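(* If $n\ge 2$, then $$\mathcal{Q}(\mathbb{B}^n)=\overline{\mathcal{Q}(\mathbb{B}^n)\cap\mathcal{A}(\mathbb{B}^n)}\quad\text{and}\quad \widetilde{\mathcal{Q}}(\mathbb{B}^n)=\overline{\widetilde{\mathcal{Q}}(\mathbb{B}^n)\cap\mathcal{A}(\mathbb{B}^n)}.$$
   Context: $\mathbb{B}^n$ is the open Euclidean unit ball of $\mathbb{C}^n$. $H(\mathbb{B}^n)$ is the space of holomorphic mappings $\mathbb{B}^n\to\mathbb{C}^n$ with the topology of locally uniform convergence; overlines denote closures in $H(\mathbb{B}^n)$. Linear operators on $\mathbb{C}^n$ carry the operator norm induced by the Euclidean norm. $\mathcal{Q}(\mathbb{B}^n)=\{f\in H(\mathbb{B}^n): f(0)=0,\ Df(0)=I_n,\ \|Df(z)-I_n\|<1 \text{ for all } z\in\mathbb{B}^n\}$. $\widetilde{\mathcal{Q}}(\mathbb{B}^n)$ is the set of all $f\in\mathcal{Q}(\mathbb{B}^n)$ with power series expansion $f(z)=z+\sum_{k=2}^\infty A_k(z^k)$, $z\in\mathbb{B}^n$, such that $\sum_{k=2}^\infty k\|A_k\|\le 1$. Here $A_k=\frac{1}{k!}D^kf(0)$ is a symmetric $k$-linear map, $A_k(z^k)=A_k(z,\dots,z)$, and $\|A_k\|$ is the norm of the $k$-linear map $A_k$. $\mathrm{Aut}(\mathbb{C}^n)$ is the set of holomorphic automorphisms of $\mathbb{C}^n$ and $\mathcal{A}(\mathbb{B}^n)=\{\Phi|_{\mathbb{B}^n}:\Phi\in\mathrm{Aut}(\mathbb{C}^n)\}$.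 *)

theory Defs
  imports "HOL-Analysis.Analysis"
begin

type_synonym 'n selfmap = "complex ^ 'n \<Rightarrow> complex ^ 'n"

abbreviation unit_ball :: "(complex ^ 'n) set"
  where "unit_ball \<equiv> ball 0 1"

text \<open>Complex Frechet differentiability: the (real) Frechet derivative exists and is
  complex-linear. Only used for open \<open>S\<close>.\<close>

definition holomorphic_map_on :: "'n::finite selfmap \<Rightarrow> (complex ^ 'n) set \<Rightarrow> bool"
  where "holomorphic_map_on f S \<longleftrightarrow>
    (\<forall>z\<in>S. \<exists>f'. (f has_derivative f') (at z) \<and> Vector_Spaces.linear (*s) (*s) f')"

text \<open>A map defined on the ball only is represented by the total function that is
  \<open>undefined\<close> outside the ball, so that equality in \<open>hol_maps\<close> is equality on the ball.\<close>

definition hol_maps :: "'n::finite selfmap set"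
  where "hol_maps = {f \<in> extensional unit_ball. holomorphic_map_on f unit_ball}"

definition hol_topology :: "'n::finite selfmap topology"
  where "hol_topology = topology (\<lambda>U. U \<subseteq> hol_maps \<and>
    (\<forall>f\<in>U. \<exists>K e. compact K \<and> K \<subseteq> unit_ball \<and> e > 0 \<and>
       (\<forall>g\<in>hol_maps. (\<forall>z\<in>K. dist (g z) (f z) < e) \<longrightarrow> g \<in> U)))"

lemma openin_hol_topology:
  fixes U :: "'n::finite selfmap set"
  shows "openin hol_topology U \<longleftrightarrow> U \<subseteq> hol_maps \<and>
    (\<forall>f\<in>U. \<exists>K e. compact K \<and> K \<subseteq> unit_ball \<and> e > 0 \<and>
       (\<forall>g\<in>hol_maps. (\<forall>z\<in>K. dist (g z) (f z) < e) \<longrightarrow> g \<in> U))"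
proof -
  let ?P = "\<lambda>(f :: 'n selfmap) U K e. compact K \<and> K \<subseteq> unit_ball \<and> e > 0 \<and>
       (\<forall>g\<in>hol_maps. (\<forall>z\<in>K. dist (g z) (f z) < e) \<longrightarrow> g \<in> U)"
  have "istopology (\<lambda>U. U \<subseteq> hol_maps \<and> (\<forall>f\<in>U. \<exists>K e. ?P f U K e))"
    unfolding istopology_def
  proof (intro conjI allI impI ballI)
    fix S T f
    assume S: "S \<subseteq> hol_maps \<and> (\<forall>f\<in>S. \<exists>K e. ?P f S K e)"
      and T: "T \<subseteq> hol_maps \<and> (\<forall>f\<in>T. \<exists>K e. ?P f T K e)"
      and f: "f \<in> S \<inter> T"
    obtain K e where K: "?P f S K e" using S f by blast
    obtain L d where L: "?P f T L d" using T f by blast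
    have "?P f (S \<inter> T) (K \<union> L) (min e d)"
      using K L by auto
    then show "\<exists>K e. ?P f (S \<inter> T) K e" by blast
  next
    fix \<K> f
    assume *: "\<forall>S\<in>\<K>. S \<subseteq> hol_maps \<and> (\<forall>f\<in>S. \<exists>K e. ?P f S K e)" and "f \<in> \<Union>\<K>"
    then obtain S where S: "S \<in> \<K>" "f \<in> S" by blast
    then have "\<exists>K e. ?P f S K e" using * by simp
    then obtain K e where "?P f S K e" by (elim exE)
    then have "?P f (\<Union>\<K>) K e" using \<open>S \<in> \<K>\<close> by simp (meson UnionI)
    then show "\<exists>K e. ?P f (\<Union>\<K>) K e" by (intro exI)
  qed auto
  then show ?thesis
    unfolding hol_topology_def by (simp only: topology_inverse')
qed

lemma topspace_hol_topology: "topspace hol_topology = hol_maps"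
proof -
  have "openin hol_topology hol_maps"
    unfolding openin_hol_topology
    by (auto intro!: exI[of _ "{}"] exI[of _ "1::real"])
  then show ?thesis
    using openin_hol_topology openin_topspace openin_subset by (metis subset_antisym)
qed

lemma hol_maps_continuous_on: "f \<in> hol_maps \<Longrightarrow> continuous_on unit_ball f"
  by (rule continuous_at_imp_continuous_on)
    (auto simp: hol_maps_def holomorphic_map_on_def dest!: bspec dest: has_derivative_continuous)

text \<open>Convergence in \<open>hol_topology\<close> is locally uniform convergence.\<close>

lemma limitin_hol_topology:
  "limitin hol_topology h f F \<longleftrightarrow>
    f \<in> hol_maps \<and> eventually (\<lambda>i. h i \<in> hol_maps) F \<and>
    (\<forall>K. compact K \<and> K \<subseteq> unit_ball \<longrightarrow> uniform_limit K h f F)"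
proof (intro iffI conjI allI impI)
  assume lim: "limitin hol_topology h f F"
  show f: "f \<in> hol_maps"
    using lim by (simp add: limitin_def topspace_hol_topology)
  show "eventually (\<lambda>i. h i \<in> hol_maps) F"
    using lim f openin_topspace[of hol_topology]
    unfolding limitin_def topspace_hol_topology by blast
  fix K :: "(complex ^ 'a) set"
  assume K: "compact K \<and> K \<subseteq> unit_ball"
  show "uniform_limit K h f F"
    unfolding uniform_limit_iff
  proof (intro allI impI)
    fix e :: real assume e: "e > 0"
    define U where "U = {g \<in> hol_maps. \<forall>z\<in>K. dist (g z) (f z) < e}"
    have slack: "\<exists>d>0. \<forall>z\<in>K. dist (g z) (f z) + d \<le> e" if g: "g \<in> U" for g
    proof (cases "K = {}")
      case False
      have "continuous_on K (\<lambda>z. dist (g z) (f z))"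
        using hol_maps_continuous_on f g K unfolding U_def
        by (auto intro!: continuous_intros intro: continuous_on_subset)
      then obtain w where "w \<in> K" "\<forall>z\<in>K. dist (g z) (f z) \<le> dist (g w) (f w)"
        using continuous_attains_sup[of K] K False by blast
      then show ?thesis
        using g by (intro exI[of _ "e - dist (g w) (f w)"]) (auto simp: U_def)
    qed (auto intro: exI[of _ "1::real"])
    have "openin hol_topology U"
      unfolding openin_hol_topology
    proof (intro conjI ballI)
      fix g assume "g \<in> U"
      then obtain d where d: "d > 0" "\<forall>z\<in>K. dist (g z) (f z) + d \<le> e"
        using slack by blast
      have "g' \<in> U" if "g' \<in> hol_maps" "\<forall>z\<in>K. dist (g' z) (g z) < d" for g'
      proof -
        have "dist (g' z) (f z) < e" if "z \<in> K" for z
          using that d \<open>\<forall>z\<in>K. dist (g' z) (g z) < d\<close> dist_triangle[of "g' z" "f z" "g z"]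
          by fastforce
        then show ?thesis
          using \<open>g' \<in> hol_maps\<close> by (simp add: U_def)
      qed
      with K d(1) show "\<exists>K d. compact K \<and> K \<subseteq> unit_ball \<and> d > 0 \<and>
          (\<forall>g'\<in>hol_maps. (\<forall>z\<in>K. dist (g' z) (g z) < d) \<longrightarrow> g' \<in> U)"
        by blast
    qed (auto simp: U_def)
    moreover have "f \<in> U" using f e by (simp add: U_def)
    ultimately have "eventually (\<lambda>i. h i \<in> U) F"
      using lim unfolding limitin_def by blast
    then show "\<forall>\<^sub>F i in F. \<forall>z\<in>K. dist (h i z) (f z) < e"
      by eventually_elim (simp add: U_def)
  qed
next
  assume R: "f \<in> hol_maps \<and> eventually (\<lambda>i. h i \<in> hol_maps) F \<and>
    (\<forall>K. compact K \<and> K \<subseteq> unit_ball \<longrightarrow> uniform_limit K h f F)"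
  show "limitin hol_topology h f F"
    unfolding limitin_def topspace_hol_topology
  proof (intro conjI allI impI)
    show "f \<in> hol_maps" using R by blast
    fix U assume "openin hol_topology U \<and> f \<in> U"
    then obtain K e where K: "compact K" "K \<subseteq> unit_ball" "e > 0"
      "\<forall>g\<in>hol_maps. (\<forall>z\<in>K. dist (g z) (f z) < e) \<longrightarrow> g \<in> U"
      unfolding openin_hol_topology by blast
    have "\<forall>\<^sub>F i in F. \<forall>z\<in>K. dist (h i z) (f z) < e"
      using R K unfolding uniform_limit_iff by blast
    moreover have "eventually (\<lambda>i. h i \<in> hol_maps) F" using R by blast
    ultimately show "eventually (\<lambda>i. h i \<in> U) F"
      by eventually_elim (use K in blast)
  qed
qed

definition Q_ball :: "'n::finite selfmap set"
  where "Q_ball = {f \<in> hol_maps. f 0 = 0 \<and> frechet_derivative f (at 0) = id \<and>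
    (\<forall>z\<in>unit_ball. onorm (\<lambda>v. frechet_derivative f (at z) v - v) < 1)}"

text \<open>\<open>higher_deriv f [v\<^sub>1, \<dots>, v\<^sub>k] z\<close> is $D^k f(z)(v_1,\dots,v_k)$, by
  $D^k f(z)(v_1,\dots,v_k) = D\bigl(w \mapsto D^{k-1} f(w)(v_2,\dots,v_k)\bigr)(z)(v_1)$.\<close>

fun higher_deriv :: "'n::finite selfmap \<Rightarrow> (complex ^ 'n) list \<Rightarrow> 'n selfmap"
  where
    "higher_deriv f [] z = f z"
  | "higher_deriv f (v # vs) z = frechet_derivative (higher_deriv f vs) (at z) v"

text \<open>The map $A_k = \frac{1}{k!} D^k f(0)$ is \<open>taylor_coeff f\<close> on lists of length \<open>k\<close>.\<close>

definition taylor_coeff :: "'n::finite selfmap \<Rightarrow> (complex ^ 'n) list \<Rightarrow> complex ^ 'n"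
  where "taylor_coeff f vs = higher_deriv f vs 0 /\<^sub>R fact (length vs)"

definition multilinear_norm :: "nat \<Rightarrow> ((complex ^ 'n::finite) list \<Rightarrow> complex ^ 'n) \<Rightarrow> real"
  where "multilinear_norm k A =
    (SUP vs \<in> {vs. length vs = k \<and> (\<forall>v\<in>set vs. norm v \<le> 1)}. norm (A vs))"

definition Q_tilde_ball :: "'n::finite selfmap set"
  where "Q_tilde_ball = {f \<in> Q_ball.
    (\<forall>z\<in>unit_ball. (\<lambda>k. taylor_coeff f (replicate (k + 2) z)) sums (f z - z)) \<and>
    summable (\<lambda>k. real (k + 2) * multilinear_norm (k + 2) (taylor_coeff f)) \<and>
    (\<Sum>k. real (k + 2) * multilinear_norm (k + 2) (taylor_coeff f)) \<le> 1}"

definition Aut_space :: "'n::finite selfmap set"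
  where "Aut_space = {\<Phi>. bij \<Phi> \<and> holomorphic_map_on \<Phi> UNIV \<and> holomorphic_map_on (inv \<Phi>) UNIV}"

definition A_ball :: "'n::finite selfmap set"
  where "A_ball = (\<lambda>\<Phi>. restrict \<Phi> unit_ball) ` Aut_space"

end

theory Submission
  imports Defs "HOL-Complex_Analysis.Complex_Analysis" "HOL-Real_Asymp.Real_Asymp"
begin

text \<open>Closedness: locally uniform convergence carries over to derivatives and Taylor
  coefficients, and the Schwarz lemma improves \<open>\<parallel>Df(z) - I\<parallel> \<le> 1\<close> to \<open>\<parallel>Df(z) - I\<parallel> \<le> \<parallel>z\<parallel> < 1\<close>.

  Density: for \<open>f = id + g\<close> in \<open>\<Q>\<close> the maps \<open>F\<^sub>l z = l z + g z\<close>, \<open>l \<ge> 1\<close>, form a Loewner chain that joins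
  \<open>f\<close> to a multiple of the identity, and its transition maps are generated by holomorphic vector fields
  \<^emph>\<open>on the ball\<close>. In dimension at least 2 all such fields are limits of sums of shear and overshear fields
  (Andersen and Lempert), hence an Euler scheme produces automorphisms close to \<open>f\<close> on smaller balls.
  Passing to \<open>f(\<rho> z) / \<rho>\<close> with \<open>\<rho> < 1\<close> and normalizing at the origin puts the approximants into \<open>\<Q>\<close>. They
  lie in the second class because \<open>\<parallel>A\<^sub>k\<parallel>\<close> is bounded by the supremum of \<open>A\<^sub>k(z\<^sup>k)\<close> on the unit ball up to a
  factor of subexponential growth in \<open>k\<close>.\<close>

text \<open>Neither class survives a small perturbation by itself: the bound on
  \<open>Df - I\<close> may come arbitrarily close to 1, and the weighted sum may equal 1. The
  dilation creates the room. It gives the bound \<open>\<rho>\<close> for the derivative and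
  multiplies the coefficient of degree k by \<open>\<rho>^(k-1)\<close>, so both conditions hold
  with slack \<open>1 - \<rho>\<close>. The approximation error on a ball of radius r must fit into
  this slack even when summed over all degrees with weight k, which calls for r > 1; but the dilated
  map need only be holomorphic up to radius \<open>1/\<rho>\<close>, so r is barely larger than 1.
  The factor \<open>k^k/k!\<close> of the polarization formula grows like \<open>e^k\<close> and
  would ruin the sum; only a subexponential factor is affordable. Flows are never integrated. A
  field counts as generated by automorphisms if small Euler steps \<open>z + s w(z)\<close> are
  automorphisms up to an error o(s) on every ball. Errors of successive steps merely add up, because
  it is the composites \<open>F\<^sub>l \<circ> \<Psi>\<close> that are compared with
  \<open>f\<close> and because the iterates stay in one ball.\<close>

no_notation fps_nth (infixl "$" 75)

section \<open>Holomorphic maps of several variables\<close>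

abbreviation fderiv :: "'n::finite selfmap \<Rightarrow> complex ^ 'n \<Rightarrow> complex ^ 'n \<Rightarrow> complex ^ 'n"
  where "fderiv f z \<equiv> frechet_derivative f (at z)"

section \<open>Complex scalar multiplication of vectors\<close>

lemma norm_vector_scalar_mult [simp]:
  fixes v :: "complex ^ 'n::finite"
  shows "norm (c *s v) = norm c * norm v"
proof -
  have "(\<Sum>i\<in>UNIV. (norm c * norm (v $ i))\<^sup>2) = (norm c)\<^sup>2 * (\<Sum>i\<in>UNIV. (norm (v $ i))\<^sup>2)"
    by (simp only: power_mult_distrib sum_distrib_left)
  then show ?thesis
    by (simp add: norm_vec_def L2_set_def norm_mult real_sqrt_mult)
qed

lemma scaleR_eq_vector_scalar_mult:
  fixes v :: "complex ^ 'n::finite"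
  shows "r *\<^sub>R v = of_real r *s v"
  by (simp add: vec_eq_iff) (simp add: scaleR_conv_of_real)

lemma bounded_bilinear_vector_scalar_mult:
  "bounded_bilinear (\<lambda>c (v :: complex ^ 'n::finite). c *s v)"
proof (intro bounded_bilinear.intro exI allI)
  show "norm (c *s v) \<le> norm c * norm v * 1" for c and v :: "complex ^ 'n" by simp
qed (simp_all add: vec_eq_iff algebra_simps)

lemmas has_derivative_vector_scalar_mult [derivative_intros] =
  bounded_bilinear.FDERIV [OF bounded_bilinear_vector_scalar_mult]
lemmas tendsto_vector_scalar_mult [tendsto_intros] =
  bounded_bilinear.tendsto [OF bounded_bilinear_vector_scalar_mult]
lemmas continuous_on_vector_scalar_mult [continuous_intros] =
  bounded_bilinear.continuous_on [OF bounded_bilinear_vector_scalar_mult]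

text \<open>Estimates for maps are reduced to coordinates in this way, where one-variable complex
  analysis applies. The loss of a factor that depends on the dimension alone is affordable.\<close>

lemma norm_vec_le_card:
  fixes v :: "complex ^ 'n::finite"
  assumes "\<And>i. norm (v $ i) \<le> M"
  shows "norm v \<le> real CARD('n) * M"
proof -
  have "norm v \<le> (\<Sum>i\<in>UNIV. norm (v $ i))"
    by (simp add: norm_vec_def L2_set_le_sum)
  also have "\<dots> \<le> (\<Sum>i\<in>(UNIV::'n set). M)" by (intro sum_mono assms)
  finally show ?thesis by simp
qed

section \<open>Complex differentiability and its calculus\<close>

lemma holomorphic_mapI:
  assumes "\<And>z. z \<in> S \<Longrightarrow> \<exists>f'. (f has_derivative f') (at z) \<and> (\<forall>c v. f' (c *s v) = c *s f' v)"
  shows "holomorphic_map_on f S"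
  unfolding holomorphic_map_on_def
proof
  fix z assume "z \<in> S"
  then obtain f' where f': "(f has_derivative f') (at z)" "\<forall>c v. f' (c *s v) = c *s f' v"
    using assms by blast
  \<comment> \<open>Additivity comes with the real derivative, so complex homogeneity is all that
    has to be supplied.\<close>
  have "\<forall>x y. f' (x + y) = f' x + f' y"
    using linear_add[OF has_derivative_linear[OF f'(1)]] by blast
  then show "\<exists>f'. (f has_derivative f') (at z) \<and> Vector_Spaces.linear (*s) (*s) f'"
    using f' by (intro exI[of _ f']) (auto simp: Vector_Spaces.linear_iff vec.vector_space_axioms)
qed

lemma holomorphic_mapI':
  assumes "\<And>z. z \<in> S \<Longrightarrow> (f has_derivative F z) (at z)"
    and "\<And>z c v. z \<in> S \<Longrightarrow> F z (c *s v) = c *s F z v"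
  shows "holomorphic_map_on f S"
  using assms by (intro holomorphic_mapI) blast

context
  fixes f :: "'n::finite selfmap" and S z
  assumes f: "holomorphic_map_on f S" and z: "z \<in> S"
begin

lemma holomorphic_map_has_derivative: "(f has_derivative fderiv f z) (at z)"
  using f z frechet_derivative_works differentiableI unfolding holomorphic_map_on_def by blast

lemma fderiv_linear: "Vector_Spaces.linear (*s) (*s) (fderiv f z)"
  using f z frechet_derivative_at unfolding holomorphic_map_on_def by metis

lemma fderiv_vector_scalar_mult: "fderiv f z (c *s v) = c *s fderiv f z v"
  using fderiv_linear by (rule vec.linear_scale)

lemma fderiv_add: "fderiv f z (v + w) = fderiv f z v + fderiv f z w"
  using fderiv_linear by (rule vec.linear_add)

lemma fderiv_minus: "fderiv f z (- v) = - fderiv f z v"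
  using fderiv_linear by (rule vec.linear_neg)

lemma fderiv_zero: "fderiv f z 0 = 0"
  using fderiv_linear by (rule vec.linear_0)

lemma fderiv_sum: "fderiv f z (sum g A) = (\<Sum>i\<in>A. fderiv f z (g i))"
  using fderiv_linear by (rule vec.linear_sum)

end

lemma fderiv_eqI: "(f has_derivative f') (at z) \<Longrightarrow> fderiv f z = f'"
  by (simp add: frechet_derivative_at[symmetric])

lemma holomorphic_map_subset: "holomorphic_map_on f T \<Longrightarrow> S \<subseteq> T \<Longrightarrow> holomorphic_map_on f S"
  unfolding holomorphic_map_on_def by blast

lemma holomorphic_map_continuous_on: "holomorphic_map_on f S \<Longrightarrow> continuous_on S f"
  by (rule continuous_at_imp_continuous_on)
    (auto dest: holomorphic_map_has_derivative has_derivative_continuous)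

text \<open>\<open>frechet_derivative\<close> is a choice among the derivatives at the point, and
  maps that agree nearby have the same candidates. Hence the \<open>undefined\<close> values outside
  the ball do no harm.\<close>

lemma fderiv_cong_open:
  assumes "open S" "z \<in> S" "\<And>x. x \<in> S \<Longrightarrow> f x = g x"
  shows "fderiv f z = fderiv g z"
  unfolding frechet_derivative_def
proof -
  have "(f has_derivative F) (at z) \<longleftrightarrow> (g has_derivative F) (at z)" for F
    using has_derivative_transform_within_open[of _ F z UNIV S] assms by (metis)
  then show "(SOME f'. (f has_derivative f') (at z)) = (SOME f'. (g has_derivative f') (at z))"
    by simp
qed

lemma holomorphic_map_cong_open:
  assumes "open S" "\<And>x. x \<in> S \<Longrightarrow> f x = g x"
  shows "holomorphic_map_on f S \<longleftrightarrow> holomorphic_map_on g S"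
  unfolding holomorphic_map_on_def
proof -
  have "(f has_derivative F) (at z) \<longleftrightarrow> (g has_derivative F) (at z)" if "z \<in> S" for F z
    using has_derivative_transform_within_open[of _ F z UNIV S] assms that by (metis)
  then show "(\<forall>z\<in>S. \<exists>f'. (f has_derivative f') (at z) \<and> Vector_Spaces.linear (*s) (*s) f') \<longleftrightarrow>
    (\<forall>z\<in>S. \<exists>f'. (g has_derivative f') (at z) \<and> Vector_Spaces.linear (*s) (*s) f')"
    by simp
qed

lemma holomorphic_map_const [simp]: "holomorphic_map_on (\<lambda>z. c) S"
  by (rule holomorphic_mapI'[of _ _ "\<lambda>z v. 0"]) auto

lemma holomorphic_map_ident [simp]: "holomorphic_map_on (\<lambda>z. z) S"
  by (rule holomorphic_mapI'[of _ _ "\<lambda>z v. v"]) auto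

lemma holomorphic_map_add:
  assumes "holomorphic_map_on f S" "holomorphic_map_on g S"
  shows "holomorphic_map_on (\<lambda>z. f z + g z) S"
  by (rule holomorphic_mapI'[of _ _ "\<lambda>z v. fderiv f z v + fderiv g z v"])
    (auto intro!: derivative_intros holomorphic_map_has_derivative assms
      simp: fderiv_vector_scalar_mult[OF assms(1)] fderiv_vector_scalar_mult[OF assms(2)] vec.scale_right_distrib)

text \<open>\<open>holomorphic_map_on\<close> speaks of self-maps of the vector space, so a
  holomorphic scalar factor is represented as a component of such a map, and a constant factor as a
  component of a constant map.\<close>

lemma holomorphic_map_component_mult:
  assumes "holomorphic_map_on f S" "holomorphic_map_on g S"
  shows "holomorphic_map_on (\<lambda>z. f z $ i *s g z) S"
proof (rule holomorphic_mapI'[of _ _ "\<lambda>z v. f z $ i *s fderiv g z v + fderiv f z v $ i *s g z"])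
  show "((\<lambda>z. f z $ i *s g z) has_derivative
      (\<lambda>v. f z $ i *s fderiv g z v + fderiv f z v $ i *s g z)) (at z)" if "z \<in> S" for z
    using that
    by (auto intro!: derivative_eq_intros bounded_linear.has_derivative[OF bounded_linear_vec_nth]
        holomorphic_map_has_derivative assms)
qed (simp add: fderiv_vector_scalar_mult[OF assms(1)] fderiv_vector_scalar_mult[OF assms(2)]
    vec_eq_iff algebra_simps)

lemma holomorphic_map_cmult:
  assumes "holomorphic_map_on f S"
  shows "holomorphic_map_on (\<lambda>z. c *s f z) S"
  using holomorphic_map_component_mult[OF holomorphic_map_const[of "\<chi> i. c"] assms] by simp

lemma holomorphic_map_minus:
  "holomorphic_map_on f S \<Longrightarrow> holomorphic_map_on (\<lambda>z. - f z) S"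
  using holomorphic_map_cmult[of f S "-1"] by simp

lemma holomorphic_map_diff:
  "holomorphic_map_on f S \<Longrightarrow> holomorphic_map_on g S \<Longrightarrow> holomorphic_map_on (\<lambda>z. f z - g z) S"
  using holomorphic_map_add[of f S "\<lambda>z. - g z"] holomorphic_map_minus[of g S] by simp

lemma holomorphic_map_sum:
  "(\<And>i. i \<in> A \<Longrightarrow> holomorphic_map_on (f i) S) \<Longrightarrow> holomorphic_map_on (\<lambda>z. \<Sum>i\<in>A. f i z) S"
  by (induction A rule: infinite_finite_induct) (auto intro: holomorphic_map_add)

lemma holomorphic_map_compose:
  assumes g: "holomorphic_map_on g T" and f: "holomorphic_map_on f S" and "f ` S \<subseteq> T"
  shows "holomorphic_map_on (\<lambda>z. g (f z)) S"
    and "z \<in> S \<Longrightarrow> fderiv (\<lambda>z. g (f z)) z v = fderiv g (f z) (fderiv f z v)"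
proof -
  have *: "((\<lambda>z. g (f z)) has_derivative (\<lambda>v. fderiv g (f z) (fderiv f z v))) (at z)"
    if "z \<in> S" for z
    using has_derivative_compose[OF holomorphic_map_has_derivative[OF f that]
        holomorphic_map_has_derivative[OF g]] that assms(3) by blast
  show "holomorphic_map_on (\<lambda>z. g (f z)) S"
    using assms by (intro holomorphic_mapI'[OF *])
      (auto simp: fderiv_vector_scalar_mult[OF f] fderiv_vector_scalar_mult[OF g])
  show "z \<in> S \<Longrightarrow> fderiv (\<lambda>z. g (f z)) z v = fderiv g (f z) (fderiv f z v)"
    using fderiv_eqI[OF *] by simp
qed

lemma holomorphic_map_linear:
  assumes "Vector_Spaces.linear (*s) (*s) (L :: 'n::finite selfmap)"
  shows "(L has_derivative L) (at z)" "holomorphic_map_on L S"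
proof -
  have "linear L"
    using assms by (intro linearI) (auto simp: vec.linear_add vec.linear_scale scaleR_eq_vector_scalar_mult)
  then show *: "(L has_derivative L) (at z)" for z
    by (simp add: linear_conv_bounded_linear bounded_linear_imp_has_derivative)
  show "holomorphic_map_on L S"
    by (rule holomorphic_mapI'[OF *]) (use assms vec.linear_scale in blast)
qed

lemma fderiv_add_fun:
  assumes "holomorphic_map_on f S" "holomorphic_map_on g S" "z \<in> S"
  shows "fderiv (\<lambda>z. f z + g z) z v = fderiv f z v + fderiv g z v"
  using fderiv_eqI[OF has_derivative_add[OF assms(1,2)[THEN holomorphic_map_has_derivative, OF assms(3)]]]
  by simp

lemma fderiv_diff_fun:
  assumes "holomorphic_map_on f S" "holomorphic_map_on g S" "z \<in> S"
  shows "fderiv (\<lambda>z. f z - g z) z v = fderiv f z v - fderiv g z v"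
  using fderiv_eqI[OF has_derivative_diff[OF assms(1,2)[THEN holomorphic_map_has_derivative, OF assms(3)]]]
  by simp

lemma fderiv_cmult_fun:
  assumes "holomorphic_map_on f S" "z \<in> S"
  shows "fderiv (\<lambda>z. c *s f z) z v = c *s fderiv f z v"
proof -
  have "((\<lambda>z. c *s f z) has_derivative (\<lambda>v. c *s fderiv f z v)) (at z)"
    using holomorphic_map_has_derivative[OF assms]
    by (intro bounded_linear.has_derivative[OF bounded_bilinear.bounded_linear_right[OF bounded_bilinear_vector_scalar_mult]])
  from fderiv_eqI[OF this] show ?thesis by simp
qed

section \<open>Restriction to complex lines and Cauchy estimates\<close>

lemma slice_has_field_derivative:
  assumes "holomorphic_map_on f S" "z + \<zeta> *s v \<in> S"
  shows "((\<lambda>\<zeta>. f (z + \<zeta> *s v) $ i) has_field_derivative fderiv f (z + \<zeta> *s v) v $ i) (at \<zeta>)"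
proof -
  have "((\<lambda>\<zeta>. z + \<zeta> *s v) has_derivative (\<lambda>t. t *s v)) (at \<zeta>)"
    by (auto intro!: derivative_eq_intros)
  then have "((\<lambda>\<zeta>. f (z + \<zeta> *s v)) has_derivative (\<lambda>t. fderiv f (z + \<zeta> *s v) (t *s v))) (at \<zeta>)"
    by (rule has_derivative_compose) (rule holomorphic_map_has_derivative[OF assms])
  then have "((\<lambda>\<zeta>. f (z + \<zeta> *s v) $ i) has_derivative (\<lambda>t. fderiv f (z + \<zeta> *s v) (t *s v) $ i)) (at \<zeta>)"
    by (rule bounded_linear.has_derivative[OF bounded_linear_vec_nth])
  \<comment> \<open>Complex linearity turns \<open>t \<mapsto> Df(t v)\<close> into multiplication
    by a single complex number.\<close>
  then show ?thesis
    unfolding has_field_derivative_def fderiv_vector_scalar_mult[OF assms]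
    by (simp add: mult.commute[of _ "fderiv f (z + \<zeta> *s v) v $ i"])
qed

lemma slice_holomorphic_on:
  assumes "holomorphic_map_on f S" "\<And>\<zeta>. \<zeta> \<in> T \<Longrightarrow> z + \<zeta> *s v \<in> S"
  shows "(\<lambda>\<zeta>. f (z + \<zeta> *s v) $ i) holomorphic_on T"
  unfolding holomorphic_on_def field_differentiable_def
  using slice_has_field_derivative[OF assms(1) assms(2)] has_field_derivative_at_within by blast

lemma holomorphic_coeff_bound:
  assumes "\<phi> holomorphic_on ball 0 \<rho>" "continuous_on (cball 0 \<rho>) \<phi>" "\<rho> > 0"
    and "\<And>\<zeta>. norm \<zeta> \<le> \<rho> \<Longrightarrow> norm (\<phi> \<zeta>) \<le> M"
  shows "norm ((deriv ^^ k) \<phi> 0 / fact k) \<le> M / \<rho> ^ k"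
proof -
  have "norm ((deriv ^^ k) \<phi> 0) \<le> fact k * M / \<rho> ^ k"
    by (rule Cauchy_inequality) (use assms in auto)
  then show ?thesis
    by (simp add: norm_divide field_simps)
qed

text \<open>By Cauchy's inequality the tail of the power series is dominated by a geometric series
  with ratio \<open>norm \<zeta> / \<rho>\<close>.\<close>

lemma holomorphic_taylor_remainder:
  assumes "\<phi> holomorphic_on ball 0 \<rho>" "continuous_on (cball 0 \<rho>) \<phi>" "\<rho> > 0"
    and "\<And>\<zeta>. norm \<zeta> \<le> \<rho> \<Longrightarrow> norm (\<phi> \<zeta>) \<le> M" and "norm \<zeta> < \<rho>"
  shows "norm (\<phi> \<zeta> - (\<Sum>j<k. (deriv ^^ j) \<phi> 0 / fact j * \<zeta> ^ j))
    \<le> M * (norm \<zeta> / \<rho>) ^ k / (1 - norm \<zeta> / \<rho>)"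
proof -
  let ?a = "\<lambda>j. (deriv ^^ j) \<phi> 0 / fact j * \<zeta> ^ j" and ?q = "norm \<zeta> / \<rho>"
  have q: "0 \<le> ?q" "?q < 1" using assms by auto
  have "?a sums \<phi> \<zeta>"
    using holomorphic_power_series[OF assms(1), of \<zeta>] assms by simp
  then have tail: "(\<lambda>j. ?a (j + k)) sums (\<phi> \<zeta> - sum ?a {..<k})"
    by (rule sums_split_initial_segment)
  have geo: "(\<lambda>j. M * ?q ^ k * ?q ^ j) sums (M * ?q ^ k * (1 / (1 - ?q)))"
    using q by (intro sums_mult geometric_sums) auto
  have "norm (?a (j + k)) \<le> M * ?q ^ k * ?q ^ j" for j
  proof -
    have "norm (?a (j + k)) \<le> M / \<rho> ^ (j + k) * norm \<zeta> ^ (j + k)"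
      unfolding norm_mult norm_power
      by (intro mult_right_mono holomorphic_coeff_bound assms) auto
    then show ?thesis by (simp add: power_divide power_add mult_ac)
  qed
  then have "norm (suminf (\<lambda>j. ?a (j + k))) \<le> (\<Sum>j. M * ?q ^ k * ?q ^ j)"
    by (intro norm_suminf_le[OF _ sums_summable[OF geo]] order_refl)
  then show ?thesis
    using sums_unique[OF tail] sums_unique[OF geo] by simp
qed

lemma slice_cball:
  fixes z :: "complex ^ 'n::finite"
  assumes "v \<noteq> 0" "norm \<zeta> \<le> r / norm v"
  shows "z + \<zeta> *s v \<in> cball z r"
  using assms by (simp add: dist_norm field_simps)

text \<open>Only values on one complex disc enter, not those on a full ball. The sharper estimate in
  directions orthogonal to \<open>z\<close> rests on this.\<close>

lemma fderiv_slice_bound: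
  fixes f :: "'n::finite selfmap"
  assumes f: "holomorphic_map_on f S" and \<rho>: "\<rho> > 0"
    and M: "\<And>\<zeta>. norm \<zeta> \<le> \<rho> \<Longrightarrow> z + \<zeta> *s v \<in> S \<and> norm (f (z + \<zeta> *s v)) \<le> M"
  shows "norm (fderiv f z v) \<le> real CARD('n) * (M / \<rho>)"
proof (rule norm_vec_le_card)
  fix i
  let ?\<phi> = "\<lambda>\<zeta>. f (z + \<zeta> *s v) $ i"
  have hol: "?\<phi> holomorphic_on cball 0 \<rho>"
    by (rule slice_holomorphic_on[OF f]) (use M in auto)
  have "norm ((deriv ^^ 1) ?\<phi> 0 / fact 1) \<le> M / \<rho> ^ 1"
  proof (rule holomorphic_coeff_bound)
    show "norm (?\<phi> \<zeta>) \<le> M" if "norm \<zeta> \<le> \<rho>" for \<zeta>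
      using M[OF that] order_trans[OF Finite_Cartesian_Product.norm_nth_le] by blast
  qed (use hol \<rho> in \<open>auto intro: holomorphic_on_subset holomorphic_on_imp_continuous_on\<close>)
  moreover have "z \<in> S" using M[of 0] \<rho> by simp
  then have "deriv ?\<phi> 0 = fderiv f z v $ i"
    using slice_has_field_derivative[OF f, of z 0 v i] by (auto intro!: DERIV_imp_deriv)
  ultimately show "norm (fderiv f z v $ i) \<le> M / \<rho>" by simp
qed

lemma holomorphic_map_fderiv_bound:
  fixes f :: "'n::finite selfmap"
  assumes f: "holomorphic_map_on f S" and S: "cball z r \<subseteq> S" and r: "r > 0"
    and M: "\<And>x. x \<in> cball z r \<Longrightarrow> norm (f x) \<le> M"
  shows "norm (fderiv f z v) \<le> real CARD('n) * M / r * norm v"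
proof (cases "v = 0")
  case True
  moreover have "z \<in> S" using S r by auto
  moreover have "0 \<le> M" using M[of z] r order_trans[OF norm_ge_zero] by auto
  ultimately show ?thesis using fderiv_zero[OF f, of z] by simp
next
  case False
  have "norm (fderiv f z v) \<le> real CARD('n) * (M / (r / norm v))"
    by (rule fderiv_slice_bound[OF f]) (use slice_cball[OF False] S M r False in auto)
  then show ?thesis by simp
qed

text \<open>Taylor's formula for the slice through \<open>z\<close> in direction \<open>v\<close>,
  at parameter 1. The disc has radius \<open>r / norm v\<close>, which is at least 2, so the
  geometric series contributes a factor of at most 2.\<close>

lemma holomorphic_map_second_order:
  fixes f :: "'n::finite selfmap"
  assumes f: "holomorphic_map_on f S" and S: "cball z r \<subseteq> S" and r: "r > 0"
    and M: "\<And>x. x \<in> cball z r \<Longrightarrow> norm (f x) \<le> M" and v: "norm v \<le> r / 2"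
  shows "norm (f (z + v) - f z - fderiv f z v) \<le> real CARD('n) * (2 * M * (norm v / r)\<^sup>2)"
proof (cases "v = 0")
  case True
  moreover have "z \<in> S" using S r by auto
  moreover have "0 \<le> M" using M[of z] r order_trans[OF norm_ge_zero] by auto
  ultimately show ?thesis using fderiv_zero[OF f, of z] by simp
next
  case False
  have zS: "z \<in> S" using S r by auto
  define \<rho> where "\<rho> = r / norm v"
  have \<rho>: "\<rho> > 0" "\<rho> \<ge> 2" using r False v by (auto simp: \<rho>_def field_simps)
  have M0: "0 \<le> M" using M[of z] r norm_ge_zero[of "f z"] by (simp del: norm_ge_zero)
  show ?thesis
  proof (rule norm_vec_le_card)
    fix i
    let ?\<phi> = "\<lambda>\<zeta>. f (z + \<zeta> *s v) $ i"
    have hol: "?\<phi> holomorphic_on cball 0 \<rho>"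
      by (rule slice_holomorphic_on[OF f]) (use slice_cball[OF False] S in \<open>auto simp: \<rho>_def\<close>)
    have "norm (?\<phi> 1 - (\<Sum>j<2. (deriv ^^ j) ?\<phi> 0 / fact j * 1 ^ j))
        \<le> M * (norm (1::complex) / \<rho>) ^ 2 / (1 - norm (1::complex) / \<rho>)"
    proof (rule holomorphic_taylor_remainder)
      show "norm (?\<phi> \<zeta>) \<le> M" if "norm \<zeta> \<le> \<rho>" for \<zeta>
        using M[OF slice_cball[OF False, of \<zeta> r z]] that
          order_trans[OF Finite_Cartesian_Product.norm_nth_le] by (auto simp: \<rho>_def)
    qed (use hol \<rho> in \<open>auto intro: holomorphic_on_subset holomorphic_on_imp_continuous_on\<close>)
    also have "\<dots> \<le> M * (1 / \<rho>)\<^sup>2 / (1 / 2)"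
      using \<rho> M0 by (intro frac_le mult_nonneg_nonneg) (auto simp: field_simps)
    also have "\<dots> = 2 * M * (norm v / r)\<^sup>2" by (simp add: \<rho>_def)
    finally have "norm (?\<phi> 1 - (\<Sum>j<2. (deriv ^^ j) ?\<phi> 0 / fact j * 1 ^ j)) \<le> 2 * M * (norm v / r)\<^sup>2" .
    moreover have "deriv ?\<phi> 0 = fderiv f z v $ i"
      using slice_has_field_derivative[OF f, of z 0 v i] zS by (auto intro!: DERIV_imp_deriv)
    ultimately show "norm ((f (z + v) - f z - fderiv f z v) $ i) \<le> 2 * M * (norm v / r)\<^sup>2"
      by (simp add: numeral_2_eq_2 algebra_simps)
  qed
qed

section \<open>Weierstrass's convergence theorem and holomorphy of derivatives\<close>

lemma holomorphic_map_uniform_limit_at: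
  fixes f :: "nat \<Rightarrow> 'n::finite selfmap"
  assumes hol: "eventually (\<lambda>n. holomorphic_map_on (f n) (cball z r)) sequentially" and r: "r > 0"
    and lim: "uniform_limit (cball z r) f g sequentially"
  obtains g' where "(g has_derivative g') (at z)" "\<And>c v. g' (c *s v) = c *s g' v"
proof -
  let ?n = "real CARD('n)"
  obtain N where N: "\<And>n. n \<ge> N \<Longrightarrow> holomorphic_map_on (f n) (cball z r)"
    using hol unfolding eventually_sequentially by blast
  define h where "h n = f (n + N)" for n
  have hol: "holomorphic_map_on (h n) (cball z r)" for n by (simp add: h_def N)
  have lim: "uniform_limit (cball z r) h g sequentially"
    using lim unfolding h_def
    by (rule filterlim_compose) (rule filterlim_add_const_nat_at_top)
  define T where "T = ball z (r / 2)"
  have sub: "cball x (r / 2) \<subseteq> cball z r" if "x \<in> T" for x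
  proof
    fix y assume "y \<in> cball x (r / 2)"
    then show "y \<in> cball z r"
      using that dist_triangle[of z y x] by (simp add: T_def)
  qed
  have TS: "T \<subseteq> cball z r" using r by (auto simp: T_def)
  \<comment> \<open>Cauchy's estimate on balls of radius \<open>r / 2\<close> turns uniform
    closeness of the maps into uniform closeness of the derivatives, which is what
    \<open>has_derivative_sequence\<close> asks for. The 4 in \<open>d\<close> pays for the two maps
    and the halved radius.\<close>
  have cau: "\<exists>N. \<forall>m\<ge>N. \<forall>n\<ge>N. \<forall>x\<in>T. \<forall>v. norm (fderiv (h m) x v - fderiv (h n) x v) \<le> e * norm v"
    if e: "e > 0" for e
  proof -
    define d where "d = e * r / (4 * ?n)"
    have d: "d > 0" using e r by (simp add: d_def)
    obtain K where K: "\<And>n x. n \<ge> K \<Longrightarrow> x \<in> cball z r \<Longrightarrow> dist (h n x) (g x) < d"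
      using lim d unfolding uniform_limit_iff eventually_sequentially by blast
    show ?thesis
    proof (intro exI[of _ K] allI impI ballI)
      fix m n x v assume mn: "K \<le> m" "K \<le> n" and x: "x \<in> T"
      have hd: "holomorphic_map_on (\<lambda>z. h m z - h n z) (cball z r)"
        by (intro holomorphic_map_diff hol)
      have "norm (fderiv (\<lambda>z. h m z - h n z) x v) \<le> ?n * (2 * d) / (r / 2) * norm v"
      proof (rule holomorphic_map_fderiv_bound[OF hd sub[OF x]])
        fix y assume "y \<in> cball x (r / 2)"
        then have "y \<in> cball z r" using sub[OF x] by blast
        then have "dist (h m y) (g y) < d" "dist (h n y) (g y) < d" using K mn by auto
        then have "dist (h m y) (h n y) \<le> 2 * d"
          using dist_triangle2[of "h m y" "h n y" "g y"] by linarith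
        then show "norm (h m y - h n y) \<le> 2 * d" by (simp add: dist_norm)
      qed (use r in auto)
      also have "?n * (2 * d) / (r / 2) = e" using r by (simp add: d_def)
      also have "fderiv (\<lambda>z. h m z - h n z) x v = fderiv (h m) x v - fderiv (h n) x v"
        by (rule fderiv_diff_fun[OF hol hol]) (use x TS in auto)
      finally show "norm (fderiv (h m) x v - fderiv (h n) x v) \<le> e * norm v" .
    qed
  qed
  have "Cauchy (\<lambda>n. fderiv (h n) x v)" if x: "x \<in> T" for x v
  proof (rule CauchyI)
    fix e :: real assume "e > 0"
    then have "e / (norm v + 1) > 0" by (simp add: add_nonneg_pos)
    from cau[OF this] x obtain K where
      K: "\<And>m n. m \<ge> K \<Longrightarrow> n \<ge> K \<Longrightarrow> norm (fderiv (h m) x v - fderiv (h n) x v) \<le> e / (norm v + 1) * norm v"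
      by blast
    have "e / (norm v + 1) * norm v < e" using \<open>e > 0\<close> by (simp add: divide_simps add_nonneg_pos)
    then show "\<exists>M. \<forall>m\<ge>M. \<forall>n\<ge>M. norm (fderiv (h m) x v - fderiv (h n) x v) < e"
      using K by (intro exI[of _ K] allI impI) (blast intro: le_less_trans)
  qed
  then have conv: "convergent (\<lambda>n. fderiv (h n) x v)" if "x \<in> T" for x v
    using that by (simp add: Cauchy_convergent_iff)
  define g' where "g' x v = lim (\<lambda>n. fderiv (h n) x v)" for x v
  have g': "(\<lambda>n. fderiv (h n) x v) \<longlonglongrightarrow> g' x v" if "x \<in> T" for x v
    using conv[OF that] by (simp add: g'_def convergent_LIMSEQ_iff)
  have zT: "z \<in> T" using r by (simp add: T_def)
  have ptw: "(\<lambda>n. h n x) \<longlonglongrightarrow> g x" if "x \<in> T" for x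
    using tendsto_uniform_limitI[OF lim] that TS by blast
  have "\<exists>G. \<forall>x\<in>T. (\<lambda>n. h n x) \<longlonglongrightarrow> G x \<and> (G has_derivative g' x) (at x within T)"
  proof (rule has_derivative_sequence)
    show "z \<in> T" by (rule zT)
    show "(\<lambda>n. h n z) \<longlonglongrightarrow> g z" by (rule ptw[OF zT])
    show "convex T" by (simp add: T_def)
    show "(h n has_derivative fderiv (h n) x) (at x within T)" if "x \<in> T" for n x
      using holomorphic_map_has_derivative[OF hol] that TS has_derivative_at_withinI by blast
    fix e :: real assume "e > 0"
    from cau[OF this] obtain K where
      K: "\<And>m n x v. m \<ge> K \<Longrightarrow> n \<ge> K \<Longrightarrow> x \<in> T \<Longrightarrow> norm (fderiv (h m) x v - fderiv (h n) x v) \<le> e * norm v"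
      by blast
    have "norm (fderiv (h m) x v - g' x v) \<le> e * norm v" if "m \<ge> K" "x \<in> T" for m x v
    proof (rule Lim_bounded)
      show "(\<lambda>n. norm (fderiv (h m) x v - fderiv (h n) x v)) \<longlonglongrightarrow> norm (fderiv (h m) x v - g' x v)"
        by (intro tendsto_intros g' that)
    qed (use K that in auto)
    then show "\<forall>\<^sub>F n in sequentially. \<forall>x\<in>T. \<forall>v. norm (fderiv (h n) x v - g' x v) \<le> e * norm v"
      unfolding eventually_sequentially by blast
  qed
  then obtain G where G: "\<And>x. x \<in> T \<Longrightarrow> (\<lambda>n. h n x) \<longlonglongrightarrow> G x"
    "\<And>x. x \<in> T \<Longrightarrow> (G has_derivative g' x) (at x within T)" by blast
  have Gg: "G x = g x" if "x \<in> T" for x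
    using LIMSEQ_unique[OF G(1) ptw] that by blast
  have "(G has_derivative g' z) (at z)"
    using G(2)[OF zT] at_within_open[OF zT] by (simp add: T_def)
  then have "(g has_derivative g' z) (at z)"
    by (rule has_derivative_transform_within_open[of _ _ _ _ T]) (use zT Gg in \<open>auto simp: T_def\<close>)
  moreover have "g' z (c *s v) = c *s g' z v" for c v
  proof (rule LIMSEQ_unique[OF g'[OF zT]])
    have "fderiv (h n) z (c *s v) = c *s fderiv (h n) z v" for n
      by (rule fderiv_vector_scalar_mult[OF hol]) (use r in auto)
    then show "(\<lambda>n. fderiv (h n) z (c *s v)) \<longlonglongrightarrow> c *s g' z v"
      by (auto intro!: tendsto_intros g' zT)
  qed
  ultimately show ?thesis using that by blast
qed

lemma cball_subset_open:
  fixes S :: "(complex ^ 'n::finite) set"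
  assumes "open S" "z \<in> S"
  obtains r where "r > 0" "cball z r \<subseteq> S"
  using open_contains_cball assms by blast

lemma holomorphic_map_bounded_cball:
  fixes f :: "'n::finite selfmap"
  assumes "holomorphic_map_on f S" "cball z r \<subseteq> S"
  obtains M where "M \<ge> 0" "\<And>x. x \<in> cball z r \<Longrightarrow> norm (f x) \<le> M"
proof -
  have "bounded (f ` cball z r)"
    by (intro compact_imp_bounded compact_continuous_image compact_cball
        continuous_on_subset[OF holomorphic_map_continuous_on[OF assms(1)] assms(2)])
  then obtain M where "\<And>x. x \<in> cball z r \<Longrightarrow> norm (f x) \<le> M"
    unfolding bounded_iff by blast
  then show ?thesis
    using that[of "max M 0"] by (simp add: le_max_iff_disj)
qed

text \<open>The difference quotients with step \<open>1/m\<close> are holomorphic near the point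
  and, by the second-order estimate, converge uniformly with error O(1/m); Weierstrass's theorem
  does the rest.\<close>

lemma holomorphic_map_fderiv:
  fixes f :: "'n::finite selfmap"
  assumes S: "open S" and f: "holomorphic_map_on f S"
  shows "holomorphic_map_on (\<lambda>z. fderiv f z v) S"
proof (rule holomorphic_mapI)
  fix z assume "z \<in> S"
  then obtain r0 where r0: "r0 > 0" "cball z r0 \<subseteq> S" using cball_subset_open S by blast
  define r where "r = r0 / 2"
  have r: "r > 0" using r0 by (simp add: r_def)
  have sub: "cball x r \<subseteq> cball z r0" if "x \<in> cball z r" for x
  proof
    fix y assume "y \<in> cball x r"
    then show "y \<in> cball z r0"
      using that dist_triangle[of z y x] by (simp add: r_def)
  qed
  obtain M where M: "M \<ge> 0" "\<And>x. x \<in> cball z r0 \<Longrightarrow> norm (f x) \<le> M"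
    using holomorphic_map_bounded_cball[OF f r0(2)] by blast
  define h where "h m x = of_nat m *s (f (x + inverse (of_nat m) *s v) - f x)" for m x
  have ev: "eventually (\<lambda>m. m > 0 \<and> norm v / real m < r / 2) sequentially"
  proof (intro eventually_conj eventually_gt_at_top)
    have "((\<lambda>m. norm v / real m) \<longlongrightarrow> 0) sequentially" by real_asymp
    then show "eventually (\<lambda>m. norm v / real m < r / 2) sequentially"
      using r by (intro order_tendstoD(2)) auto
  qed
  have small: "norm (inverse (of_nat m) *s v) = norm v / real m" for m
    by (simp add: norm_inverse divide_inverse mult.commute)
  have mem: "x + inverse (of_nat m) *s v \<in> cball x r"
    if "norm v / real m < r / 2" for x m
  proof -
    have "0 \<le> norm v / real m" by simp
    with that have "norm v / real m \<le> r" by linarith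
    then show ?thesis
      unfolding mem_cball by (simp add: dist_norm small del: norm_vector_scalar_mult)
  qed
  have hol: "holomorphic_map_on (h m) (cball z r)" if m: "m > 0 \<and> norm v / real m < r / 2" for m
  proof -
    have 1: "holomorphic_map_on (\<lambda>x. x + inverse (of_nat m) *s v) (cball z r)"
      by (intro holomorphic_map_add) auto
    have "(\<lambda>x. x + inverse (of_nat m) *s v) ` cball z r \<subseteq> S"
      using sub mem m r0(2) by blast
    note 2 = holomorphic_map_compose(1)[OF f 1 this]
    have "cball z r \<subseteq> S" using sub[of z] r r0 by auto
    from holomorphic_map_diff[OF 2 holomorphic_map_subset[OF f this]] show ?thesis
      unfolding h_def[abs_def] by (rule holomorphic_map_cmult)
  qed
  have est: "norm (h m x - fderiv f x v) \<le> real CARD('n) * (2 * M * (norm v / r)\<^sup>2) / real m"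
    if m: "m > 0 \<and> norm v / real m < r / 2" and x: "x \<in> cball z r" for m x
  proof -
    have cS: "cball x r \<subseteq> S" using sub[OF x] r0(2) by (rule subset_trans)
    then have xS: "x \<in> S" using r by auto
    have "h m x - fderiv f x v = of_nat m *s (f (x + inverse (of_nat m) *s v) - f x
        - fderiv f x (inverse (of_nat m) *s v))"
      using m by (simp add: h_def fderiv_vector_scalar_mult[OF f xS] vec_eq_iff field_simps)
    then have "norm (h m x - fderiv f x v) = real m * norm (f (x + inverse (of_nat m) *s v) - f x
        - fderiv f x (inverse (of_nat m) *s v))"
      by (simp only: norm_vector_scalar_mult norm_of_nat)
    also have "\<dots> \<le> real m * (real CARD('n) * (2 * M * (norm (inverse (of_nat m) *s v) / r)\<^sup>2))"
    proof (intro mult_left_mono holomorphic_map_second_order[OF f cS r])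
      show "norm (f y) \<le> M" if "y \<in> cball x r" for y using M sub[OF x] that by blast
      show "norm (inverse (of_nat m) *s v) \<le> r / 2" using m small by simp
    qed auto
    also have "\<dots> = real CARD('n) * (2 * M * (norm v / r)\<^sup>2) / real m"
      using m unfolding small by (simp add: field_simps power2_eq_square)
    finally show ?thesis .
  qed
  have "uniform_limit (cball z r) h (\<lambda>x. fderiv f x v) sequentially"
    unfolding uniform_limit_iff
  proof (intro allI impI)
    fix e :: real assume e: "e > 0"
    have "((\<lambda>m. real CARD('n) * (2 * M * (norm v / r)\<^sup>2) / real m) \<longlongrightarrow> 0) sequentially" by real_asymp
    then have "eventually (\<lambda>m. real CARD('n) * (2 * M * (norm v / r)\<^sup>2) / real m < e) sequentially"
      using e by (intro order_tendstoD(2)) auto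
    with ev show "\<forall>\<^sub>F m in sequentially. \<forall>x\<in>cball z r. dist (h m x) (fderiv f x v) < e"
      by eventually_elim (use est in \<open>fastforce simp: dist_norm\<close>)
  qed
  moreover have "eventually (\<lambda>m. holomorphic_map_on (h m) (cball z r)) sequentially"
    using ev by eventually_elim (use hol in blast)
  ultimately show "\<exists>f'. ((\<lambda>z. fderiv f z v) has_derivative f') (at z) \<and> (\<forall>c v. f' (c *s v) = c *s f' v)"
    by (rule_tac holomorphic_map_uniform_limit_at[OF _ r]) auto
qed

section \<open>Iterated directional derivatives\<close>

lemma holomorphic_map_higher_deriv:
  "open S \<Longrightarrow> holomorphic_map_on f S \<Longrightarrow> holomorphic_map_on (higher_deriv f vs) S"
proof (induction vs)
  case Nil
  then show ?case by (simp add: higher_deriv.simps[abs_def])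
next
  case (Cons v vs)
  then show ?case
    using holomorphic_map_fderiv[of S "higher_deriv f vs" v] by (simp add: higher_deriv.simps(2)[abs_def])
qed

lemma higher_deriv_cong_open:
  assumes "open S" "z \<in> S" "\<And>x. x \<in> S \<Longrightarrow> f x = g x"
  shows "higher_deriv f vs z = higher_deriv g vs z"
  using assms(2)
proof (induction vs arbitrary: z)
  case (Cons v vs)
  then show ?case using fderiv_cong_open[OF assms(1) Cons.prems, of "higher_deriv f vs" "higher_deriv g vs"]
    by simp
qed (use assms in auto)

lemma higher_deriv_add:
  assumes S: "open S" and "holomorphic_map_on f S" "holomorphic_map_on g S" and "z \<in> S"
  shows "higher_deriv (\<lambda>z. f z + g z) vs z = higher_deriv f vs z + higher_deriv g vs z"
  using assms(4)
proof (induction vs arbitrary: z)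
  case (Cons v vs)
  have "fderiv (higher_deriv (\<lambda>z. f z + g z) vs) z v
      = fderiv (\<lambda>z. higher_deriv f vs z + higher_deriv g vs z) z v"
    using fderiv_cong_open[OF S Cons.prems Cons.IH] by simp
  also have "\<dots> = fderiv (higher_deriv f vs) z v + fderiv (higher_deriv g vs) z v"
    using assms Cons.prems by (intro fderiv_add_fun[of _ S] holomorphic_map_higher_deriv)
  finally show ?case by simp
qed auto

lemma fderiv_cmult_scale:
  assumes S: "open S" and f: "holomorphic_map_on f S" and z: "c *s z \<in> S"
  shows "holomorphic_map_on (\<lambda>z. a *s f (c *s z)) {z. c *s z \<in> S}"
    and "fderiv (\<lambda>z. a *s f (c *s z)) z v = (a * c) *s fderiv f (c *s z) v"
proof -
  let ?T = "{z. c *s z \<in> S}"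
  have sc: "holomorphic_map_on (\<lambda>z. c *s z) ?T"
    by (intro holomorphic_map_cmult) simp
  have im: "(\<lambda>z. c *s z) ` ?T \<subseteq> S" by blast
  note comp = holomorphic_map_compose[OF f sc im]
  show "holomorphic_map_on (\<lambda>z. a *s f (c *s z)) ?T"
    by (intro holomorphic_map_cmult comp)
  have "fderiv (\<lambda>z. c *s z) z v = c *s v"
    using fderiv_cmult_fun[OF holomorphic_map_ident UNIV_I, of c z v]
    by (simp add: fderiv_eqI[OF has_derivative_ident])
  then show "fderiv (\<lambda>z. a *s f (c *s z)) z v = (a * c) *s fderiv f (c *s z) v"
    using fderiv_cmult_fun[OF comp(1), of z a v] comp(2)[of z v] z
    by (simp add: fderiv_vector_scalar_mult[OF f z])
qed

text \<open>Serves the dilation \<open>f(c z)/c\<close>: with \<open>a = 1/c\<close>, the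
  coefficient of degree k picks up the factor \<open>c^(k-1)\<close>.\<close>

lemma higher_deriv_cmult_scale:
  assumes S: "open S" and f: "holomorphic_map_on f S" and "c *s z \<in> S"
  shows "higher_deriv (\<lambda>z. a *s f (c *s z)) vs z = (a * c ^ length vs) *s higher_deriv f vs (c *s z)"
  using assms(3)
proof (induction vs arbitrary: z)
  case (Cons v vs)
  have "open ((\<lambda>z. c *s z) -` S)"
    by (intro open_vimage[OF S] continuous_intros)
  then have T: "open {z. c *s z \<in> S}" by (simp add: vimage_def)
  have "fderiv (higher_deriv (\<lambda>z. a *s f (c *s z)) vs) z v
      = fderiv (\<lambda>z. (a * c ^ length vs) *s higher_deriv f vs (c *s z)) z v"
    using fderiv_cong_open[OF T, of z "higher_deriv (\<lambda>z. a *s f (c *s z)) vs"] Cons by simp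
  also have "\<dots> = (a * c ^ length vs * c) *s fderiv (higher_deriv f vs) (c *s z) v"
    by (rule fderiv_cmult_scale(2)[OF S holomorphic_map_higher_deriv[OF S f] Cons.prems])
  finally show ?case by (simp add: mult_ac)
qed auto

text \<open>Links homogeneous parts to one-variable Taylor coefficients and so to Cauchy's
  inequality.\<close>

lemma slice_higher_deriv:
  assumes S: "open S" and f: "holomorphic_map_on f S" and "\<zeta> *s z \<in> S"
  shows "(deriv ^^ k) (\<lambda>\<zeta>. f (\<zeta> *s z) $ i) \<zeta> = higher_deriv f (replicate k z) (\<zeta> *s z) $ i"
  using assms(3)
proof (induction k arbitrary: \<zeta>)
  case (Suc k)
  let ?H = "higher_deriv f (replicate k z)"
  have "open ((\<lambda>\<zeta>. \<zeta> *s z) -` S)"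
    by (intro open_vimage[OF S] continuous_intros)
  then have T: "open {\<zeta>. \<zeta> *s z \<in> S}" by (simp add: vimage_def)
  have "((\<lambda>\<zeta>. ?H (\<zeta> *s z) $ i) has_field_derivative fderiv ?H (\<zeta> *s z) z $ i) (at \<zeta>)"
    using slice_has_field_derivative[OF holomorphic_map_higher_deriv[OF S f], of 0 \<zeta> z "replicate k z" i] Suc.prems
    by simp
  then have "((deriv ^^ k) (\<lambda>\<zeta>. f (\<zeta> *s z) $ i) has_field_derivative fderiv ?H (\<zeta> *s z) z $ i) (at \<zeta>)"
    by (rule has_field_derivative_transform_within_open[OF _ T]) (use Suc in auto)
  then show ?case by (simp add: DERIV_imp_deriv)
qed auto

section \<open>Homogeneous expansions\<close>

abbreviation hpart :: "'n::finite selfmap \<Rightarrow> nat \<Rightarrow> 'n selfmap"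
  where "hpart f k z \<equiv> taylor_coeff f (replicate k z)"

lemma taylor_coeff_Nil [simp]: "taylor_coeff f [] = f 0"
  by (simp add: taylor_coeff_def)

lemma taylor_coeff_replicate_zero:
  assumes "open S" "holomorphic_map_on f S" "0 \<in> S"
  shows "hpart f (Suc k) 0 = 0"
  using fderiv_zero[OF holomorphic_map_higher_deriv[OF assms(1,2)] assms(3)]
  by (simp add: taylor_coeff_def)

lemma taylor_coeff_slice:
  assumes "open S" "holomorphic_map_on f S" "0 \<in> S"
  shows "hpart f k z $ i = (deriv ^^ k) (\<lambda>\<zeta>. f (\<zeta> *s z) $ i) 0 / fact k"
  using slice_higher_deriv[OF assms(1,2), of 0 z k i] assms(3)
  by (simp add: taylor_coeff_def) (simp add: scaleR_conv_of_real divide_inverse mult.commute)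

lemma higher_deriv_replicate_cmult:
  assumes S: "open S" and f: "holomorphic_map_on f S" and "w \<in> S"
  shows "higher_deriv f (replicate k (c *s z)) w = c ^ k *s higher_deriv f (replicate k z) w"
  using assms(3)
proof (induction k arbitrary: w)
  case (Suc k)
  note hol = holomorphic_map_higher_deriv[OF S f]
  have "fderiv (higher_deriv f (replicate k (c *s z))) w (c *s z)
      = fderiv (\<lambda>w. c ^ k *s higher_deriv f (replicate k z) w) w (c *s z)"
    using fderiv_cong_open[OF S Suc.prems Suc.IH] by simp
  also have "\<dots> = (c ^ k * c) *s fderiv (higher_deriv f (replicate k z)) w z"
    by (simp add: fderiv_cmult_fun[OF hol Suc.prems] fderiv_vector_scalar_mult[OF hol Suc.prems])
  finally show ?case by (simp add: mult.commute)
qed auto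

lemma taylor_coeff_replicate_cmult:
  assumes "open S" "holomorphic_map_on f S" "0 \<in> S"
  shows "hpart f k (c *s z) = c ^ k *s hpart f k z"
  using higher_deriv_replicate_cmult[OF assms, of k c z]
  by (simp add: taylor_coeff_def vec_eq_iff)

context
  fixes f :: "'n::finite selfmap" and S :: "(complex ^ 'n) set" and r M :: real
  assumes S: "open S" and f: "holomorphic_map_on f S" and r: "r > 0" and rS: "cball 0 r \<subseteq> S"
    and M: "\<And>x. norm x \<le> r \<Longrightarrow> norm (f x) \<le> M"
begin

lemma slice_bound:
  assumes "z \<noteq> 0"
  defines "\<rho> \<equiv> r / norm z"
  shows "\<rho> > 0" "(\<lambda>\<zeta>. f (\<zeta> *s z) $ i) holomorphic_on ball 0 \<rho>"
    "continuous_on (cball 0 \<rho>) (\<lambda>\<zeta>. f (\<zeta> *s z) $ i)"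
    "norm \<zeta> \<le> \<rho> \<Longrightarrow> norm (f (\<zeta> *s z) $ i) \<le> M"
proof -
  show \<rho>: "\<rho> > 0" using r assms by simp
  have le: "norm (\<zeta> *s z) \<le> r" if "norm \<zeta> \<le> \<rho>" for \<zeta>
    using that assms by (simp add: field_simps)
  have "(\<lambda>\<zeta>. f (0 + \<zeta> *s z) $ i) holomorphic_on cball 0 \<rho>"
    by (rule slice_holomorphic_on[OF f]) (use le rS in auto)
  then show "(\<lambda>\<zeta>. f (\<zeta> *s z) $ i) holomorphic_on ball 0 \<rho>"
    "continuous_on (cball 0 \<rho>) (\<lambda>\<zeta>. f (\<zeta> *s z) $ i)"
    by (auto intro: holomorphic_on_subset holomorphic_on_imp_continuous_on)
  show "norm (f (\<zeta> *s z) $ i) \<le> M" if "norm \<zeta> \<le> \<rho>"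
    using M[OF le[OF that]] order_trans[OF Finite_Cartesian_Product.norm_nth_le] by blast
qed

lemma sup_bound_nonneg: "0 \<le> M"
  using M[of 0] r order_trans[OF norm_ge_zero] by auto

lemma zero_mem_domain: "0 \<in> S" using r rS by auto

lemma homogeneous_part_bound:
  "norm (hpart f k z) \<le> real CARD('n) * (M * (norm z / r) ^ k)"
proof (cases "z = 0")
  case True
  \<comment> \<open>At the origin there is no slice of finite radius. In degree 0 something remains
    to be bounded, because \<open>0 ^ 0 = 1\<close>.\<close>
  have "norm (f 0) \<le> 1 * M" using M[of 0] r by simp
  also have "\<dots> \<le> real CARD('n) * M" by (intro mult_right_mono sup_bound_nonneg) simp
  finally show ?thesis
    using True taylor_coeff_replicate_zero[OF S f zero_mem_domain] by (cases k) auto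
next
  case False
  have "norm (hpart f k z $ i) \<le> M / (r / norm z) ^ k" for i
    unfolding taylor_coeff_slice[OF S f zero_mem_domain]
    by (rule holomorphic_coeff_bound) (use slice_bound[OF False] in auto)
  from norm_vec_le_card[OF this] show ?thesis by (simp add: power_divide field_simps)
qed

lemma homogeneous_expansion_remainder:
  assumes "norm z < r"
  shows "norm (f z - (\<Sum>j<k. hpart f j z))
    \<le> real CARD('n) * (M * (norm z / r) ^ k / (1 - norm z / r))"
proof (cases "z = 0")
  case True
  have "norm (f 0) \<le> 1 * M" using M[of 0] r by simp
  also have "\<dots> \<le> real CARD('n) * M" by (intro mult_right_mono sup_bound_nonneg) simp
  finally show ?thesis
    using True taylor_coeff_replicate_zero[OF S f zero_mem_domain]
    by (cases k) (auto simp: sum.lessThan_Suc_shift simp del: sum.lessThan_Suc)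
next
  case False
  have "norm ((f z - (\<Sum>j<k. hpart f j z)) $ i)
      \<le> M * (norm (1::complex) / (r / norm z)) ^ k / (1 - norm (1::complex) / (r / norm z))" for i
  proof -
    \<comment> \<open>\<open>z\<close> is the point of the slice with parameter 1, inside the disc
      of radius \<open>r / norm z > 1\<close>.\<close>
    have "norm (f (1 *s z) $ i - (\<Sum>j<k. (deriv ^^ j) (\<lambda>\<zeta>. f (\<zeta> *s z) $ i) 0 / fact j * 1 ^ j))
       \<le> M * (norm (1::complex) / (r / norm z)) ^ k / (1 - norm (1::complex) / (r / norm z))"
      by (rule holomorphic_taylor_remainder)
        (use slice_bound[OF False] assms False in \<open>auto simp: field_simps\<close>)
    then show ?thesis
      by (simp add: taylor_coeff_slice[OF S f zero_mem_domain])
  qed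
  from norm_vec_le_card[OF this] show ?thesis by simp
qed

lemma homogeneous_expansion_sums:
  assumes "norm z < r"
  shows "(\<lambda>k. hpart f k z) sums f z"
  unfolding sums_def
proof (rule Lim_transform)
  show "(\<lambda>k. f z) \<longlonglongrightarrow> f z" by simp
  have q: "0 \<le> norm z / r" "norm z / r < 1" using assms r by auto
  show "(\<lambda>k. (\<Sum>j<k. hpart f j z) - f z) \<longlonglongrightarrow> 0"
  proof (rule Lim_null_comparison)
    show "eventually (\<lambda>k. norm ((\<Sum>j<k. hpart f j z) - f z)
        \<le> real CARD('n) * (M * (norm z / r) ^ k / (1 - norm z / r))) sequentially"
      using homogeneous_expansion_remainder[OF assms] by (simp add: norm_minus_commute)
    show "(\<lambda>k. real CARD('n) * (M * (norm z / r) ^ k / (1 - norm z / r))) \<longlonglongrightarrow> 0"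
      using q by (auto intro!: tendsto_eq_intros LIMSEQ_power_zero simp del: divide_less_eq_1_pos)
  qed
qed

text \<open>Here \<open>z\<close> fills the direction slots of the iterated derivative, so
  holomorphy is not inherited from \<open>higher_deriv\<close>. Instead, by strong induction,
  subtract from \<open>f(z/m)\<close> its parts of degree below \<open>k\<close> and multiply by
  \<open>m^k\<close>: these maps are holomorphic, and the remainder estimate shows that they
  converge to the part of degree \<open>k\<close> locally uniformly, with error O(1/m). Symmetry and
  multilinearity of the derivatives do not enter.\<close>

lemma holomorphic_map_homogeneous_part:
  "holomorphic_map_on (\<lambda>z. hpart f k z) UNIV"
proof (induction k rule: less_induct)
  case (less k)
  show ?case
  proof (rule holomorphic_mapI)
    fix z :: "complex ^ 'n"
    define X where "X = norm z + 1"
    have X: "X > 0" by (simp add: X_def add_nonneg_pos)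
    have le: "norm x \<le> X" if "x \<in> cball z 1" for x
      using that norm_triangle_ineq2[of x z] by (simp add: X_def dist_norm norm_minus_commute)
    define y where "y m x = inverse (of_nat m) *s x" for m and x :: "complex ^ 'n"
    define h where "h m x = of_nat m ^ k *s (f (y m x) - (\<Sum>j<k. hpart f j (y m x)))" for m x
    have ev: "eventually (\<lambda>m. m > 0 \<and> X / real m < r / 2) sequentially"
    proof (intro eventually_conj eventually_gt_at_top)
      have "((\<lambda>m. X / real m) \<longlongrightarrow> 0) sequentially" by real_asymp
      then show "eventually (\<lambda>m. X / real m < r / 2) sequentially"
        using r by (intro order_tendstoD(2)) auto
    qed
    have ny: "norm (y m x) \<le> X / real m" if "x \<in> cball z 1" for m x
      using mult_right_mono[OF le[OF that], of "inverse (real m)"]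
      by (simp add: y_def norm_inverse divide_inverse mult.commute)
    have hol: "holomorphic_map_on (h m) (cball z 1)" if m: "m > 0 \<and> X / real m < r / 2" for m
    proof -
      have im: "y m ` cball z 1 \<subseteq> S"
      proof
        fix w assume "w \<in> y m ` cball z 1"
        then have "norm w \<le> X / real m" using ny by auto
        then have "norm w \<le> r" using m r by linarith
        then show "w \<in> S" using rS by auto
      qed
      have yh: "holomorphic_map_on (y m) (cball z 1)"
        unfolding y_def[abs_def] by (intro holomorphic_map_cmult) simp
      show ?thesis
        unfolding h_def[abs_def]
        by (intro holomorphic_map_cmult holomorphic_map_diff holomorphic_map_sum
            holomorphic_map_compose(1)[OF f yh im] holomorphic_map_compose(1)[OF less.IH yh]) auto
    qed
    define C where "C = real CARD('n) * M * (X / r) ^ Suc k * 2"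
    have est: "norm (h m x - hpart f k x) \<le> C / real m"
      if m: "m > 0 \<and> X / real m < r / 2" and x: "x \<in> cball z 1" for m x
    proof -
      have q: "norm (y m x) / r \<le> X / r / real m" "X / r / real m \<le> 1 / 2"
        using ny[OF x, of m] m r by (auto simp: field_simps)
      have yr: "norm (y m x) < r" using ny[OF x, of m] m r by linarith
      have xy: "x = of_nat m *s y m x" using m by (simp add: y_def)
      have "hpart f k x = of_nat m ^ k *s hpart f k (y m x)"
        by (subst xy) (rule taylor_coeff_replicate_cmult[OF S f zero_mem_domain])
      then have "h m x - hpart f k x
          = of_nat m ^ k *s (f (y m x) - (\<Sum>j<Suc k. hpart f j (y m x)))"
        by (simp add: h_def vec_eq_iff algebra_simps)
      then have "norm (h m x - hpart f k x)
          = real m ^ k * norm (f (y m x) - (\<Sum>j<Suc k. hpart f j (y m x)))"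
        by (simp only: norm_vector_scalar_mult norm_power norm_of_nat)
      also have "\<dots> \<le> real m ^ k * (real CARD('n) * (M * (norm (y m x) / r) ^ Suc k / (1 - norm (y m x) / r)))"
        by (intro mult_left_mono homogeneous_expansion_remainder yr) simp
      also have "\<dots> \<le> real m ^ k * (real CARD('n) * (M * (X / r / real m) ^ Suc k / (1 / 2)))"
      proof (intro mult_left_mono frac_le)
        show "0 \<le> M * (X / r / real m) ^ Suc k"
          using X r sup_bound_nonneg by simp
        show "(norm (y m x) / r) ^ Suc k \<le> (X / r / real m) ^ Suc k"
          using q r by (intro power_mono) auto
        show "1 / 2 \<le> 1 - norm (y m x) / r" using q by linarith
      qed (use sup_bound_nonneg in auto)
      also have "\<dots> = C / real m"
        using m by (simp add: C_def power_divide field_simps)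
      finally show ?thesis .
    qed
    have "uniform_limit (cball z 1) h (\<lambda>x. hpart f k x) sequentially"
      unfolding uniform_limit_iff
    proof (intro allI impI)
      fix e :: real assume e: "e > 0"
      have "((\<lambda>m. C / real m) \<longlongrightarrow> 0) sequentially" by real_asymp
      then have "eventually (\<lambda>m. C / real m < e) sequentially"
        using e by (intro order_tendstoD(2)) auto
      with ev show "\<forall>\<^sub>F m in sequentially. \<forall>x\<in>cball z 1. dist (h m x) (hpart f k x) < e"
        by eventually_elim (use est in \<open>fastforce simp: dist_norm\<close>)
    qed
    moreover have "eventually (\<lambda>m. holomorphic_map_on (h m) (cball z 1)) sequentially"
      using ev by eventually_elim (use hol in blast)
    ultimately show "\<exists>f'. ((\<lambda>z. hpart f k z) has_derivative f') (at z) \<and>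
        (\<forall>c v. f' (c *s v) = c *s f' v)"
      by (rule_tac holomorphic_map_uniform_limit_at[of h z 1]) auto
  qed
qed

end

section \<open>Homogeneous maps and vanishing orders\<close>

definition homogeneous :: "nat \<Rightarrow> 'n::finite selfmap \<Rightarrow> bool"
  where "homogeneous k P \<longleftrightarrow> (\<forall>c z. P (c *s z) = c ^ k *s P z)"

lemma homogeneousD: "homogeneous k P \<Longrightarrow> P (c *s z) = c ^ k *s P z"
  by (simp add: homogeneous_def)

text \<open>Differentiating the homogeneity relation produces an extra factor \<open>c\<close> that
  can be cancelled only for \<open>c \<noteq> 0\<close>. The case \<open>c = 0\<close> follows by
  continuity of the derivative along \<open>c = 1/(m+1)\<close>.\<close>

lemma homogeneous_fderiv:
  assumes P: "holomorphic_map_on P UNIV" and hom: "homogeneous (Suc k) P"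
  shows "homogeneous k (\<lambda>z. fderiv P z v)"
  unfolding homogeneous_def
proof (intro allI)
  fix c z
  have *: "fderiv P (c *s z) v = c ^ k *s fderiv P z v" if "c \<noteq> 0" for c
  proof -
    have "(\<lambda>z. 1 *s P (c *s z)) = (\<lambda>z. c ^ Suc k *s P z)"
      using hom by (simp add: homogeneous_def)
    then have "fderiv (\<lambda>z. 1 *s P (c *s z)) z v = fderiv (\<lambda>z. c ^ Suc k *s P z) z v" by simp
    then have "c *s fderiv P (c *s z) v = c ^ Suc k *s fderiv P z v"
      using fderiv_cmult_scale(2)[OF open_UNIV P, of c z 1 v] fderiv_cmult_fun[OF P, of z "c ^ Suc k" v] by simp
    then show ?thesis using that by (simp add: vec_eq_iff)
  qed
  show "fderiv P (c *s z) v = c ^ k *s fderiv P z v"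
  proof (cases "c = 0")
    case True
    have cont: "isCont (\<lambda>z. fderiv P z v) w" for w
      using holomorphic_map_continuous_on[OF holomorphic_map_fderiv[OF open_UNIV P]]
      by (simp add: continuous_on_eq_continuous_at)
    let ?c = "\<lambda>m. complex_of_real (inverse (real (Suc m)))"
    have c: "?c \<longlonglongrightarrow> 0"
      using tendsto_of_real[OF LIMSEQ_inverse_real_of_nat, where ?'a=complex] by (simp only: of_real_0)
    have "(\<lambda>m. ?c m *s z) \<longlonglongrightarrow> 0 *s z"
      by (intro tendsto_intros c)
    then have "(\<lambda>m. fderiv P (?c m *s z) v) \<longlonglongrightarrow> fderiv P (0 *s z) v"
      by (rule isCont_tendsto_compose[OF cont])
    moreover have "fderiv P (?c m *s z) v = ?c m ^ k *s fderiv P z v" for m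
      by (rule *) (simp only: of_real_eq_0_iff, simp)
    moreover have "(\<lambda>m. ?c m ^ k *s fderiv P z v) \<longlonglongrightarrow> 0 ^ k *s fderiv P z v"
      by (intro tendsto_intros c)
    ultimately show ?thesis
      using True LIMSEQ_unique by simp
  qed (rule *)
qed

text \<open>Euler's identity, obtained by differentiating the slice \<open>\<zeta>^k P z\<close> at
  1.\<close>

lemma fderiv_radial:
  assumes P: "holomorphic_map_on P UNIV" and hom: "homogeneous k P"
  shows "fderiv P z z = of_nat k *s P z"
proof (simp add: vec_eq_iff, rule allI)
  fix i
  have "((\<lambda>\<zeta>. P (0 + \<zeta> *s z) $ i) has_field_derivative fderiv P z z $ i) (at 1)"
    using slice_has_field_derivative[OF P, of 0 1 z i] by simp
  moreover have "((\<lambda>\<zeta>. \<zeta> ^ k * P z $ i) has_field_derivative of_nat k * P z $ i) (at 1)"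
    by (auto intro!: derivative_eq_intros)
  ultimately show "fderiv P z z $ i = of_nat k * P z $ i"
    using DERIV_unique by (simp add: homogeneousD[OF hom])
qed

lemma homogeneous_higher_deriv:
  assumes P: "holomorphic_map_on P UNIV"
  shows "homogeneous (length vs + m) P \<Longrightarrow> homogeneous m (higher_deriv P vs)"
proof (induction vs arbitrary: m)
  case (Cons v vs)
  have "homogeneous m (\<lambda>z. fderiv (higher_deriv P vs) z v)"
    by (rule homogeneous_fderiv[OF holomorphic_map_higher_deriv[OF open_UNIV P]])
      (use Cons in auto)
  then show ?case by (simp add: homogeneous_def)
qed (simp add: homogeneous_def)

lemma homogeneous_higher_deriv_zero:
  assumes P: "holomorphic_map_on P UNIV"
  shows "homogeneous k P \<Longrightarrow> k < length vs \<Longrightarrow> higher_deriv P vs z = 0"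
proof (induction vs arbitrary: z)
  case (Cons v vs)
  have "higher_deriv P vs = (\<lambda>z. higher_deriv P vs 0)"
  proof (cases "k = length vs")
    case True
    then have "homogeneous 0 (higher_deriv P vs)"
      using homogeneous_higher_deriv[OF P, of vs 0] Cons by simp
    then show ?thesis by (metis homogeneousD power_0 vector_smult_lid vector_smult_lzero)
  qed (use Cons in \<open>auto simp: fun_eq_iff\<close>)
  then have "fderiv (higher_deriv P vs) z = (\<lambda>v. 0)"
    by (metis fderiv_eqI has_derivative_const)
  then show ?case by simp
qed simp

text \<open>The origin is left out because the estimate passes to derivatives through balls of
  radius \<open>norm z / 2\<close>, which degenerate there. The value at 0 is recovered by
  continuity in the end.\<close>

definition vanishing_order :: "nat \<Rightarrow> 'n::finite selfmap \<Rightarrow> bool"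
  where "vanishing_order m h \<longleftrightarrow>
    (\<exists>C d. d > 0 \<and> (\<forall>z. 0 < norm z \<and> norm z \<le> d \<longrightarrow> norm (h z) \<le> C * norm z ^ m))"

text \<open>On the ball of radius \<open>norm z / 2\<close> about \<open>z\<close> the norm at most
  doubles, so Cauchy's estimate costs exactly one power of \<open>norm z\<close>.\<close>

lemma vanishing_order_fderiv:
  fixes h :: "'n::finite selfmap"
  assumes S: "open S" "0 \<in> S" and h: "holomorphic_map_on h S" and "vanishing_order (Suc m) h"
  shows "vanishing_order m (\<lambda>z. fderiv h z v)"
proof -
  obtain C d where C: "d > 0" "\<And>z. 0 < norm z \<Longrightarrow> norm z \<le> d \<Longrightarrow> norm (h z) \<le> C * norm z ^ Suc m"
    using assms(4) unfolding vanishing_order_def by blast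
  obtain e where e: "e > 0" "cball 0 e \<subseteq> S" using cball_subset_open[OF S] by blast
  define d' where "d' = min d e / 2"
  have d': "d' > 0" using C e by (simp add: d'_def)
  define K where "K = real CARD('n) * (\<bar>C\<bar> * 2 ^ Suc m) * 2 * norm v"
  have "norm (fderiv h z v) \<le> K * norm z ^ m" if z: "0 < norm z" "norm z \<le> d'" for z
  proof -
    have near: "0 < norm x \<and> norm x \<le> 2 * norm z" if "x \<in> cball z (norm z / 2)" for x
    proof -
      have "norm (z - x) \<le> norm z / 2" using that by (simp add: dist_norm)
      then show ?thesis
        using norm_triangle_ineq2[of z x] norm_triangle_ineq2[of x z] z norm_minus_commute[of z x]
        by linarith
    qed
    have "norm (fderiv h z v) \<le> real CARD('n) * (\<bar>C\<bar> * (2 * norm z) ^ Suc m) / (norm z / 2) * norm v"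
    proof (rule holomorphic_map_fderiv_bound[OF h])
      show "cball z (norm z / 2) \<subseteq> S"
      proof
        fix x assume "x \<in> cball z (norm z / 2)"
        then have "norm x \<le> e" using near[of x] z by (auto simp: d'_def)
        then show "x \<in> S" using e by auto
      qed
      fix x assume x: "x \<in> cball z (norm z / 2)"
      then have "norm (h x) \<le> C * norm x ^ Suc m"
        using near[OF x] z by (intro C) (auto simp: d'_def)
      also have "\<dots> \<le> \<bar>C\<bar> * norm x ^ Suc m" by (intro mult_right_mono) auto
      also have "\<dots> \<le> \<bar>C\<bar> * (2 * norm z) ^ Suc m"
        using near[OF x] by (intro mult_left_mono power_mono) auto
      finally show "norm (h x) \<le> \<bar>C\<bar> * (2 * norm z) ^ Suc m" .
    qed (use z in auto)
    also have "\<dots> = K * norm z ^ m"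
      using z by (simp add: K_def power_mult_distrib field_simps)
    finally show ?thesis .
  qed
  then show ?thesis unfolding vanishing_order_def using d' by blast
qed

lemma vanishing_order_higher_deriv:
  assumes S: "open S" "0 \<in> S" and h: "holomorphic_map_on h S"
  shows "vanishing_order (length vs + m) h \<Longrightarrow> vanishing_order m (higher_deriv h vs)"
proof (induction vs arbitrary: m)
  case (Cons v vs)
  have "vanishing_order m (\<lambda>z. fderiv (higher_deriv h vs) z v)"
    by (rule vanishing_order_fderiv[OF S holomorphic_map_higher_deriv[OF S(1) h]])
      (use Cons in auto)
  then show ?case by (simp add: vanishing_order_def)
qed (simp add: vanishing_order_def)

lemma vanishing_order_zero:
  assumes S: "open S" "0 \<in> S" and h: "holomorphic_map_on h S" and "vanishing_order (Suc m) h"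
  shows "h 0 = 0"
proof -
  obtain C d where C: "d > 0" "\<And>z. 0 < norm z \<Longrightarrow> norm z \<le> d \<Longrightarrow> norm (h z) \<le> C * norm z ^ Suc m"
    using assms(4) unfolding vanishing_order_def by blast
  have "(h \<longlongrightarrow> 0) (at 0)"
  proof (rule Lim_null_comparison)
    show "\<forall>\<^sub>F z in at 0. norm (h z) \<le> C * norm z ^ Suc m"
      using C unfolding eventually_at by (intro exI[of _ d]) auto
    show "((\<lambda>z. C * norm z ^ Suc m) \<longlongrightarrow> 0) (at 0)"
      by (auto intro!: tendsto_eq_intros)
  qed
  moreover have "(h \<longlongrightarrow> h 0) (at 0)"
    using has_derivative_continuous[OF holomorphic_map_has_derivative[OF h S(2)]]
    by (simp add: continuous_at)
  ultimately show ?thesis by (rule tendsto_unique[OF at_neq_bot, symmetric])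
qed

text \<open>With k directions, the parts of lower degree are differentiated away, and the remainder
  beyond degree k vanishes to order k + 1 at 0. So a multilinear coefficient can be estimated on an
  entire homogeneous map, where one bound on the unit sphere scales to all of space.\<close>

lemma higher_deriv_homogeneous_part:
  fixes f :: "'n::finite selfmap"
  assumes S: "open S" and f: "holomorphic_map_on f S" and S0: "0 \<in> S"
  shows "higher_deriv f vs 0 = higher_deriv (\<lambda>z. hpart f (length vs) z) vs 0"
proof -
  define P where "P k z = hpart f k z" for k z
  define k where "k = length vs"
  obtain r where r: "r > 0" "cball 0 r \<subseteq> S" using cball_subset_open[OF S S0] by blast
  obtain M where M: "M \<ge> 0" "\<And>x. norm x \<le> r \<Longrightarrow> norm (f x) \<le> M"
    using holomorphic_map_bounded_cball[OF f r(2)] by auto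
  have PU: "holomorphic_map_on (P j) UNIV" for j
    unfolding P_def[abs_def] by (rule holomorphic_map_homogeneous_part[OF S f r M(2)])
  then have PS: "holomorphic_map_on (P j) S" for j by (rule holomorphic_map_subset) simp
  have hom: "homogeneous j (P j)" for j
    using taylor_coeff_replicate_cmult[OF S f S0] by (simp add: homogeneous_def P_def)
  have low: "higher_deriv (\<lambda>z. \<Sum>j<l. P j z) vs 0 = 0" if "l \<le> k" for l
    using that
  proof (induction l)
    case 0
    have "homogeneous 0 (\<lambda>z::complex^'n. 0::complex^'n)" by (simp add: homogeneous_def)
    from homogeneous_higher_deriv_zero[OF _ this, of vs 0] show ?case
      by (cases vs) auto
  next
    case (Suc l)
    have "higher_deriv (P l) vs 0 = 0"
      by (rule homogeneous_higher_deriv_zero[OF PU hom]) (use Suc in \<open>simp add: k_def\<close>)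
    moreover have "higher_deriv (\<lambda>z. (\<Sum>j<l. P j z) + P l z) vs 0
        = higher_deriv (\<lambda>z. \<Sum>j<l. P j z) vs 0 + higher_deriv (P l) vs 0"
      by (rule higher_deriv_add[OF S _ _ S0]) (intro holomorphic_map_sum PS)+
    ultimately show ?case using Suc by simp
  qed
  define R where "R z = f z - (\<Sum>j<Suc k. P j z)" for z
  have R: "holomorphic_map_on R S"
    unfolding R_def[abs_def] by (intro holomorphic_map_diff holomorphic_map_sum PS f)
  have "vanishing_order (Suc k) R"
    unfolding vanishing_order_def
  proof (intro exI conjI allI impI)
    show "r / 2 > 0" using r by simp
    fix z :: "complex ^ 'n" assume z: "0 < norm z \<and> norm z \<le> r / 2"
    have "norm (R z) \<le> real CARD('n) * (M * (norm z / r) ^ Suc k / (1 - norm z / r))"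
      unfolding R_def P_def by (rule homogeneous_expansion_remainder[OF S f r M(2)]) (use z r in auto)
    also have "\<dots> \<le> real CARD('n) * (M * (norm z / r) ^ Suc k / (1 / 2))"
      using z r M by (intro mult_left_mono frac_le mult_nonneg_nonneg) (auto simp: field_simps)
    also have "\<dots> = (real CARD('n) * M * 2 / r ^ Suc k) * norm z ^ Suc k"
      by (simp add: power_divide)
    finally show "norm (R z) \<le> (real CARD('n) * M * 2 / r ^ Suc k) * norm z ^ Suc k" .
  qed
  then have "vanishing_order (length vs + Suc 0) R" by (simp add: k_def)
  from vanishing_order_higher_deriv[OF S S0 R this]
  have R0: "higher_deriv R vs 0 = 0"
    by (rule vanishing_order_zero[OF S S0 holomorphic_map_higher_deriv[OF S R]])
  have "f = (\<lambda>z. ((\<Sum>j<k. P j z) + P k z) + R z)" by (simp add: R_def)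
  then have "higher_deriv f vs 0 = higher_deriv (\<lambda>z. ((\<Sum>j<k. P j z) + P k z) + R z) vs 0" by simp
  also have "\<dots> = higher_deriv (\<lambda>z. (\<Sum>j<k. P j z) + P k z) vs 0 + higher_deriv R vs 0"
    by (rule higher_deriv_add[OF S _ R S0]) (intro holomorphic_map_add holomorphic_map_sum PS)
  also have "\<dots> = higher_deriv (\<lambda>z. (\<Sum>j<k. P j z)) vs 0 + higher_deriv (P k) vs 0"
    unfolding R0 by (subst higher_deriv_add[OF S _ _ S0]) (auto intro!: holomorphic_map_sum PS)
  finally show ?thesis using low[of k] by (simp add: k_def P_def[abs_def])
qed

section \<open>Norms of Taylor coefficients\<close>

text \<open>The inner product of the type class is only the real part of this one, and orthogonality
  to the complex line through \<open>z\<close> needs both parts.\<close>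

definition hermitian :: "complex ^ 'n::finite \<Rightarrow> complex ^ 'n \<Rightarrow> complex"
  where "hermitian x y = (\<Sum>i\<in>UNIV. x $ i * cnj (y $ i))"

lemma hermitian_diff_left: "hermitian (x - y) z = hermitian x z - hermitian y z"
  by (simp add: hermitian_def algebra_simps sum_subtractf)

lemma hermitian_cmult_left: "hermitian (c *s x) z = c * hermitian x z"
  by (simp add: hermitian_def sum_distrib_left mult_ac)

lemma Re_hermitian: "Re (hermitian x y) = x \<bullet> y"
  by (simp add: hermitian_def inner_vec_def inner_complex_def)

lemma hermitian_self: "hermitian x x = of_real ((norm x)\<^sup>2)"
proof -
  have "hermitian x x = (\<Sum>i\<in>UNIV. of_real ((norm (x $ i))\<^sup>2))"
    unfolding hermitian_def by (intro sum.cong refl complex_norm_square[symmetric])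
  also have "\<dots> = of_real ((norm x)\<^sup>2)"
    by (simp add: norm_vec_def L2_set_def sum_nonneg flip: of_real_sum of_real_power)
  finally show ?thesis .
qed

text \<open>A unimodular factor \<open>c\<close> rotates the product onto the nonnegative real axis,
  where the real Cauchy-Schwarz inequality applies.\<close>

lemma norm_hermitian_le: "norm (hermitian x y) \<le> norm x * norm y"
proof (cases "hermitian x y = 0")
  case False
  define c where "c = cnj (sgn (hermitian x y))"
  have c: "norm c = 1" using False by (simp add: c_def norm_sgn)
  have "c * hermitian x y = of_real (norm (hermitian x y))"
    using False by (simp add: c_def sgn_div_norm scaleR_conv_of_real complex_norm_square[symmetric]
        power2_eq_square field_simps mult.commute[of "cnj _"])
  then have "norm (hermitian x y) = Re (hermitian (c *s x) y)"
    by (simp add: hermitian_cmult_left)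
  also have "\<dots> \<le> norm (c *s x) * norm y"
    unfolding Re_hermitian by (rule norm_cauchy_schwarz)
  finally show ?thesis by (simp add: c)
qed simp

lemma norm_add_orthogonal:
  assumes "hermitian u z = 0"
  shows "(norm (z + \<zeta> *s u))\<^sup>2 = (norm z)\<^sup>2 + (norm \<zeta>)\<^sup>2 * (norm u)\<^sup>2"
proof -
  have "(\<zeta> *s u) \<bullet> z = 0"
    using assms by (simp add: hermitian_cmult_left flip: Re_hermitian)
  then show ?thesis
    using dot_norm[of z "\<zeta> *s u"] by (simp add: inner_commute power_mult_distrib)
qed

lemma orthogonal_decomposition:
  fixes z v :: "complex ^ 'n::finite"
  assumes "z \<noteq> 0"
  obtains a u where "v = a *s z + u" "hermitian u z = 0" "norm (a *s z) \<le> norm v" "norm u \<le> norm v"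
proof -
  define a where "a = hermitian v z / of_real ((norm z)\<^sup>2)"
  define u where "u = v - a *s z"
  have u: "hermitian u z = 0"
    using assms by (simp add: u_def a_def hermitian_diff_left hermitian_cmult_left hermitian_self)
  have "hermitian u (a *s z) = 0"
    using u by (simp add: hermitian_def mult_ac flip: sum_distrib_left)
  from norm_add_orthogonal[OF this, of 1]
  have "(norm v)\<^sup>2 = (norm (a *s z))\<^sup>2 + (norm u)\<^sup>2" by (simp add: u_def)
  then have "(norm (a *s z))\<^sup>2 \<le> (norm v)\<^sup>2" "(norm u)\<^sup>2 \<le> (norm v)\<^sup>2" by simp_all
  then have "norm (a *s z) \<le> norm v" "norm u \<le> norm v"
    by (simp_all only: abs_le_square_iff[symmetric] abs_norm_cancel)
  moreover have "v = a *s z + u" by (simp add: u_def)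
  ultimately show ?thesis using that u by blast
qed

text \<open>The Cauchy estimate loses only a factor \<open>\<surd>m\<close> in directions orthogonal to \<open>z\<close>, because
  $|z + \zeta u|^2 = |z|^2 + |\zeta|^2|u|^2$ there. So, as opposed to what the polarization formula
  gives, differentiating a homogeneous map costs no exponential factor.\<close>

lemma homogeneous_fderiv_bound:
  fixes P :: "'n::finite selfmap"
  assumes P: "holomorphic_map_on P UNIV" and hom: "homogeneous (Suc k) P"
    and M: "\<And>z. norm (P z) \<le> M * norm z ^ Suc k"
  shows "norm (fderiv P z v)
    \<le> M * real (Suc k) * (1 + 2 * real CARD('n) / sqrt (real (Suc k))) * norm z ^ k * norm v"
proof -
  let ?m = "Suc k" and ?n = "real CARD('n)"
  let ?c = "1 + 2 * ?n / sqrt (real ?m)"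
  obtain e :: "complex ^ 'n" where e: "norm e = 1" using vector_choose_size[of 1] by auto
  have M0: "0 \<le> M" using M[of e] e order_trans[OF norm_ge_zero] by auto
  have *: "norm (fderiv P z v) \<le> M * real ?m * ?c * norm z ^ k * norm v" if z: "z \<noteq> 0" for z
  proof -
    obtain a u where au: "v = a *s z + u" "hermitian u z = 0" "norm (a *s z) \<le> norm v" "norm u \<le> norm v"
      using orthogonal_decomposition[OF z, of v] by blast
    \<comment> \<open>In the radial direction Euler's identity gives the exact cost, namely the
      degree.\<close>
    have rad: "norm (fderiv P z (a *s z)) \<le> real ?m * (M * norm z ^ k * norm v)"
    proof -
      have "norm (fderiv P z (a *s z)) = norm a * (real ?m * norm (P z))"
        by (simp only: fderiv_vector_scalar_mult[OF P UNIV_I] fderiv_radial[OF P hom]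
            norm_vector_scalar_mult norm_of_nat)
      also have "\<dots> \<le> norm a * (real ?m * (M * norm z ^ ?m))"
        by (intro mult_left_mono M) auto
      also have "\<dots> = real ?m * (M * norm z ^ k * norm (a *s z))" by simp
      also have "\<dots> \<le> real ?m * (M * norm z ^ k * norm v)"
        using au M0 by (intro mult_left_mono) auto
      finally show ?thesis .
    qed
    have tan: "norm (fderiv P z u) \<le> ?n * 2 * sqrt (real ?m) * (M * norm z ^ k * norm v)"
    proof (cases "u = 0")
      case True
      then show ?thesis using fderiv_zero[OF P UNIV_I, of z] M0 by simp
    next
      case False
      \<comment> \<open>For this radius the square of the norm on the disc is at most
        \<open>(norm z)\<^sup>2 * (1 + 1/m)\<close>. Its m-th power gains a factor of at most
        \<open>exp 1\<close>, which is rounded up to 4 so that the square root is 2.\<close>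
      define \<rho> where "\<rho> = norm z / (sqrt (real ?m) * norm u)"
      have \<rho>: "\<rho> > 0" using False z by (simp add: \<rho>_def)
      have "norm (fderiv P z u) \<le> ?n * (M * (2 * norm z ^ ?m) / \<rho>)"
      proof (rule fderiv_slice_bound[OF P \<rho>], intro conjI UNIV_I)
        fix \<zeta> :: complex assume \<zeta>: "norm \<zeta> \<le> \<rho>"
        have "(norm (z + \<zeta> *s u))\<^sup>2 = (norm z)\<^sup>2 + (norm \<zeta>)\<^sup>2 * (norm u)\<^sup>2"
          by (rule norm_add_orthogonal[OF au(2)])
        also have "\<dots> \<le> (norm z)\<^sup>2 + \<rho>\<^sup>2 * (norm u)\<^sup>2"
          using \<zeta> by (intro add_left_mono mult_right_mono power_mono) auto
        also have "\<rho>\<^sup>2 * (norm u)\<^sup>2 = (norm z)\<^sup>2 * (1 / real ?m)"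
          using False by (simp add: \<rho>_def power_divide power_mult_distrib)
        also have "(norm z)\<^sup>2 + (norm z)\<^sup>2 * (1 / real ?m) = (norm z)\<^sup>2 * (1 + 1 / real ?m)"
          by (simp add: algebra_simps)
        also have "\<dots> \<le> (norm z)\<^sup>2 * exp (1 / real ?m)"
          by (intro mult_left_mono exp_ge_add_one_self) auto
        finally have "((norm (z + \<zeta> *s u))\<^sup>2) ^ ?m \<le> ((norm z)\<^sup>2 * exp (1 / real ?m)) ^ ?m"
          by (intro power_mono) auto
        also have "\<dots> = (norm z ^ ?m)\<^sup>2 * exp 1"
        proof -
          have "exp (1 / real ?m) ^ ?m = exp (1::real)"
            using exp_of_nat_mult[of ?m "1 / real ?m"] by (simp add: field_simps)
          then show ?thesis
            by (simp only: power_mult_distrib flip: power_mult) (simp add: mult.commute)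
        qed
        also have "\<dots> \<le> (norm z ^ ?m)\<^sup>2 * 4"
          using exp_le by (intro mult_left_mono) auto
        also have "\<dots> = (2 * norm z ^ ?m)\<^sup>2" by (simp add: power_mult_distrib)
        finally have "(norm (z + \<zeta> *s u) ^ ?m)\<^sup>2 \<le> (2 * norm z ^ ?m)\<^sup>2"
          by (simp only: power_mult[symmetric] mult.commute)
        then have "norm (z + \<zeta> *s u) ^ ?m \<le> 2 * norm z ^ ?m"
          by (rule power2_le_imp_le) simp
        then show "norm (P (z + \<zeta> *s u)) \<le> M * (2 * norm z ^ ?m)"
          by (intro order_trans[OF M] mult_left_mono M0)
      qed
      also have "\<dots> = ?n * 2 * sqrt (real ?m) * (M * norm z ^ k * norm u)"
        using False z by (simp add: \<rho>_def)
      also have "\<dots> \<le> ?n * 2 * sqrt (real ?m) * (M * norm z ^ k * norm v)"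
        using au M0 by (intro mult_left_mono) auto
      finally show ?thesis .
    qed
    have "fderiv P z v = fderiv P z (a *s z) + fderiv P z u"
      unfolding au(1) by (rule fderiv_add[OF P UNIV_I])
    then have "norm (fderiv P z v) \<le> norm (fderiv P z (a *s z)) + norm (fderiv P z u)"
      by (simp add: norm_triangle_ineq)
    also have "\<dots> \<le> real ?m * (M * norm z ^ k * norm v) + ?n * 2 * sqrt (real ?m) * (M * norm z ^ k * norm v)"
      by (intro add_mono rad tan)
    also have "\<dots> = M * (real ?m + ?n * 2 * sqrt (real ?m)) * norm z ^ k * norm v"
      by (simp add: algebra_simps)
    also have "real ?m + ?n * 2 * sqrt (real ?m) = real ?m * ?c"
      using real_div_sqrt[of "real ?m"] by (simp add: field_simps)
    finally show ?thesis by (simp only: mult.assoc)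
  qed
  show ?thesis
  proof (cases "z = 0")
    case True
    \<comment> \<open>Homogeneity moves the estimate from the unit vector \<open>e\<close> to the
      origin. This covers both the constant derivative for \<open>k = 0\<close> and the zero
      derivative for \<open>k > 0\<close>.\<close>
    have "fderiv P z v = 0 ^ k *s fderiv P e v"
      using homogeneousD[OF homogeneous_fderiv[OF P hom, of v], of 0 e] True by simp
    then have "norm (fderiv P z v) = 0 ^ k * norm (fderiv P e v)" by (simp add: norm_power)
    also have "\<dots> \<le> 0 ^ k * (M * real ?m * ?c * norm e ^ k * norm v)"
      using e by (intro mult_left_mono *) auto
    finally show ?thesis using e True by (simp add: mult_ac)
  qed (rule *)
qed

text \<open>The accumulated loss of k differentiations beyond the factorial. Since the sum of
  \<open>2 n / sqrt j\<close> over j up to k is at most \<open>4 n sqrt k\<close>, the product is at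
  most \<open>exp (4 n sqrt k)\<close>, which is subexponential.\<close>

definition deriv_loss :: "nat \<Rightarrow> nat \<Rightarrow> real"
  where "deriv_loss n k = (\<Prod>j<k. 1 + 2 * real n / sqrt (real (Suc j)))"

lemma deriv_loss_pos: "deriv_loss n k > 0"
  unfolding deriv_loss_def by (intro prod_pos ballI) (simp add: add_pos_nonneg)

text \<open>Each derivative multiplies the bound by the current degree and the corresponding loss
  factor; \<open>m\<close> is the degree that is left, and the quotients telescope.\<close>

lemma homogeneous_higher_deriv_bound:
  fixes P :: "'n::finite selfmap"
  assumes P: "holomorphic_map_on P UNIV"
  shows "homogeneous (length vs + m) P \<Longrightarrow> (\<And>z. norm (P z) \<le> M * norm z ^ (length vs + m)) \<Longrightarrow>
    (\<forall>v\<in>set vs. norm v \<le> 1) \<Longrightarrow>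
    norm (higher_deriv P vs z) \<le> M * (fact (length vs + m) / fact m)
      * (deriv_loss CARD('n) (length vs + m) / deriv_loss CARD('n) m) * norm z ^ m"
proof (induction vs arbitrary: m z)
  case Nil
  then show ?case using deriv_loss_pos[of "CARD('n)" m] by simp
next
  case (Cons v vs)
  let ?l = "length vs + Suc m" and ?B = "deriv_loss CARD('n)"
  define K where "K = M * (fact ?l / fact (Suc m)) * (?B ?l / ?B (Suc m))"
  obtain e :: "complex ^ 'n" where e: "norm e = 1" using vector_choose_size[of 1] by auto
  have M0: "0 \<le> M" using Cons.prems(2)[of e] e order_trans[OF norm_ge_zero] by auto
  have K0: "0 \<le> K"
    unfolding K_def using M0 deriv_loss_pos[of "CARD('n)"] by (intro mult_nonneg_nonneg divide_nonneg_pos) (auto simp: less_imp_le)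
  have B: "?B (Suc m) = ?B m * (1 + 2 * real CARD('n) / sqrt (real (Suc m)))"
    by (simp add: deriv_loss_def)
  have "norm (fderiv (higher_deriv P vs) z v)
      \<le> K * real (Suc m) * (1 + 2 * real CARD('n) / sqrt (real (Suc m))) * norm z ^ m * norm v"
  proof (rule homogeneous_fderiv_bound)
    show "holomorphic_map_on (higher_deriv P vs) UNIV"
      by (rule holomorphic_map_higher_deriv[OF open_UNIV P])
    show "homogeneous (Suc m) (higher_deriv P vs)"
      by (rule homogeneous_higher_deriv[OF P]) (use Cons in auto)
    show "norm (higher_deriv P vs z) \<le> K * norm z ^ Suc m" for z
      unfolding K_def by (rule Cons.IH) (use Cons.prems in auto)
  qed
  also have "\<dots> \<le> K * real (Suc m) * (1 + 2 * real CARD('n) / sqrt (real (Suc m))) * norm z ^ m * 1"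
    using Cons.prems(3) K0 by (intro mult_left_mono) (auto intro!: mult_nonneg_nonneg add_nonneg_nonneg)
  also have "\<dots> = M * (fact ?l / fact m) * (?B ?l / ?B m) * norm z ^ m"
  proof -
    have c: "1 + 2 * real CARD('n) / sqrt (real (Suc m)) > 0" by (simp add: add_pos_nonneg)
    have "real (Suc m) * (F / fact (Suc m)) = F / fact m" for F :: real
      unfolding fact_Suc by (simp del: of_nat_Suc)
    from this[of "fact ?l"] have "real (Suc m) * (fact ?l / fact (Suc m)) = fact ?l / fact m" .
    moreover have "?B ?l / ?B (Suc m) * (1 + 2 * real CARD('n) / sqrt (real (Suc m))) = ?B ?l / ?B m"
      unfolding B using c by simp
    moreover have "K * real (Suc m) * (1 + 2 * real CARD('n) / sqrt (real (Suc m))) * norm z ^ m * 1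
        = M * (real (Suc m) * (fact ?l / fact (Suc m)))
          * (?B ?l / ?B (Suc m) * (1 + 2 * real CARD('n) / sqrt (real (Suc m)))) * norm z ^ m"
      unfolding K_def by (simp only: mult_ac mult_1_right)
    ultimately show ?thesis by (simp only:)
  qed
  finally show ?case by simp
qed

lemma taylor_coeff_bound:
  fixes f :: "'n::finite selfmap"
  assumes S: "open S" and f: "holomorphic_map_on f S" and r: "r > 0" and rS: "cball 0 r \<subseteq> S"
    and M: "\<And>x. norm x \<le> r \<Longrightarrow> norm (f x) \<le> M" and vs: "\<forall>v\<in>set vs. norm v \<le> 1"
  shows "norm (taylor_coeff f vs) \<le> real CARD('n) * M * deriv_loss CARD('n) (length vs) / r ^ length vs"
proof -
  define k where "k = length vs"
  define P where "P z = hpart f k z" for z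
  have S0: "0 \<in> S" using r rS by auto
  \<comment> \<open>All the degree is used up, so \<open>m = 0\<close> and the power of the norm at
    the origin is \<open>0 ^ 0 = 1\<close>. The factorial then cancels against the one in
    \<open>taylor_coeff\<close>.\<close>
  have "norm (higher_deriv P vs 0) \<le> (real CARD('n) * M / r ^ k) * (fact (length vs + 0) / fact 0)
      * (deriv_loss CARD('n) (length vs + 0) / deriv_loss CARD('n) 0) * norm (0 :: complex ^ 'n) ^ 0"
  proof (rule homogeneous_higher_deriv_bound[OF _ _ _ vs])
    show "holomorphic_map_on P UNIV"
      unfolding P_def[abs_def] by (rule holomorphic_map_homogeneous_part[OF S f r rS M])
    show "homogeneous (length vs + 0) P"
      using taylor_coeff_replicate_cmult[OF S f S0] by (simp add: homogeneous_def P_def k_def)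
    show "norm (P z) \<le> real CARD('n) * M / r ^ k * norm z ^ (length vs + 0)" for z
      using homogeneous_part_bound[OF S f r rS M, where k = k and z = z]
      by (simp add: P_def k_def power_divide)
  qed
  also have "higher_deriv P vs 0 = higher_deriv f vs 0"
    unfolding P_def[abs_def] k_def by (rule higher_deriv_homogeneous_part[OF S f S0, symmetric])
  finally have "norm (higher_deriv f vs 0) \<le> real CARD('n) * M / r ^ k * fact k * deriv_loss CARD('n) k"
    by (simp add: k_def deriv_loss_def)
  then show ?thesis
    by (simp add: taylor_coeff_def field_simps flip: k_def)
qed

text \<open>Ratio test: consecutive quotients \<open>q k\<close> tend to \<open>1 / r\<close>, and
  \<open>(1 / r + 1) / 2\<close> is the midpoint between this limit and 1. Every
  \<open>r > 1\<close> is good enough, which is the gain of the subexponential loss.\<close>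

lemma summable_deriv_loss:
  assumes "r > 1"
  shows "summable (\<lambda>k. real (k + 2) * (deriv_loss n (k + 2) / r ^ (k + 2)))"
proof -
  define a where "a k = real (k + 2) * (deriv_loss n (k + 2) / r ^ (k + 2))" for k
  define q where "q k = real (k + 3) / real (k + 2) * (1 + 2 * real n / sqrt (real (k + 3))) / r" for k
  have "(\<lambda>k. real (k + 3) / real (k + 2)) \<longlonglongrightarrow> 1" by real_asymp
  moreover have "(\<lambda>k. 2 * real n / sqrt (real (k + 3))) \<longlonglongrightarrow> 0" by real_asymp
  ultimately have "q \<longlonglongrightarrow> 1 * (1 + 0) / r"
    unfolding q_def using assms by (intro tendsto_intros) auto
  then have "eventually (\<lambda>k. q k < (1 / r + 1) / 2) sequentially"
    by (intro order_tendstoD(2)) (use assms in \<open>auto simp: field_simps\<close>)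
  then obtain N where N: "\<And>k. k \<ge> N \<Longrightarrow> q k < (1 / r + 1) / 2"
    unfolding eventually_sequentially by blast
  have a0: "a k > 0" for k
    unfolding a_def using assms deriv_loss_pos[of n] by (intro mult_pos_pos divide_pos_pos) auto
  have step: "a (Suc k) = q k * a k" for k
  proof -
    have "deriv_loss n (Suc k + 2) = deriv_loss n (k + 2) * (1 + 2 * real n / sqrt (real (k + 3)))"
      by (simp add: deriv_loss_def eval_nat_numeral)
    moreover have "x * (D * c / (r * R)) = x / y * c / r * (y * (D / R))" if "y \<noteq> 0" for x y c D R :: real
      using that by simp
    from this[of "real (k + 2)" "real (k + 3)"] have
      "real (k + 3) * (D * c / (r * R)) = real (k + 3) / real (k + 2) * c / r * (real (k + 2) * (D / R))"
      for c D R by simp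
    moreover have "Suc k + 2 = k + 3" "r ^ (Suc k + 2) = r * r ^ (k + 2)" by simp_all
    ultimately show ?thesis unfolding a_def q_def by (simp only:)
  qed
  have "summable a"
  proof (rule summable_ratio_test)
    show "(1 / r + 1) / 2 < 1" using assms by (simp add: field_simps)
    show "norm (a (Suc k)) \<le> (1 / r + 1) / 2 * norm (a k)" if "k \<ge> N" for k
      using N[OF that] a0[of k] a0[of "Suc k"] unfolding step
      by (auto intro!: mult_right_mono simp: abs_mult zero_less_mult_iff)
  qed
  then show ?thesis unfolding a_def .
qed

section \<open>Vector fields generated by automorphisms\<close>

lemma Aut_spaceI:
  assumes "holomorphic_map_on \<Phi> UNIV" "holomorphic_map_on \<Psi> UNIV"
    and "\<And>z. \<Psi> (\<Phi> z) = z" "\<And>z. \<Phi> (\<Psi> z) = z"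
  shows "\<Phi> \<in> Aut_space"
proof -
  have "bij \<Phi>" by (rule o_bij[of \<Psi>]) (auto simp: fun_eq_iff assms)
  moreover have "inv \<Phi> = \<Psi>" by (rule inv_equality) (auto simp: assms)
  ultimately show ?thesis using assms by (simp add: Aut_space_def)
qed

lemma Aut_space_compose:
  assumes "\<Phi> \<in> Aut_space" "\<Psi> \<in> Aut_space"
  shows "(\<lambda>z. \<Phi> (\<Psi> z)) \<in> Aut_space"
proof (rule Aut_spaceI[of _ "\<lambda>z. inv \<Psi> (inv \<Phi> z)"])
  show "holomorphic_map_on (\<lambda>z. \<Phi> (\<Psi> z)) UNIV"
    by (rule holomorphic_map_compose(1)[of \<Phi> UNIV]) (use assms in \<open>simp_all add: Aut_space_def\<close>)
  show "holomorphic_map_on (\<lambda>z. inv \<Psi> (inv \<Phi> z)) UNIV"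
    by (rule holomorphic_map_compose(1)[of "inv \<Psi>" UNIV]) (use assms in \<open>simp_all add: Aut_space_def\<close>)
  have "inj \<Phi>" "inj \<Psi>" "surj \<Phi>" "surj \<Psi>"
    using assms by (simp_all add: Aut_space_def bij_is_inj bij_is_surj)
  then show "inv \<Psi> (inv \<Phi> (\<Phi> (\<Psi> z))) = z" "\<Phi> (\<Psi> (inv \<Psi> (inv \<Phi> z))) = z" for z
    by (simp_all add: inv_f_f surj_f_inv_f)
qed

lemma Aut_space_ident: "(\<lambda>z. z) \<in> Aut_space"
  by (rule Aut_spaceI[of _ "\<lambda>z. z"]) auto

lemma Aut_space_cmult:
  assumes "c \<noteq> 0"
  shows "(\<lambda>z. c *s z) \<in> Aut_space"
  by (rule Aut_spaceI[of _ "\<lambda>z. inverse c *s z"])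
    (use assms in \<open>auto intro: holomorphic_map_cmult\<close>)

lemma Aut_space_translation: "(\<lambda>z. z + v) \<in> Aut_space"
  by (rule Aut_spaceI[of _ "\<lambda>z. z - v"]) (auto intro: holomorphic_map_add holomorphic_map_diff)

text \<open>Without conjugation, so that \<open>cdot a\<close> is complex linear in
  \<open>z\<close>, hence holomorphic.\<close>

definition cdot :: "complex ^ 'n::finite \<Rightarrow> complex ^ 'n \<Rightarrow> complex"
  where "cdot a z = (\<Sum>i\<in>UNIV. a $ i * z $ i)"

lemma cdot_add: "cdot a (x + y) = cdot a x + cdot a y" "cdot (a + b) x = cdot a x + cdot b x"
  by (simp_all add: cdot_def algebra_simps sum.distrib)

lemma cdot_diff: "cdot a (x - y) = cdot a x - cdot a y" "cdot (a - b) x = cdot a x - cdot b x"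
  by (simp_all add: cdot_def algebra_simps sum_subtractf)

lemma cdot_cmult: "cdot a (c *s x) = c * cdot a x" "cdot (c *s a) x = c * cdot a x"
  by (simp_all add: cdot_def sum_distrib_left mult_ac)

lemma cdot_zero [simp]: "cdot a 0 = 0" "cdot 0 x = 0"
  by (simp_all add: cdot_def)

lemma cdot_axis [simp]: "cdot a (axis i 1) = a $ i" "cdot (axis i 1) z = z $ i"
  by (simp_all add: cdot_def axis_def if_distrib if_distribR cong: if_cong)

lemma has_derivative_cdot: "(cdot a has_derivative cdot a) (at z)"
proof -
  have "((\<lambda>z. \<Sum>i\<in>UNIV. a $ i * z $ i) has_derivative (\<lambda>z. \<Sum>i\<in>UNIV. a $ i * z $ i)) (at z)"
    by (intro derivative_intros bounded_linear.has_derivative[OF bounded_linear_vec_nth])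
  then show ?thesis by (simp add: cdot_def[abs_def])
qed

lemma continuous_on_cdot [continuous_intros]:
  "continuous_on S f \<Longrightarrow> continuous_on S (\<lambda>z. cdot a (f z))"
  unfolding cdot_def by (intro continuous_intros)

lemma holomorphic_map_ridge:
  assumes h: "h holomorphic_on UNIV" and w: "holomorphic_map_on w S"
  shows "holomorphic_map_on (\<lambda>z. h (cdot a z) *s w z) S"
proof (rule holomorphic_mapI')
  fix z assume z: "z \<in> S"
  have "(h has_field_derivative deriv h (cdot a z)) (at (cdot a z))"
    using h holomorphic_derivI[of h UNIV] by auto
  then have "((\<lambda>z. h (cdot a z)) has_derivative (\<lambda>v. deriv h (cdot a z) * cdot a v)) (at z)"
    using has_derivative_compose[OF has_derivative_cdot] unfolding has_field_derivative_def by blast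
  from has_derivative_vector_scalar_mult[OF this holomorphic_map_has_derivative[OF w z]]
  show "((\<lambda>z. h (cdot a z) *s w z) has_derivative
      (\<lambda>v. h (cdot a z) *s fderiv w z v + (deriv h (cdot a z) * cdot a v) *s w z)) (at z)" .
  show "h (cdot a z) *s fderiv w z (c *s v) + (deriv h (cdot a z) * cdot a (c *s v)) *s w z =
      c *s (h (cdot a z) *s fderiv w z v + (deriv h (cdot a z) * cdot a v) *s w z)" for c v
    by (simp add: fderiv_vector_scalar_mult[OF w z] cdot_cmult vec_eq_iff algebra_simps)
qed

text \<open>Moving along \<open>v\<close> leaves \<open>cdot a z\<close> unchanged, so subtracting
  the same multiple of \<open>v\<close> undoes the map.\<close>

lemma Aut_space_shear:
  assumes "cdot a v = 0" "h holomorphic_on UNIV"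
  shows "(\<lambda>z. z + h (cdot a z) *s v) \<in> Aut_space"
  by (rule Aut_spaceI[of _ "\<lambda>z. z - h (cdot a z) *s v"])
    (use assms in \<open>auto intro!: holomorphic_map_add holomorphic_map_diff holomorphic_map_ridge
      simp: cdot_add cdot_diff cdot_cmult\<close>)

text \<open>The map fixes \<open>cdot a z\<close> and multiplies \<open>cdot b z\<close> by the
  nonvanishing factor \<open>exp (h (cdot a z))\<close>; replacing \<open>h\<close> by
  \<open>- h\<close> inverts it.\<close>

lemma Aut_space_overshear:
  assumes a: "cdot a v = 0" and b: "cdot b v = 1" and h: "h holomorphic_on UNIV"
  shows "(\<lambda>z. z + ((exp (h (cdot a z)) - 1) * cdot b z) *s v) \<in> Aut_space"
proof -
  define \<Phi> where "\<Phi> h z = z + (exp (h (cdot a z)) - 1) *s (cdot b z *s v)" for h z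
  have hol: "holomorphic_map_on (\<Phi> h) UNIV" if "h holomorphic_on UNIV" for h
  proof -
    have "holomorphic_map_on (\<lambda>z. cdot b z *s v) UNIV"
      using holomorphic_map_ridge[of "\<lambda>x. x" "\<lambda>z. v" UNIV b] by (simp add: holomorphic_on_ident)
    with that show ?thesis
      unfolding \<Phi>_def[abs_def]
      by (intro holomorphic_map_add holomorphic_map_ridge[of "\<lambda>x. exp (h x) - 1"])
        (auto intro!: holomorphic_intros)
  qed
  have inv: "\<Phi> (\<lambda>x. - h x) (\<Phi> h z) = z" for h z
  proof -
    have "cdot a (\<Phi> h z) = cdot a z" "cdot b (\<Phi> h z) = exp (h (cdot a z)) * cdot b z"
      by (simp_all only: \<Phi>_def cdot_add cdot_cmult a b) (simp_all add: algebra_simps)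
    then have "\<Phi> (\<lambda>x. - h x) (\<Phi> h z) = \<Phi> h z + (exp (- h (cdot a z)) - 1) *s ((exp (h (cdot a z)) * cdot b z) *s v)"
      unfolding \<Phi>_def[of "\<lambda>x. - h x" "\<Phi> h z"] by (simp only:)
    also have "\<dots> = z"
    proof -
      define E E' where "E = exp (h (cdot a z))" and "E' = exp (- h (cdot a z))"
      have E: "E' * (E * x) = x" for x by (simp add: E_def E'_def exp_minus)
      show ?thesis
        unfolding \<Phi>_def E_def[symmetric] E'_def[symmetric]
        by (simp add: vec_eq_iff left_diff_distrib mult.assoc E)
    qed
    finally show ?thesis .
  qed
  have "\<Phi> h \<in> Aut_space"
  proof (rule Aut_spaceI[of _ "\<Phi> (\<lambda>x. - h x)"])
    show "holomorphic_map_on (\<Phi> h) UNIV" "holomorphic_map_on (\<Phi> (\<lambda>x. - h x)) UNIV"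
      using h by (auto intro!: hol holomorphic_intros)
    show "\<Phi> (\<lambda>x. - h x) (\<Phi> h z) = z" "\<Phi> h (\<Phi> (\<lambda>x. - h x) z) = z" for z
      using inv[of h z] inv[of "\<lambda>x. - h x" z] by simp_all
  qed
  then show ?thesis by (simp add: \<Phi>_def[abs_def])
qed

section \<open>Fields whose Euler steps are approximated by automorphisms; sums and limits\<close>

abbreviation euler_step :: "real \<Rightarrow> real \<Rightarrow> real \<Rightarrow> 'n::finite selfmap \<Rightarrow> bool"
  where "euler_step r \<eta> s w \<equiv>
    \<exists>\<psi>\<in>Aut_space. \<forall>z. norm z \<le> r \<longrightarrow> norm (\<psi> z - z - s *\<^sub>R w z) \<le> \<eta> * s"

text \<open>A substitute for the closure of the sums of complete fields. Agreement to first order in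
  \<open>s\<close> suffices for an Euler scheme, and it is stable under sums, by composition, and
  under uniform limits on balls.\<close>

definition aut_field :: "'n::finite selfmap \<Rightarrow> bool"
  where "aut_field w \<longleftrightarrow> continuous_on UNIV w \<and>
    (\<forall>r>0. \<forall>\<eta>>0. \<exists>s\<^sub>0>0. \<forall>s. 0 < s \<and> s < s\<^sub>0 \<longrightarrow>
      euler_step r \<eta> s w)"

lemma aut_field_continuous: "aut_field w \<Longrightarrow> continuous_on UNIV w"
  by (simp add: aut_field_def)

lemma aut_fieldE:
  assumes "aut_field w" "r > 0" "\<eta> > 0"
  obtains s\<^sub>0 where "s\<^sub>0 > 0" "\<And>s. 0 < s \<Longrightarrow> s < s\<^sub>0 \<Longrightarrow>
      euler_step r \<eta> s w"
proof -
  note * = conjunct2[OF assms(1)[unfolded aut_field_def], THEN spec, THEN mp, OF assms(2),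
      THEN spec, THEN mp, OF assms(3)]
  from * obtain e where e: "e > 0" "\<forall>s. 0 < s \<and> s < e \<longrightarrow>
      euler_step r \<eta> s w"
    by (elim exE conjE)
  show ?thesis by (rule that[OF e(1)]) (use e(2) in simp)
qed

lemma continuous_bounded_cball:
  fixes w :: "complex ^ 'n::finite \<Rightarrow> 'b::real_normed_vector"
  assumes "continuous_on UNIV w"
  obtains B where "B > 0" "\<And>z. norm z \<le> r \<Longrightarrow> norm (w z) \<le> B"
proof -
  have "bounded (w ` cball 0 r)"
    by (intro compact_imp_bounded compact_continuous_image compact_cball
        continuous_on_subset[OF assms]) simp
  then obtain B where "B > 0" "\<And>x. x \<in> cball 0 r \<Longrightarrow> norm (w x) \<le> B"
    unfolding bounded_pos by blast
  then show ?thesis using that by simp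
qed

text \<open>The threshold for \<open>s\<close> must be independent of the coefficients
  \<open>t\<close>: in the Loewner chain they are powers of \<open>1 / l\<close>, and one step size
  has to serve the whole range of \<open>l\<close>.\<close>

lemma aut_field_combination:
  fixes V :: "nat \<Rightarrow> 'n::finite selfmap"
  assumes "\<And>j. j < J \<Longrightarrow> aut_field (V j)" "r > 0" "\<eta> > 0"
  shows "\<exists>s\<^sub>0>0. \<forall>s t. 0 < s \<longrightarrow> s < s\<^sub>0 \<longrightarrow> (\<forall>j<J. 0 \<le> t j \<and> t j \<le> 1) \<longrightarrow>
    euler_step r \<eta> s (\<lambda>z. \<Sum>j<J. t j *\<^sub>R V j z)"
  using assms
proof (induction J arbitrary: \<eta>)
  case 0
  then show ?case
    by (intro exI[of _ 1]) (auto intro!: bexI[OF _ Aut_space_ident])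
next
  case (Suc J)
  define \<theta> where "\<theta> = \<eta> / 3"
  have \<theta>: "\<theta> > 0" using Suc by (simp add: \<theta>_def)
  have "\<exists>s\<^sub>0>0. \<forall>s t. 0 < s \<longrightarrow> s < s\<^sub>0 \<longrightarrow> (\<forall>j<J. 0 \<le> t j \<and> t j \<le> 1) \<longrightarrow>
    euler_step r \<theta> s (\<lambda>z. \<Sum>j<J. t j *\<^sub>R V j z)"
    by (rule Suc.IH) (use Suc.prems \<theta> in auto)
  then obtain s1 where s1: "s1 > 0" "\<And>s t. 0 < s \<Longrightarrow> s < s1 \<Longrightarrow> (\<And>j. j < J \<Longrightarrow> 0 \<le> t j \<and> t j \<le> 1) \<Longrightarrow>
    euler_step r \<theta> s (\<lambda>z. \<Sum>j<J. t j *\<^sub>R V j z)" by blast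
  have VJ: "aut_field (V J)" using Suc.prems by simp
  obtain s2 where s2: "s2 > 0" "\<And>s. 0 < s \<Longrightarrow> s < s2 \<Longrightarrow>
      euler_step (r + 1) \<theta> s (V J)"
    by (rule aut_fieldE[OF VJ, of "r + 1" \<theta>]) (use Suc.prems \<theta> in auto)
  have "uniformly_continuous_on (cball 0 (r + 1)) (V J)"
    by (intro compact_uniformly_continuous continuous_on_subset[OF aut_field_continuous[OF VJ]]) auto
  then obtain \<delta> where \<delta>0: "\<delta> > 0"
    "\<forall>x\<in>cball 0 (r + 1). \<forall>y\<in>cball 0 (r + 1). dist y x < \<delta> \<longrightarrow> dist (V J y) (V J x) < \<theta>"
    using \<theta> unfolding uniformly_continuous_on_def by blast
  have \<delta>: "\<delta> > 0"
    "\<And>x y. norm x \<le> r + 1 \<Longrightarrow> norm y \<le> r + 1 \<Longrightarrow> norm (y - x) < \<delta> \<Longrightarrow> norm (V J y - V J x) < \<theta>"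
    using \<delta>0 by (simp_all add: dist_norm)
  have "\<exists>B. \<forall>z. norm z \<le> r \<longrightarrow> norm (V j z) \<le> B" if "j < J" for j
    by (rule continuous_bounded_cball[OF aut_field_continuous[OF Suc.prems(1)[OF less_SucI[OF that]]], of r]) blast
  then have "\<forall>j. \<exists>B. j < J \<longrightarrow> (\<forall>z. norm z \<le> r \<longrightarrow> norm (V j z) \<le> B)" by blast
  from choice[OF this] obtain B where
    B: "\<And>j z. j < J \<Longrightarrow> norm z \<le> r \<Longrightarrow> norm (V j z) \<le> B j" by blast
  define C where "C = \<bar>\<Sum>j<J. B j\<bar> + \<theta>"
  have C: "C > 0" using \<theta> by (simp add: C_def add_nonneg_pos)
  \<comment> \<open>The first composite moves a point by at most \<open>s * C\<close>. Staying below
    1 keeps it in the ball of radius \<open>r + 1\<close> where \<open>\<psi>2\<close> is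
    controlled, and staying below \<open>\<delta>\<close> changes \<open>V J\<close> by less than
    \<open>\<theta>\<close>.\<close>
  define s0 where "s0 = min (min s1 s2) (min 1 \<delta> / (2 * C))"
  have "euler_step r \<eta> s (\<lambda>z. \<Sum>j<Suc J. t j *\<^sub>R V j z)"
    if s: "0 < s" "s < s0" and t: "\<forall>j<Suc J. 0 \<le> t j \<and> t j \<le> 1" for s t
  proof -
    have "euler_step r \<theta> s (\<lambda>z. \<Sum>j<J. t j *\<^sub>R V j z)"
      by (rule s1(2)) (use s t in \<open>auto simp: s0_def\<close>)
    then obtain \<psi>1 where \<psi>1: "\<psi>1 \<in> Aut_space"
      "\<And>z. norm z \<le> r \<Longrightarrow> norm (\<psi>1 z - z - s *\<^sub>R (\<Sum>j<J. t j *\<^sub>R V j z)) \<le> \<theta> * s" by blast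
    have "\<exists>\<psi>\<in>Aut_space. \<forall>z. norm z \<le> r + 1 \<longrightarrow> norm (\<psi> z - z - (s * t J) *\<^sub>R V J z) \<le> \<theta> * s"
    \<comment> \<open>\<open>aut_fieldE\<close> provides positive steps only, so a vanishing
      coefficient is served by the identity.\<close>
    proof (cases "t J = 0")
      case True
      then show ?thesis using \<theta> s by (intro bexI[OF _ Aut_space_ident]) auto
    next
      case False
      then have tJ: "0 < t J" "t J \<le> 1" using t by (auto simp: less_le)
      have le: "s * t J \<le> s" using tJ s by simp
      moreover have "s < s2" using s by (simp add: s0_def)
      ultimately have "s * t J < s2" by linarith
      then obtain \<psi> where "\<psi> \<in> Aut_space"
        "\<And>z. norm z \<le> r + 1 \<Longrightarrow> norm (\<psi> z - z - (s * t J) *\<^sub>R V J z) \<le> \<theta> * (s * t J)"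
        using s2(2)[of "s * t J"] s tJ by auto
      moreover have "\<theta> * (s * t J) \<le> \<theta> * s" using le \<theta> by (intro mult_left_mono) auto
      ultimately show ?thesis by (meson order_trans)
    qed
    then obtain \<psi>2 where \<psi>2: "\<psi>2 \<in> Aut_space"
      "\<And>z. norm z \<le> r + 1 \<Longrightarrow> norm (\<psi>2 z - z - (s * t J) *\<^sub>R V J z) \<le> \<theta> * s" by blast
    have "norm (\<psi>2 (\<psi>1 z) - z - s *\<^sub>R (\<Sum>j<Suc J. t j *\<^sub>R V j z)) \<le> \<eta> * s" if z: "norm z \<le> r" for z
    proof -
      define \<Sigma> where "\<Sigma> = (\<Sum>j<J. t j *\<^sub>R V j z)"
      have "norm \<Sigma> \<le> (\<Sum>j<J. B j)"
        unfolding \<Sigma>_def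
      proof (rule sum_norm_le)
        fix j assume j: "j \<in> {..<J}"
        have "norm (t j *\<^sub>R V j z) \<le> 1 * norm (V j z)"
          using t j unfolding norm_scaleR by (intro mult_right_mono) auto
        then show "norm (t j *\<^sub>R V j z) \<le> B j" using B[of j z] j z by auto
      qed
      then have \<Sigma>: "norm \<Sigma> \<le> C - \<theta>" by (simp add: C_def)
      have e1: "norm (\<psi>1 z - z - s *\<^sub>R \<Sigma>) \<le> \<theta> * s" using \<psi>1(2)[OF z] by (simp add: \<Sigma>_def)
      have "norm (\<psi>1 z - z) \<le> norm (\<psi>1 z - z - s *\<^sub>R \<Sigma>) + norm (s *\<^sub>R \<Sigma>)"
        using norm_triangle_ineq[of "\<psi>1 z - z - s *\<^sub>R \<Sigma>" "s *\<^sub>R \<Sigma>"] by simp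
      also have "\<dots> \<le> \<theta> * s + s * (C - \<theta>)"
        using e1 \<Sigma> s by (intro add_mono) (auto intro: mult_left_mono)
      also have "\<dots> = s * C" by (simp add: algebra_simps)
      also have "\<dots> < min 1 \<delta> / (2 * C) * C"
        using s C by (intro mult_strict_right_mono) (auto simp: s0_def)
      also have "\<dots> = min 1 \<delta> / 2" using C by simp
      also have "\<dots> < min 1 \<delta>"
      proof -
        have "0 < min 1 \<delta>" using \<delta> by simp
        then show ?thesis by linarith
      qed
      finally have near: "norm (\<psi>1 z - z) < min 1 \<delta>" .
      then have n1: "norm (\<psi>1 z) \<le> r + 1"
        using z norm_triangle_ineq2[of "\<psi>1 z" z] by linarith
      have e2: "norm (\<psi>2 (\<psi>1 z) - \<psi>1 z - (s * t J) *\<^sub>R V J (\<psi>1 z)) \<le> \<theta> * s"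
        by (rule \<psi>2(2)[OF n1])
      have "norm (V J (\<psi>1 z) - V J z) < \<theta>"
        by (rule \<delta>(2)) (use z n1 near in auto)
      then have e3: "norm ((s * t J) *\<^sub>R (V J (\<psi>1 z) - V J z)) \<le> s * \<theta>"
        using s t[rule_format, of J] unfolding norm_scaleR by (intro mult_mono) (auto simp: mult_left_le)
      have "\<psi>2 (\<psi>1 z) - z - s *\<^sub>R (\<Sum>j<Suc J. t j *\<^sub>R V j z)
          = (\<psi>2 (\<psi>1 z) - \<psi>1 z - (s * t J) *\<^sub>R V J (\<psi>1 z)) + (\<psi>1 z - z - s *\<^sub>R \<Sigma>)
            + (s * t J) *\<^sub>R (V J (\<psi>1 z) - V J z)"
        by (simp add: \<Sigma>_def algebra_simps)
      also have "norm \<dots> \<le> \<theta> * s + \<theta> * s + s * \<theta>"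
        by (intro norm_triangle_mono e1 e2 e3)
      also have "\<dots> = \<eta> * s" by (simp add: \<theta>_def)
      finally show ?thesis .
    qed
    then show ?thesis
      by (intro bexI[OF _ Aut_space_compose[OF \<psi>2(1) \<psi>1(1)]] allI impI)
  qed
  moreover have "s0 > 0" using s1 s2 \<delta> C by (simp add: s0_def)
  ultimately show ?case by (intro exI[of _ s0] conjI allI impI)
qed

lemma aut_field_zero: "aut_field (\<lambda>z. 0)"
  unfolding aut_field_def using Aut_space_ident by (auto intro!: exI[of _ 1] bexI[of _ "\<lambda>z. z"])

lemma aut_field_add:
  assumes "aut_field v" "aut_field w"
  shows "aut_field (\<lambda>z. v z + w z)"
proof -
  have cont: "continuous_on UNIV (\<lambda>z. v z + w z)"
    by (intro continuous_intros aut_field_continuous assms)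
  define V where "V j = (if j = (0::nat) then v else w)" for j
  have V: "aut_field (V j)" for j using assms by (simp add: V_def)
  have s: "(\<Sum>j<2. 1 *\<^sub>R V j z) = v z + w z" for z
    by (simp add: V_def numeral_2_eq_2)
  show ?thesis
    unfolding aut_field_def
  proof (intro conjI cont allI impI)
    fix r \<eta> :: real assume r: "r > 0" "\<eta> > 0"
    from aut_field_combination[of 2 V, OF V r] obtain s0 where s0: "s0 > 0"
      "\<And>s t. 0 < s \<Longrightarrow> s < s0 \<Longrightarrow> (\<forall>j<2. 0 \<le> t j \<and> t j \<le> 1) \<Longrightarrow>
        euler_step r \<eta> s (\<lambda>z. \<Sum>j<2. t j *\<^sub>R V j z)"
      by blast
    from s0(2)[of _ "\<lambda>j. 1"] s0(1)
    show "\<exists>s\<^sub>0>0. \<forall>s. 0 < s \<and> s < s\<^sub>0 \<longrightarrow> euler_step r \<eta> s (\<lambda>z. v z + w z)"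
      unfolding s by auto
  qed
qed

lemma aut_field_sum:
  "(\<And>i. i \<in> A \<Longrightarrow> aut_field (v i)) \<Longrightarrow> aut_field (\<lambda>z. \<Sum>i\<in>A. v i z)"
  by (induction A rule: infinite_finite_induct) (auto intro: aut_field_add aut_field_zero)

text \<open>An error in the field enters the Euler step with a factor \<open>s\<close>, so a fixed
  ball and tolerance require a single approximating field.\<close>

lemma aut_field_limit:
  assumes cont: "continuous_on UNIV w"
    and "\<And>r \<eta>. r > 0 \<Longrightarrow> \<eta> > 0 \<Longrightarrow> \<exists>w'. aut_field w' \<and> (\<forall>z. norm z \<le> r \<longrightarrow> norm (w' z - w z) \<le> \<eta>)"
  shows "aut_field w"
  unfolding aut_field_def
proof (intro conjI cont allI impI)
  fix r \<eta> :: real assume r: "r > 0" "\<eta> > 0"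
  then obtain w' where w': "aut_field w'" "\<And>z. norm z \<le> r \<Longrightarrow> norm (w' z - w z) \<le> \<eta> / 2"
    using assms(2)[of r "\<eta> / 2"] by auto
  obtain s0 where s0: "s0 > 0" "\<And>s. 0 < s \<Longrightarrow> s < s0 \<Longrightarrow>
      euler_step r (\<eta> / 2) s w'"
    using aut_fieldE[OF w'(1) r(1), of "\<eta> / 2"] r by auto
  show "\<exists>s\<^sub>0>0. \<forall>s. 0 < s \<and> s < s\<^sub>0 \<longrightarrow>
      euler_step r \<eta> s w"
  proof (intro exI[of _ s0] conjI allI impI s0(1))
    fix s assume s: "0 < s \<and> s < s0"
    then obtain \<psi> where \<psi>: "\<psi> \<in> Aut_space"
      "\<And>z. norm z \<le> r \<Longrightarrow> norm (\<psi> z - z - s *\<^sub>R w' z) \<le> \<eta> / 2 * s" using s0(2) by blast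
    have "norm (\<psi> z - z - s *\<^sub>R w z) \<le> \<eta> * s" if z: "norm z \<le> r" for z
    proof -
      have "\<psi> z - z - s *\<^sub>R w z = (\<psi> z - z - s *\<^sub>R w' z) + s *\<^sub>R (w' z - w z)"
        by (simp add: algebra_simps)
      also have "norm \<dots> \<le> \<eta> / 2 * s + s * (\<eta> / 2)"
        using \<psi>(2)[OF z] w'(2)[OF z] s by (intro norm_triangle_mono) (auto intro: mult_left_mono)
      finally show ?thesis by (simp add: mult.commute)
    qed
    with \<psi>(1) show "euler_step r \<eta> s w" by blast
  qed
qed

section \<open>Shear, overshear and exponential fields\<close>

lemma norm_exp_second_order:
  fixes u :: complex
  assumes "norm u \<le> 1"
  shows "norm (exp u - 1 - u) \<le> 3 * (norm u)\<^sup>2"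
proof -
  have "norm (exp u - (\<Sum>i\<le>1. u ^ i / fact i)) \<le> exp \<bar>Re u\<bar> * (norm u ^ Suc 1) / fact 1"
    by (rule Taylor_exp)
  also have "\<dots> \<le> 3 * (norm u)\<^sup>2"
  proof -
    have "exp \<bar>Re u\<bar> \<le> exp 1" using assms abs_Re_le_cmod[of u] by (simp only: exp_le_cancel_iff)
    also have "\<dots> \<le> 3" by (rule exp_le)
    finally show ?thesis by (simp add: power2_eq_square mult_right_mono)
  qed
  finally show ?thesis by (simp add: algebra_simps)
qed

text \<open>Here the Euler step is itself an automorphism, and the error is zero.\<close>

lemma aut_field_shear:
  assumes "cdot a v = 0"
  shows "aut_field (\<lambda>z. exp (cdot a z) *s v)"
  unfolding aut_field_def
proof (intro conjI allI impI)
  show "continuous_on UNIV (\<lambda>z. exp (cdot a z) *s v)" by (intro continuous_intros)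
  fix r \<eta> :: real assume "\<eta> > 0"
  have "euler_step r \<eta> s (\<lambda>z. exp (cdot a z) *s v)"
    if "0 < s" for s
    using \<open>\<eta> > 0\<close> that
    by (intro bexI[OF _ Aut_space_shear[OF assms, of "\<lambda>x. of_real s * exp x"]])
      (auto intro!: holomorphic_intros simp: scaleR_eq_vector_scalar_mult)
  then show "\<exists>s\<^sub>0>0. \<forall>s. 0 < s \<and> s < s\<^sub>0 \<longrightarrow> euler_step r \<eta> s (\<lambda>z. exp (cdot a z) *s v)"
    by (intro exI[of _ 1]) auto
qed

text \<open>The exponent is constant along \<open>v\<close>, so the field has an explicit flow by
  overshears. Its map at time \<open>s\<close> is used, and it differs from the Euler step by the
  quadratic remainder of \<open>exp\<close>.\<close>

lemma aut_field_overshear: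
  assumes a: "cdot a v = 0" and b: "cdot b v = 1"
  shows "aut_field (\<lambda>z. (c * exp (cdot a z) * cdot b z) *s v)"
  unfolding aut_field_def
proof (intro conjI allI impI)
  show "continuous_on UNIV (\<lambda>z. (c * exp (cdot a z) * cdot b z) *s v)" by (intro continuous_intros)
  fix r \<eta> :: real assume r: "r > 0" "\<eta> > 0"
  let ?u = "\<lambda>z. c * exp (cdot a z)"
  obtain U where U: "U > 0" "\<And>z. norm z \<le> r \<Longrightarrow> norm (?u z) \<le> U"
    by (rule continuous_bounded_cball[of ?u]) (auto intro!: continuous_intros)
  obtain m where m: "m > 0" "\<And>z. norm z \<le> r \<Longrightarrow> norm (cdot b z) \<le> m"
    by (rule continuous_bounded_cball[of "cdot b"]) (auto intro!: continuous_intros)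
  define K where "K = 3 * U\<^sup>2 * m * norm v + 1"
  have K: "K > 0" using m by (simp add: K_def add_nonneg_pos)
  define s0 where "s0 = min (1 / U) (\<eta> / K)"
  show "\<exists>s\<^sub>0>0. \<forall>s. 0 < s \<and> s < s\<^sub>0 \<longrightarrow> euler_step r \<eta> s (\<lambda>z. (?u z * cdot b z) *s v)"
  proof (intro exI[of _ s0] conjI allI impI)
    show "s0 > 0" using U K r by (simp add: s0_def)
    fix s assume s: "0 < s \<and> s < s0"
    define \<psi> where "\<psi> z = z + ((exp (of_real s * ?u z) - 1) * cdot b z) *s v" for z
    have "\<psi> \<in> Aut_space"
      unfolding \<psi>_def[abs_def]
      by (rule Aut_space_overshear[OF a b, of "\<lambda>x. of_real s * (c * exp x)"]) (auto intro!: holomorphic_intros)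
    moreover have "norm (\<psi> z - z - s *\<^sub>R ((?u z * cdot b z) *s v)) \<le> \<eta> * s" if z: "norm z \<le> r" for z
    proof -
      have eu: "norm (of_real s * ?u z) \<le> s * U"
        using U(2)[OF z] s unfolding norm_mult[of "of_real s"] by (intro mult_mono) auto
      have "s * U \<le> 1" using s U by (simp add: s0_def field_simps)
      have "\<psi> z - z - s *\<^sub>R ((?u z * cdot b z) *s v)
          = ((exp (of_real s * ?u z) - 1 - of_real s * ?u z) * cdot b z) *s v"
        by (simp add: \<psi>_def scaleR_eq_vector_scalar_mult vec_eq_iff algebra_simps)
      then have "norm (\<psi> z - z - s *\<^sub>R ((?u z * cdot b z) *s v))
          = norm (exp (of_real s * ?u z) - 1 - of_real s * ?u z) * norm (cdot b z) * norm v"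
        by (simp only: norm_vector_scalar_mult norm_mult)
      also have "\<dots> \<le> 3 * (s * U)\<^sup>2 * m * norm v"
      proof (intro mult_right_mono mult_mono)
        have "norm (exp (of_real s * ?u z) - 1 - of_real s * ?u z) \<le> 3 * (norm (of_real s * ?u z))\<^sup>2"
          using eu \<open>s * U \<le> 1\<close> by (intro norm_exp_second_order) linarith
        also have "\<dots> \<le> 3 * (s * U)\<^sup>2"
          using eu by (intro mult_left_mono power_mono) auto
        finally show "norm (exp (of_real s * ?u z) - 1 - of_real s * ?u z) \<le> 3 * (s * U)\<^sup>2" .
      qed (use m(2)[OF z] in auto)
      also have "\<dots> = (K - 1) * s * s" by (simp add: K_def power2_eq_square)
      also have "\<dots> \<le> K * s * s" using s by (intro mult_right_mono) auto
      also have "\<dots> \<le> \<eta> * s"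
        using s K by (intro mult_right_mono) (auto simp: s0_def field_simps)
      finally show ?thesis .
    qed
    ultimately show "euler_step r \<eta> s (\<lambda>z. (?u z * cdot b z) *s v)" by blast
  qed
qed

text \<open>\<open>v\<close> is a basis vector \<open>axis j 1\<close> corrected along another one,
  \<open>axis i 1\<close>, to lie in the kernel of \<open>a\<close>; this is where two coordinates
  are required. \<open>b\<close> is the coordinate j corrected by a multiple of \<open>a\<close> to
  vanish on \<open>u\<close>, and the correction is invisible on \<open>v\<close>.\<close>

lemma exists_transversal:
  fixes a u :: "complex ^ 'n::finite"
  assumes n: "CARD('n) \<ge> 2" and u: "cdot a u = 1"
  obtains v b where "cdot a v = 0" "cdot b v = 1" "cdot b u = 0"
proof -
  have "a \<noteq> 0" using u by auto
  then obtain i where i: "a $ i \<noteq> 0" by (auto simp: vec_eq_iff)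
  have "\<exists>j. j \<noteq> i"
  proof (rule ccontr)
    assume "\<not> (\<exists>j. j \<noteq> i)"
    then have "(UNIV :: 'n set) = {i}" by auto
    then have "CARD('n) = 1" by (metis card_1_singleton_iff One_nat_def)
    with n show False by simp
  qed
  then obtain j where j: "j \<noteq> i" by blast
  define v where "v = axis j 1 - (a $ j / a $ i) *s axis i 1"
  define b where "b = axis j 1 - u $ j *s a"
  have v: "cdot a v = 0" using i by (simp add: v_def cdot_diff cdot_cmult)
  have "v $ j = 1" using j by (simp add: v_def axis_def)
  then have "cdot b v = 1" using v by (simp add: b_def cdot_diff cdot_cmult)
  moreover have "cdot b u = 0" using u by (simp add: b_def cdot_diff cdot_cmult)
  ultimately show ?thesis using that v by blast
qed

text \<open>The only place where the dimension matters. Write \<open>w = c u\<close> with \<open>a u = 1\<close> and pick a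
  vector \<open>v\<close> and a functional \<open>b\<close> with \<open>a v = 0\<close>, \<open>b v = 1\<close>, \<open>b u = 0\<close>. Then \<open>v - t u\<close> lies in the
  kernel of \<open>a + t b\<close>, so \<open>exp ((a + t b) z) (v - t u)\<close> is a shear field, and its derivative at
  \<open>t = 0\<close> is the overshear field \<open>(b z) exp (a z) v\<close> minus \<open>exp (a z) u\<close>.\<close>

lemma aut_field_exp:
  fixes a w :: "complex ^ 'n::finite"
  assumes n: "CARD('n) \<ge> 2"
  shows "aut_field (\<lambda>z. exp (cdot a z) *s w)"
proof (cases "cdot a w = 0")
  case True
  then show ?thesis by (rule aut_field_shear)
next
  case False
  define c where "c = cdot a w"
  define u where "u = inverse c *s w"
  have c: "c \<noteq> 0" using False by (simp add: c_def)
  have au: "cdot a u = 1" using c by (simp add: u_def cdot_cmult c_def)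
  obtain v b where v: "cdot a v = 0" and b: "cdot b v = 1" and bu: "cdot b u = 0"
    using exists_transversal[OF n au] by blast
  have w: "w = c *s u" using c by (simp add: u_def)
  show ?thesis
  proof (rule aut_field_limit)
    show "continuous_on UNIV (\<lambda>z. exp (cdot a z) *s w)" by (intro continuous_intros)
    fix r \<eta> :: real assume r: "r > 0" "\<eta> > 0"
    obtain E where E: "E > 0" "\<And>z. norm z \<le> r \<Longrightarrow> norm (exp (cdot a z)) \<le> E"
      by (rule continuous_bounded_cball[of "\<lambda>z. exp (cdot a z)"]) (auto intro!: continuous_intros)
    obtain m where m: "m > 0" "\<And>z. norm z \<le> r \<Longrightarrow> norm (cdot b z) \<le> m"
      by (rule continuous_bounded_cball[of "cdot b"]) (auto intro!: continuous_intros)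
    define K where "K = norm c * E * (3 * m\<^sup>2 * norm v + (3 * m\<^sup>2 + m) * norm u) + 1"
    have K: "K > 0" using E m by (simp add: K_def add_nonneg_pos)
    define t where "t = min 1 (min (1 / m) (\<eta> / K))"
    have "t \<le> 1 / m" "t \<le> \<eta> / K" by (simp_all add: t_def)
    then have t: "t > 0" "t \<le> 1" "t * m \<le> 1" "t * K \<le> \<eta>"
      using m K r by (simp_all add: pos_le_divide_eq) (simp_all add: t_def)
    \<comment> \<open>The two shear terms form \<open>- c\<close> times a difference quotient in
      \<open>t\<close>. It tends to \<open>c exp(a z) u\<close> minus the overshear field in the
      first term, so the sum tends to \<open>exp(a z) w\<close>.\<close>
    define W where "W z = (c * exp (cdot a z) * cdot b z) *s v
      + (exp (cdot (a + of_real t *s b) z) *s ((- c / of_real t) *s (v - of_real t *s u))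
      + exp (cdot a z) *s ((c / of_real t) *s v))" for z
    have "aut_field W"
      unfolding W_def[abs_def]
      by (intro aut_field_add aut_field_overshear aut_field_shear v b)
        (simp_all add: cdot_add cdot_cmult cdot_diff v b bu au)
    moreover have "norm (W z - exp (cdot a z) *s w) \<le> \<eta>" if z: "norm z \<le> r" for z
    proof -
      define x where "x = of_real t * cdot b z"
      define R where "R = exp x - 1 - x"
      have tc: "complex_of_real t \<noteq> 0" using t by simp
      have ex: "exp (cdot (a + of_real t *s b) z) = exp (cdot a z) * (R + 1 + x)"
        by (simp add: R_def x_def cdot_add cdot_cmult exp_add)
      have nx: "norm x \<le> t * m" using m(2)[OF z] t by (simp add: x_def norm_mult)
      then have "norm R \<le> 3 * (norm x)\<^sup>2"
        unfolding R_def using t by (intro norm_exp_second_order) linarith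
      also have "\<dots> \<le> 3 * (t * m)\<^sup>2" using nx by (intro mult_left_mono power_mono) auto
      finally have nR: "norm R \<le> 3 * (t * m)\<^sup>2" .
      have bz: "cdot b z = x / of_real t" using tc by (simp add: x_def)
      have "W z - exp (cdot a z) *s w = (c * exp (cdot a z)) *s ((- (R / of_real t)) *s v + (R + x) *s u)"
        unfolding W_def w ex bz vec_eq_iff
        using tc by (simp add: field_simps)
      then have "norm (W z - exp (cdot a z) *s w)
          = norm c * norm (exp (cdot a z)) * norm ((- (R / of_real t)) *s v + (R + x) *s u)"
        by (simp only: norm_vector_scalar_mult norm_mult)
      also have "\<dots> \<le> norm c * E * (t * (3 * m\<^sup>2 * norm v + (3 * m\<^sup>2 + m) * norm u))"
      proof (intro mult_mono mult_left_mono E(2)[OF z])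
        have "norm (R / of_real t) \<le> t * (3 * m\<^sup>2)"
          using nR t by (simp add: norm_divide field_simps power2_eq_square)
        then have 1: "norm ((- (R / of_real t)) *s v) \<le> t * (3 * m\<^sup>2) * norm v"
          by (simp add: mult_right_mono)
        have "t * (3 * m\<^sup>2) * t \<le> t * (3 * m\<^sup>2)"
          using t by (intro mult_left_le) auto
        then have "3 * (t * m)\<^sup>2 \<le> t * (3 * m\<^sup>2)" by (simp add: power2_eq_square mult_ac)
        then have "norm (R + x) \<le> t * (3 * m\<^sup>2) + t * m"
          using nR nx by (intro norm_triangle_mono) linarith+
        then have 2: "norm ((R + x) *s u) \<le> (t * (3 * m\<^sup>2) + t * m) * norm u"
          unfolding norm_vector_scalar_mult by (rule mult_right_mono) simp
        have "norm ((- (R / of_real t)) *s v + (R + x) *s u)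
            \<le> t * (3 * m\<^sup>2) * norm v + (t * (3 * m\<^sup>2) + t * m) * norm u"
          by (rule norm_triangle_mono[OF 1 2])
        then show "norm ((- (R / of_real t)) *s v + (R + x) *s u)
            \<le> t * (3 * m\<^sup>2 * norm v + (3 * m\<^sup>2 + m) * norm u)"
          by (simp add: algebra_simps)
      qed (use E in auto)
      also have "\<dots> \<le> t * K" using t by (simp add: K_def algebra_simps)
      also have "\<dots> \<le> \<eta>" by (rule t)
      finally show ?thesis .
    qed
    ultimately show "\<exists>w'. aut_field w' \<and> (\<forall>z. norm z \<le> r \<longrightarrow> norm (w' z - exp (cdot a z) *s w) \<le> \<eta>)"
      by blast
  qed
qed

section \<open>From exponential fields to polynomial fields and to holomorphic fields on
  balls\<close>

definition exp_aut_multiplier :: "(complex ^ 'n::finite \<Rightarrow> complex) \<Rightarrow> bool"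
  where "exp_aut_multiplier p \<longleftrightarrow> continuous_on UNIV p \<and>
    (\<forall>a w. aut_field (\<lambda>z. (p z * exp (cdot a z)) *s w))"

lemma exp_aut_multiplierD:
  "exp_aut_multiplier p \<Longrightarrow> aut_field (\<lambda>z. (p z * exp (cdot a z)) *s w)"
  by (simp add: exp_aut_multiplier_def)

lemma exp_aut_multiplier_const:
  assumes "CARD('n::finite) \<ge> 2"
  shows "exp_aut_multiplier (\<lambda>z :: complex ^ 'n. c)"
proof -
  have "aut_field (\<lambda>z. (c * exp (cdot a z)) *s w)" for a w :: "complex ^ 'n"
    using aut_field_exp[OF assms, of a "c *s w"] by (simp add: mult.commute)
  then show ?thesis by (simp add: exp_aut_multiplier_def del: vector_smult_assoc)
qed

lemma exp_aut_multiplier_add: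
  "exp_aut_multiplier p \<Longrightarrow> exp_aut_multiplier q \<Longrightarrow> exp_aut_multiplier (\<lambda>z. p z + q z)"
  by (auto simp: exp_aut_multiplier_def distrib_right vec.scale_left_distrib
      intro!: continuous_intros aut_field_add)

lemma exp_aut_multiplier_cmult:
  assumes "exp_aut_multiplier p"
  shows "exp_aut_multiplier (\<lambda>z. c * p z)"
proof -
  have "(c * p z * exp (cdot a z)) *s w = (p z * exp (cdot a z)) *s (c *s w)" for z a and w :: "complex ^ 'a"
    by (simp add: mult_ac)
  then show ?thesis
    using assms exp_aut_multiplierD[OF assms]
    unfolding exp_aut_multiplier_def by (simp only: continuous_on_mult_left simp_thms)
qed

lemma exp_aut_multiplier_sum:
  assumes "CARD('n::finite) \<ge> 2"
  shows "(\<And>i. i \<in> A \<Longrightarrow> exp_aut_multiplier (p i)) \<Longrightarrow>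
    exp_aut_multiplier (\<lambda>z :: complex ^ 'n. \<Sum>i\<in>A. p i z)"
  by (induction A rule: infinite_finite_induct)
    (auto intro: exp_aut_multiplier_add exp_aut_multiplier_const[OF assms])

text \<open>The derivative of \<open>exp(a z)\<close> with respect to the i-th entry of
  \<open>a\<close> is \<open>z_i exp(a z)\<close>, and its difference quotients are sums of two
  fields with different exponents. For this reason \<open>exp_aut_multiplier\<close> quantifies over
  all exponents.\<close>

lemma exp_aut_multiplier_coordinate:
  fixes p :: "complex ^ 'n::finite \<Rightarrow> complex"
  assumes p: "exp_aut_multiplier p"
  shows "exp_aut_multiplier (\<lambda>z. z $ i * p z)"
proof -
  have cont [continuous_intros]: "continuous_on S p" for S
    using p continuous_on_subset by (auto simp: exp_aut_multiplier_def)
  have "aut_field (\<lambda>z. (z $ i * p z * exp (cdot a z)) *s w)" for a w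
  proof (rule aut_field_limit)
    show "continuous_on UNIV (\<lambda>z. (z $ i * p z * exp (cdot a z)) *s w)" by (intro continuous_intros)
    fix r \<eta> :: real assume r: "r > 0" "\<eta> > 0"
    obtain E where E: "E > 0" "\<And>z. norm z \<le> r \<Longrightarrow> norm ((p z * exp (cdot a z)) *s w) \<le> E"
      by (rule continuous_bounded_cball[of "\<lambda>z. (p z * exp (cdot a z)) *s w"]) (auto intro!: continuous_intros)
    define t where "t = min (1 / r) (\<eta> / (3 * r\<^sup>2 * E))"
    have "t \<le> 1 / r" "t \<le> \<eta> / (3 * r\<^sup>2 * E)" by (simp_all add: t_def)
    moreover have "3 * r\<^sup>2 * E > 0" using E r by simp
    ultimately have t: "t > 0" "t * r \<le> 1" "t * (3 * r\<^sup>2 * E) \<le> \<eta>"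
      using E r by (simp_all only: pos_le_divide_eq) (simp_all add: t_def)
    define W where "W z = (p z * exp (cdot (a + of_real t *s axis i 1) z)) *s ((1 / of_real t) *s w)
      + (p z * exp (cdot a z)) *s ((- 1 / of_real t) *s w)" for z
    have "aut_field W"
      unfolding W_def[abs_def] by (intro aut_field_add exp_aut_multiplierD p)
    moreover have "norm (W z - (z $ i * p z * exp (cdot a z)) *s w) \<le> \<eta>" if z: "norm z \<le> r" for z
    proof -
      define x where "x = of_real t * z $ i"
      have tc: "complex_of_real t \<noteq> 0" using t by simp
      have "norm (z $ i) \<le> r" using z Finite_Cartesian_Product.norm_nth_le[of z i] by linarith
      then have nx: "norm x \<le> t * r" using t by (simp add: x_def norm_mult)
      then have "norm (exp x - 1 - x) \<le> 3 * (norm x)\<^sup>2"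
        using t by (intro norm_exp_second_order) linarith
      also have "\<dots> \<le> 3 * (t * r)\<^sup>2" using nx by (intro mult_left_mono power_mono) auto
      finally have nR: "norm (exp x - 1 - x) \<le> 3 * (t * r)\<^sup>2" .
      have zi: "z $ i = x / of_real t" using tc by (simp add: x_def)
      have ex: "exp (cdot (a + of_real t *s axis i 1) z) = exp (cdot a z) * exp x"
        by (simp add: x_def cdot_add cdot_cmult exp_add)
      have "W z - (z $ i * p z * exp (cdot a z)) *s w
          = ((exp x - 1 - x) / of_real t) *s ((p z * exp (cdot a z)) *s w)"
        unfolding W_def ex zi vec_eq_iff using tc by (simp add: field_simps)
      then have "norm (W z - (z $ i * p z * exp (cdot a z)) *s w)
          = norm ((exp x - 1 - x) / of_real t) * norm ((p z * exp (cdot a z)) *s w)"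
        by (simp only: norm_vector_scalar_mult)
      also have "\<dots> \<le> (3 * t * r\<^sup>2) * E"
        using nR t r by (intro mult_mono E(2)[OF z]) (auto simp: norm_divide field_simps power2_eq_square)
      also have "\<dots> \<le> \<eta>" using t by (simp add: mult_ac)
      finally show ?thesis .
    qed
    ultimately show "\<exists>w'. aut_field w' \<and>
        (\<forall>z. norm z \<le> r \<longrightarrow> norm (w' z - (z $ i * p z * exp (cdot a z)) *s w) \<le> \<eta>)"
      by blast
  qed
  then show ?thesis
    unfolding exp_aut_multiplier_def by (auto intro!: continuous_intros)
qed

text \<open>Euler's identity writes a homogeneous map as a multiple of the sum of coordinates times
  its partial derivatives, which have lower degree. The induction thus needs no expansion into
  monomials.\<close>

lemma exp_aut_multiplier_homogeneous:
  fixes P :: "'n::finite selfmap"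
  assumes n: "CARD('n) \<ge> 2"
  shows "holomorphic_map_on P UNIV \<Longrightarrow> homogeneous k P \<Longrightarrow> exp_aut_multiplier (\<lambda>z. P z $ i)"
proof (induction k arbitrary: P)
  case 0
  have "P z = P 0" for z
    using homogeneousD[OF 0(2), of 0 z] by simp
  then have "(\<lambda>z. P z $ i) = (\<lambda>z. P 0 $ i)" by (intro ext arg_cong[of _ _ "\<lambda>x. x $ i"])
  then show ?case using exp_aut_multiplier_const[OF n, of "P 0 $ i"] by (simp only:)
next
  case (Suc k)
  have eq: "P z $ i = inverse (of_nat (Suc k)) * (\<Sum>j\<in>UNIV. z $ j * fderiv P z (axis j 1) $ i)" for z
  proof -
    have "of_nat (Suc k) *s P z = fderiv P z (\<Sum>j\<in>UNIV. z $ j *s axis j 1)"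
      by (simp only: basis_expansion fderiv_radial[OF Suc.prems])
    also have "\<dots> = (\<Sum>j\<in>UNIV. z $ j *s fderiv P z (axis j 1))"
      by (simp only: fderiv_sum[OF Suc.prems(1) UNIV_I] fderiv_vector_scalar_mult[OF Suc.prems(1) UNIV_I])
    finally have "(of_nat (Suc k) *s P z) $ i = (\<Sum>j\<in>UNIV. z $ j *s fderiv P z (axis j 1)) $ i" by simp
    then have "of_nat (Suc k) * P z $ i = (\<Sum>j\<in>UNIV. z $ j * fderiv P z (axis j 1) $ i)"
      by (simp only: vector_smult_component sum_component)
    then show ?thesis by (simp add: field_simps del: of_nat_Suc)
  qed
  have "exp_aut_multiplier (\<lambda>z. z $ j * fderiv P z (axis j 1) $ i)" for j
    by (intro exp_aut_multiplier_coordinate Suc.IH holomorphic_map_fderiv[OF open_UNIV]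
        homogeneous_fderiv Suc.prems)
  then show ?case
    unfolding eq by (intro exp_aut_multiplier_cmult exp_aut_multiplier_sum[OF n])
qed

lemma aut_field_homogeneous:
  fixes P :: "'n::finite selfmap"
  assumes n: "CARD('n) \<ge> 2" and "holomorphic_map_on P UNIV" "homogeneous k P"
  shows "aut_field P"
proof -
  \<comment> \<open>With exponent 0 the exponential disappears, and the multipliers are the
    components of \<open>P\<close>.\<close>
  have "aut_field (\<lambda>z. \<Sum>i\<in>UNIV. (P z $ i * exp (cdot 0 z)) *s axis i 1)"
    using exp_aut_multiplier_homogeneous[OF assms]
    by (intro aut_field_sum) (simp only: exp_aut_multiplier_def)
  then show ?thesis by (simp add: basis_expansion)
qed

text \<open>The Andersen-Lempert density statement for a ball: truncate the homogeneous expansion,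
  all parts of which are entire. The radius \<open>s\<close> between \<open>r\<close> and
  \<open>R\<close> makes the remainder geometric.\<close>

lemma aut_field_approximation:
  fixes f :: "'n::finite selfmap"
  assumes n: "CARD('n) \<ge> 2" and f: "holomorphic_map_on f (ball 0 R)" and r: "0 < r" "r < R" and \<eta>: "\<eta> > 0"
  obtains W where "aut_field W" "\<And>z. norm z \<le> r \<Longrightarrow> norm (W z - f z) \<le> \<eta>"
proof -
  define s where "s = (r + R) / 2"
  have s: "s > 0" "r < s" and sR: "cball 0 s \<subseteq> ball (0 :: complex ^ 'n) R" using r by (auto simp: s_def)
  obtain M where M: "M \<ge> 0" "\<And>x. norm x \<le> s \<Longrightarrow> norm (f x) \<le> M"
    using holomorphic_map_bounded_cball[OF f sR] by auto
  define q where "q = r / s"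
  have q: "0 \<le> q" "q < 1" using r s by (auto simp: q_def)
  let ?e = "\<lambda>k. real CARD('n) * (M * q ^ k / (1 - q))"
  have "?e \<longlonglongrightarrow> 0"
    using q by (auto intro!: tendsto_eq_intros LIMSEQ_power_zero)
  then have "eventually (\<lambda>k. ?e k < \<eta>) sequentially"
    using \<eta> by (intro order_tendstoD(2)) auto
  then obtain k where k: "?e k < \<eta>" unfolding eventually_sequentially by blast
  note ball = open_ball[of 0 R]
  have 0: "(0 :: complex ^ 'n) \<in> ball 0 R" using r by simp
  define W where "W z = (\<Sum>j<k. hpart f j z)" for z
  have "aut_field (\<lambda>z. hpart f j z)" for j
    by (rule aut_field_homogeneous[OF n holomorphic_map_homogeneous_part[OF ball f s(1) sR M(2)], of j])
      (use taylor_coeff_replicate_cmult[OF ball f 0] in \<open>auto simp: homogeneous_def\<close>)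
  then have "aut_field W" unfolding W_def[abs_def] by (intro aut_field_sum)
  moreover have "norm (W z - f z) \<le> \<eta>" if z: "norm z \<le> r" for z
  proof -
    have zq: "norm z / s \<le> q" "0 \<le> norm z / s" using z s by (auto simp: q_def divide_right_mono)
    have "norm (f z - W z) \<le> real CARD('n) * (M * (norm z / s) ^ k / (1 - norm z / s))"
      unfolding W_def using z s
      by (intro homogeneous_expansion_remainder[OF ball f s(1) sR M(2)]) auto
    also have "\<dots> \<le> ?e k"
    proof (intro mult_left_mono frac_le)
      show "(norm z / s) ^ k \<le> q ^ k" using zq by (intro power_mono)
    qed (use q zq M in auto)
    finally show ?thesis using k by (simp add: norm_minus_commute)
  qed
  ultimately show ?thesis by (rule that)
qed

section \<open>Approximation by automorphisms along a Loewner chain\<close>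

lemma derivative_bound_imp_lipschitz:
  fixes g :: "'n::finite selfmap"
  assumes g: "holomorphic_map_on g (ball 0 R)"
    and c: "\<And>z v. z \<in> ball 0 R \<Longrightarrow> norm (fderiv g z v) \<le> c * norm v"
    and x: "x \<in> ball 0 R" and y: "y \<in> ball 0 R"
  shows "norm (g x - g y) \<le> c * norm (x - y)"
proof (rule differentiable_bound[OF convex_ball _ _ x y])
  show "(g has_derivative fderiv g z) (at z within ball 0 R)" if "z \<in> ball 0 R" for z
    using holomorphic_map_has_derivative[OF g that] by (rule has_derivative_at_withinI)
  show "onorm (fderiv g z) \<le> c" if "z \<in> ball 0 R" for z
    using c[OF that] by (rule onorm_le)
qed

text \<open>Divided by \<open>l^(j+1)\<close>, these are the terms of the Neumann series of
  \<open>(l + Dg(z))\<inverse> z\<close>.\<close>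

primrec neumann_term :: "'n::finite selfmap \<Rightarrow> nat \<Rightarrow> 'n selfmap"
  where
    "neumann_term g 0 z = z"
  | "neumann_term g (Suc j) z = - fderiv g z (neumann_term g j z)"

text \<open>In \<open>holomorphic_map_fderiv\<close> the direction is fixed, whereas here it depends
  on \<open>z\<close>; expanding it in the standard basis separates the two dependences.\<close>

lemma holomorphic_map_neumann_term:
  assumes S: "open S" and g: "holomorphic_map_on g S"
  shows "holomorphic_map_on (neumann_term g j) S"
proof (induction j)
  case (Suc j)
  have "holomorphic_map_on (\<lambda>z. - (\<Sum>i\<in>UNIV. neumann_term g j z $ i *s fderiv g z (axis i 1))) S"
    by (intro holomorphic_map_minus holomorphic_map_sum holomorphic_map_component_mult Suc
        holomorphic_map_fderiv[OF S g])
  moreover have eq: "neumann_term g (Suc j) z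
      = - (\<Sum>i\<in>UNIV. neumann_term g j z $ i *s fderiv g z (axis i 1))" if z: "z \<in> S" for z
  proof -
    have "fderiv g z (\<Sum>i\<in>UNIV. neumann_term g j z $ i *s axis i 1)
        = (\<Sum>i\<in>UNIV. neumann_term g j z $ i *s fderiv g z (axis i 1))"
      by (simp only: fderiv_sum[OF g z] fderiv_vector_scalar_mult[OF g z])
    then show ?thesis by (simp add: basis_expansion)
  qed
  ultimately show ?case
    by (subst holomorphic_map_cong_open[OF S eq])
qed (simp add: neumann_term.simps(1)[abs_def])

lemma norm_neumann_term_le:
  assumes "\<And>v. norm (fderiv g z v) \<le> c * norm v" "0 \<le> c"
  shows "norm (neumann_term g j z) \<le> c ^ j * norm z"
proof (induction j)
  case (Suc j)
  have "norm (neumann_term g (Suc j) z) \<le> c * norm (neumann_term g j z)" using assms by simp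
  also have "\<dots> \<le> c * (c ^ j * norm z)" using Suc assms by (intro mult_left_mono)
  finally show ?case by simp
qed simp

text \<open>Applying \<open>l + Dg(z)\<close> to the truncated series telescopes, and the defect is
  the next term, which is small when \<open>Dg\<close> is a contraction.\<close>

lemma neumann_sum:
  fixes J :: nat
  assumes g: "holomorphic_map_on g S" and z: "z \<in> S" and l: "l > 0"
  defines "W \<equiv> (\<Sum>j<J. (1 / l) ^ Suc j *\<^sub>R neumann_term g j z)"
  shows "l *\<^sub>R W + fderiv g z W = z - (1 / l) ^ J *\<^sub>R neumann_term g J z"
proof -
  define a where "a j = (1 / l) ^ j *\<^sub>R neumann_term g j z" for j
  have "fderiv g z (r *\<^sub>R v) = r *\<^sub>R fderiv g z v" for r v
    by (simp only: scaleR_eq_vector_scalar_mult fderiv_vector_scalar_mult[OF g z])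
  then have "fderiv g z W = (\<Sum>j<J. - a (Suc j))"
    unfolding W_def fderiv_sum[OF g z] a_def by (simp only: neumann_term.simps scaleR_minus_right minus_minus)
  moreover have "l *\<^sub>R W = (\<Sum>j<J. a j)"
    unfolding W_def scaleR_sum_right a_def using l by (intro sum.cong) auto
  ultimately have "l *\<^sub>R W + fderiv g z W = (\<Sum>j<J. a j - a (Suc j))"
    by (simp add: sum_subtractf sum_negf)
  also have "\<dots> = a 0 - a J" by (rule sum_lessThan_telescope')
  finally show ?thesis by (simp add: a_def)
qed

text \<open>The maps \<open>F\<^sub>l z = l z + g z\<close> form a Loewner chain: with \<open>W = (l + Dg(z))\<inverse> z\<close> one has
  \<open>F\<^sub>l\<^sub>+\<^sub>h (z - h W) = F\<^sub>l z + O(h\<^sup>2)\<close>, and \<open>W\<close> is a holomorphic vector field on the ball, pointing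
  outwards because \<open>\<parallel>Dg\<parallel> < 1\<close>. So the transition maps can be approximated by automorphisms that
  preserve the ball. The inverse is replaced by a partial sum of its Neumann series.\<close>

lemma loewner_step:
  fixes g :: "'n::finite selfmap"
  assumes n: "CARD('n) \<ge> 2" and g: "holomorphic_map_on g (ball 0 R)"
    and c: "0 \<le> c" "c < 1" "\<And>z v. z \<in> ball 0 R \<Longrightarrow> norm (fderiv g z v) \<le> c * norm v"
    and r: "0 < r" "r < R" and L: "L \<ge> 1" and \<delta>: "\<delta> > 0"
  obtains h\<^sub>0 where "h\<^sub>0 > 0"
    "\<And>h l. 0 < h \<Longrightarrow> h < h\<^sub>0 \<Longrightarrow> 1 \<le> l \<Longrightarrow> l \<le> L \<Longrightarrow> \<exists>\<psi>\<in>Aut_space. \<forall>z. norm z \<le> r \<longrightarrow>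
      norm (\<psi> z) \<le> r \<and> norm ((l + h) *\<^sub>R \<psi> z + g (\<psi> z) - (l *\<^sub>R z + g z)) \<le> \<delta> * h"
proof -
  \<comment> \<open>\<open>\<kappa>\<close> measures how far \<open>W\<close> points outwards:
    \<open>z \<bullet> W \<ge> \<kappa> * (norm z)\<^sup>2\<close>. From
    \<open>norm W \<ge> norm z / (2 * (L + 1))\<close> one gets twice this amount, and half of it is
    spent on the truncation of the series.\<close>
  define \<kappa> where "\<kappa> = (1 - c) / (8 * (L + 1)\<^sup>2)"
  define B where "B = 2 * r / (1 - c)"
  define s where "s = (R - r) / 2"
  \<comment> \<open>The first entry makes the deviation \<open>2 * d * h\<close> of
    \<open>\<psi> z\<close> from \<open>y\<close> at most the inward gain
    \<open>r * \<kappa> / 2 * h\<close>; the second keeps all errors linear in \<open>d\<close>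
    below half of \<open>\<delta> * h\<close>.\<close>
  define d where "d = min (r * \<kappa> / 4) (\<delta> / (2 * (2 * L + 5)))"
  have \<kappa>: "\<kappa> > 0" using c L by (simp add: \<kappa>_def)
  have B: "B > 0" using c r by (simp add: B_def)
  have s: "s > 0" using r by (simp add: s_def)
  have d: "d > 0" using r \<kappa> \<delta> L by (simp add: d_def)
  have "r + s < R" using r unfolding s_def by argo
  then have sR: "cball 0 (r + s) \<subseteq> ball (0 :: complex ^ 'n) R" by auto
  obtain M where M: "M \<ge> 0" "\<And>x. x \<in> cball 0 (r + s) \<Longrightarrow> norm (g x) \<le> M"
    using holomorphic_map_bounded_cball[OF g sR] by blast
  define K where "K = B + real CARD('n) * (2 * M * (B / s)\<^sup>2)"
  have K: "K > 0" using B M by (simp add: K_def add_pos_nonneg)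
  have "(\<lambda>J. c ^ J) \<longlonglongrightarrow> 0" using c by (intro LIMSEQ_power_zero) auto
  \<comment> \<open>The three entries bound the truncation error \<open>e\<close> by half of
    \<open>norm z\<close>, by \<open>d\<close>, and by what the inner product estimate can
    lose.\<close>
  moreover define \<theta> where "\<theta> = min (1 / 2) (min (d / r) (\<kappa> * (1 - c) / 2))"
  have "\<theta> > 0" using d r \<kappa> c by (simp add: \<theta>_def)
  ultimately have "eventually (\<lambda>J. c ^ J < \<theta>) sequentially" by (intro order_tendstoD(2))
  then obtain J where J: "c ^ J < \<theta>" unfolding eventually_sequentially by blast
  have cJ: "c ^ J \<le> 1 / 2" "c ^ J * r \<le> d" "c ^ J * 2 \<le> \<kappa> * (1 - c)"
    using J r by (auto simp: \<theta>_def pos_less_divide_eq less_imp_le)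
  define T where "T = neumann_term g"
  \<comment> \<open>The sign is reversed because the step moves against \<open>W\<close>. The
    tolerance lets \<open>J\<close> such errors add up to less than \<open>d\<close>.\<close>
  have "\<exists>W. aut_field W \<and> (\<forall>z. norm z \<le> r \<longrightarrow> norm (W z - - T j z) \<le> d / real (Suc J))" for j
  proof -
    have "holomorphic_map_on (\<lambda>z. - T j z) (ball 0 R)"
      unfolding T_def by (intro holomorphic_map_minus holomorphic_map_neumann_term g open_ball)
    from aut_field_approximation[OF n this r, of "d / real (Suc J)"] d show ?thesis by auto
  qed
  then obtain V where V: "\<And>j. aut_field (V j)"
    "\<And>j z. norm z \<le> r \<Longrightarrow> norm (V j z + T j z) \<le> d / real (Suc J)"
    by (simp only: diff_minus_eq_add) metis
  obtain h1 where h1: "h1 > 0" "\<And>h t. 0 < h \<Longrightarrow> h < h1 \<Longrightarrow> \<forall>j<J. 0 \<le> t j \<and> t j \<le> 1 \<Longrightarrow>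
    \<exists>\<psi>\<in>Aut_space. \<forall>z. norm z \<le> r \<longrightarrow> norm (\<psi> z - z - h *\<^sub>R (\<Sum>j<J. t j *\<^sub>R V j z)) \<le> d * h"
    using aut_field_combination[of J V r d] V(1) r d by auto
  \<comment> \<open>Besides the threshold \<open>h1\<close>: \<open>1 / \<kappa>\<close> keeps the
    contraction factor nonnegative, the next bound lets \<open>h\<^sup>2 * (norm W)\<^sup>2\<close>
    consume only half of the inward gain, \<open>s / (2 * B)\<close> admits the second-order
    estimate, and the last one makes the quadratic errors small.\<close>
  define h0 where "h0 = min (min h1 1) (min (min (1 / \<kappa>) (\<kappa> * (1 - c)\<^sup>2 / 4)) (min (s / (2 * B)) (\<delta> / (2 * K))))"
  show ?thesis
  proof (rule that)
    show "h0 > 0" using h1 \<kappa> c s B K \<delta> by (simp add: h0_def)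
    fix h l assume h: "0 < h" "h < h0" and l: "1 \<le> l" "l \<le> L"
    have hh: "h < h1" "h \<le> 1" "h * \<kappa> \<le> 1" "h * 4 \<le> \<kappa> * (1 - c)\<^sup>2" "h * B \<le> s / 2" "h * K \<le> \<delta> / 2"
    proof -
      have "h \<le> 1 / \<kappa>" "h \<le> \<kappa> * (1 - c)\<^sup>2 / 4" "h \<le> s / (2 * B)" "h \<le> \<delta> / (2 * K)"
        using h by (simp_all add: h0_def)
      then show "h * \<kappa> \<le> 1" "h * 4 \<le> \<kappa> * (1 - c)\<^sup>2" "h * B \<le> s / 2" "h * K \<le> \<delta> / 2"
        using \<kappa> B K by (simp_all add: field_simps)
    qed (use h in \<open>simp_all add: h0_def\<close>)
    \<comment> \<open>The dependence on \<open>l\<close> sits entirely in these coefficients, which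
      lie between 0 and 1 since \<open>l \<ge> 1\<close>.\<close>
    define t where "t j = (1 / l) ^ Suc j" for j
    have t: "0 \<le> t j" "t j \<le> 1" for j
      unfolding t_def using l by (auto intro!: power_le_one simp del: power_Suc)
    obtain \<psi> where \<psi>: "\<psi> \<in> Aut_space"
      "\<And>z. norm z \<le> r \<Longrightarrow> norm (\<psi> z - z - h *\<^sub>R (\<Sum>j<J. t j *\<^sub>R V j z)) \<le> d * h"
      using h1(2)[OF h(1) hh(1), of t] t by blast
    have "norm (\<psi> z) \<le> r \<and> norm ((l + h) *\<^sub>R \<psi> z + g (\<psi> z) - (l *\<^sub>R z + g z)) \<le> \<delta> * h"
      if z: "norm z \<le> r" for z
    proof -
      have zR: "z \<in> ball 0 R" using z r by simp
      define W where "W = (\<Sum>j<J. t j *\<^sub>R T j z)"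
      define e where "e = (1 / l) ^ J *\<^sub>R T J z"
      define y where "y = z - h *\<^sub>R W"
      have We: "l *\<^sub>R W + fderiv g z W = z - e"
        using neumann_sum[OF g zR, of l J] l by (simp add: W_def e_def T_def t_def)
      have DW: "norm (fderiv g z W) \<le> c * norm W" by (rule c(3)[OF zR])
      have e: "norm e \<le> c ^ J * norm z"
      proof -
        have "norm e \<le> 1 * norm (T J z)"
          unfolding e_def norm_scaleR using l by (intro mult_right_mono) (auto intro!: power_le_one)
        then show ?thesis
          using norm_neumann_term_le[of g z c J, OF c(3)[OF zR] c(1)] by (simp add: T_def)
      qed
      have "c ^ J * norm z \<le> 1 / 2 * norm z" using cJ(1) by (intro mult_right_mono) auto
      then have e2: "norm e \<le> norm z / 2" using e by simp
      have cW: "c * norm W \<le> norm W" "0 \<le> c * norm W" using c by (auto intro: mult_left_le_one_le)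
      have nlW: "norm (l *\<^sub>R W) = l * norm W" using l by simp
      have "l * norm W \<le> norm (z - e) + norm (fderiv g z W)"
        unfolding nlW[symmetric] using norm_triangle_ineq4[of "z - e" "fderiv g z W"]
        by (simp add: We[symmetric])
      also have "norm (z - e) \<le> norm z + norm z"
        using norm_triangle_ineq4[of z e] e2 norm_ge_zero[of z] by linarith
      finally have "l * norm W \<le> 2 * norm z + c * norm W" using DW by simp
      moreover have "norm W \<le> l * norm W" using l by (simp add: mult_le_cancel_right1)
      ultimately have "(1 - c) * norm W \<le> 2 * norm z" by (simp add: algebra_simps)
      then have Wle: "norm W \<le> 2 * norm z / (1 - c)" using c by (simp add: field_simps)
      also have "\<dots> \<le> B" unfolding B_def using z c by (intro divide_right_mono) auto
      finally have WB: "norm W \<le> B" .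
      have "norm z / 2 \<le> norm (z - e)" using norm_triangle_ineq2[of z e] e2 by linarith
      also have "\<dots> \<le> l * norm W + norm (fderiv g z W)"
        unfolding We[symmetric] nlW[symmetric] by (rule norm_triangle_ineq)
      also have "\<dots> \<le> L * norm W + norm W"
        using DW cW l by (intro add_mono mult_right_mono) auto
      finally have Wge: "norm z / (2 * (L + 1)) \<le> norm W" using L by (simp add: field_simps)
      \<comment> \<open>Take the inner product of \<open>We\<close> with \<open>W\<close>: since
        \<open>l \<ge> 1\<close>, the contraction \<open>Dg\<close> can consume only the fraction
        \<open>c\<close> of the main term.\<close>
      have zW: "\<kappa> * (norm z)\<^sup>2 \<le> z \<bullet> W"
      proof -
        have "z \<bullet> W = l * (norm W)\<^sup>2 + fderiv g z W \<bullet> W + e \<bullet> W"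
          using arg_cong[OF We, of "\<lambda>x. x \<bullet> W"] by (simp add: inner_add_left inner_diff_left power2_norm_eq_inner)
        moreover have "- (fderiv g z W \<bullet> W) \<le> c * (norm W)\<^sup>2"
          using order_trans[OF Cauchy_Schwarz_ineq2[of "fderiv g z W" W] mult_right_mono[OF DW norm_ge_zero[of W]]]
          by (simp add: power2_eq_square mult.assoc)
        moreover have "- (e \<bullet> W) \<le> \<kappa> * (norm z)\<^sup>2"
        proof -
          have "- (e \<bullet> W) \<le> norm e * norm W"
            using Cauchy_Schwarz_ineq2[of e W] by linarith
          also have "\<dots> \<le> (c ^ J * norm z) * (2 * norm z / (1 - c))"
            using c by (intro mult_mono e Wle) auto
          also have "\<dots> = (c ^ J * 2) * ((norm z)\<^sup>2 / (1 - c))" by (simp add: power2_eq_square)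
          also have "\<dots> \<le> (\<kappa> * (1 - c)) * ((norm z)\<^sup>2 / (1 - c))"
            using c by (intro mult_right_mono cJ) auto
          also have "\<dots> = \<kappa> * (norm z)\<^sup>2" using c by simp
          finally show ?thesis .
        qed
        moreover have "2 * \<kappa> * (norm z)\<^sup>2 \<le> (1 - c) * (norm W)\<^sup>2"
        proof -
          have "2 * \<kappa> * (norm z)\<^sup>2 = (1 - c) * (norm z / (2 * (L + 1)))\<^sup>2"
          proof -
            have "2 * (a / (8 * X)) * Z = a * (Z / (2\<^sup>2 * X))" for a X Z :: real by simp
            then show ?thesis by (simp only: \<kappa>_def power_divide power_mult_distrib)
          qed
          also have "\<dots> \<le> (1 - c) * (norm W)\<^sup>2"
            using c L by (intro mult_left_mono power_mono Wge) auto
          finally show ?thesis .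
        qed
        moreover have "(norm W)\<^sup>2 \<le> l * (norm W)\<^sup>2" using l by (simp add: mult_le_cancel_right1)
        ultimately show ?thesis by (simp add: algebra_simps)
      qed
      have hk: "0 \<le> h * \<kappa>" using h \<kappa> by simp
      have ny: "norm y \<le> r * (1 - h * \<kappa> / 2)"
      proof -
        have "(norm y)\<^sup>2 = (norm z)\<^sup>2 - 2 * h * (z \<bullet> W) + h\<^sup>2 * (norm W)\<^sup>2"
          unfolding y_def power2_norm_eq_inner
          by (simp add: inner_diff_left inner_diff_right inner_commute power2_eq_square algebra_simps)
        also have "\<dots> \<le> (norm z)\<^sup>2 - 2 * h * (\<kappa> * (norm z)\<^sup>2) + h\<^sup>2 * (2 * norm z / (1 - c))\<^sup>2"
          using h by (intro add_mono diff_mono order_refl mult_left_mono zW power_mono Wle) auto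
        also have "h\<^sup>2 * (2 * norm z / (1 - c))\<^sup>2 = h * ((h * 4) * ((norm z)\<^sup>2 / (1 - c)\<^sup>2))"
          by (simp add: power2_eq_square)
        also have "\<dots> \<le> h * ((\<kappa> * (1 - c)\<^sup>2) * ((norm z)\<^sup>2 / (1 - c)\<^sup>2))"
          using h hh by (intro mult_left_mono mult_right_mono) auto
        also have "\<dots> = h * \<kappa> * (norm z)\<^sup>2" using c by simp
        finally have "(norm y)\<^sup>2 \<le> (norm z)\<^sup>2 * (1 - h * \<kappa>)" by (simp add: algebra_simps)
        also have "\<dots> \<le> (norm z)\<^sup>2 * (1 - h * \<kappa> / 2)\<^sup>2"
        proof (intro mult_left_mono)
          have "1 - x \<le> (1 - x / 2)\<^sup>2" for x :: real by (simp add: power2_eq_square algebra_simps)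
          then show "1 - h * \<kappa> \<le> (1 - h * \<kappa> / 2)\<^sup>2" .
        qed simp
        also have "\<dots> = (norm z * (1 - h * \<kappa> / 2))\<^sup>2" by (simp add: power_mult_distrib)
        finally have "norm y \<le> norm z * (1 - h * \<kappa> / 2)"
          by (rule power2_le_imp_le) (use hh in auto)
        also have "\<dots> \<le> r * (1 - h * \<kappa> / 2)" using z hh by (intro mult_right_mono) auto
        finally show ?thesis .
      qed
      have \<psi>y: "norm (\<psi> z - y) \<le> 2 * d * h"
      proof -
        have "\<psi> z - y = (\<psi> z - z - h *\<^sub>R (\<Sum>j<J. t j *\<^sub>R V j z)) + h *\<^sub>R (\<Sum>j<J. t j *\<^sub>R (V j z + T j z))"
          by (simp add: y_def W_def scaleR_add_right sum.distrib)
        also have "norm \<dots> \<le> d * h + h * d"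
        proof (intro norm_triangle_mono \<psi>(2)[OF z])
          have "norm (\<Sum>j<J. t j *\<^sub>R (V j z + T j z)) \<le> (\<Sum>j<J. d / real (Suc J))"
          proof (rule sum_norm_le)
            fix j
            have "norm (t j *\<^sub>R (V j z + T j z)) \<le> 1 * norm (V j z + T j z)"
              unfolding norm_scaleR using t by (intro mult_right_mono) auto
            then show "norm (t j *\<^sub>R (V j z + T j z)) \<le> d / real (Suc J)" using V(2)[OF z, of j] by linarith
          qed
          also have "\<dots> \<le> d" using d by (simp add: field_simps)
          finally show "norm (h *\<^sub>R (\<Sum>j<J. t j *\<^sub>R (V j z + T j z))) \<le> h * d" using h by simp
        qed
        finally show ?thesis by simp
      qed
      have nr: "norm (\<psi> z) \<le> r"
      proof -
        have "2 * d * h \<le> r * \<kappa> / 2 * h" using h by (intro mult_right_mono) (auto simp: d_def)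
        moreover have "norm (\<psi> z) \<le> norm y + norm (\<psi> z - y)"
          using norm_triangle_ineq[of y "\<psi> z - y"] by simp
        ultimately show ?thesis using ny \<psi>y by (simp add: algebra_simps)
      qed
      have "r * (1 - h * \<kappa> / 2) \<le> r * 1" using r hk by (intro mult_left_mono) auto
      then have yr: "norm y \<le> r" using ny by simp
      have 1: "norm ((l + h) *\<^sub>R (\<psi> z - y) + (g (\<psi> z) - g y)) \<le> (2 * L + 4) * d * h"
      proof -
        have "norm (g (\<psi> z) - g y) \<le> c * norm (\<psi> z - y)"
          by (rule derivative_bound_imp_lipschitz[OF g c(3)]) (use nr yr r in auto)
        also have "\<dots> \<le> 1 * norm (\<psi> z - y)" using c by (intro mult_right_mono) auto
        finally have "norm ((l + h) *\<^sub>R (\<psi> z - y) + (g (\<psi> z) - g y)) \<le> (l + h) * norm (\<psi> z - y) + norm (\<psi> z - y)"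
          using l h by (intro norm_triangle_mono) auto
        also have "\<dots> = (l + h + 1) * norm (\<psi> z - y)" by (simp add: algebra_simps)
        also have "\<dots> \<le> (L + 2) * (2 * d * h)" using l hh h L by (intro mult_mono \<psi>y) auto
        finally show ?thesis by (simp add: algebra_simps)
      qed
      have 2: "norm (g y - g z + h *\<^sub>R fderiv g z W) \<le> h * (real CARD('n) * (2 * M * (B / s)\<^sup>2)) * h"
      proof -
        have hW: "norm (h *\<^sub>R W) \<le> h * B" using h WB by simp
        have sub: "cball z s \<subseteq> cball 0 (r + s)"
        proof
          fix x assume "x \<in> cball z s"
          then show "x \<in> cball 0 (r + s)" using z dist_triangle[of 0 x z] by simp
        qed
        have "norm (g (z + - (h *\<^sub>R W)) - g z - fderiv g z (- (h *\<^sub>R W)))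
            \<le> real CARD('n) * (2 * M * (norm (- (h *\<^sub>R W)) / s)\<^sup>2)"
          by (rule holomorphic_map_second_order[OF g _ s M(2)])
            (use sub sR hW hh in \<open>auto simp del: norm_scaleR\<close>)
        also have "\<dots> \<le> real CARD('n) * (2 * M * (h * B / s)\<^sup>2)"
          using hW M s by (intro mult_left_mono power_mono divide_right_mono) (auto simp del: norm_scaleR)
        also have "fderiv g z (- (h *\<^sub>R W)) = - (h *\<^sub>R fderiv g z W)"
          by (simp only: fderiv_minus[OF g zR] scaleR_eq_vector_scalar_mult fderiv_vector_scalar_mult[OF g zR])
        finally show ?thesis by (simp add: y_def power2_eq_square mult_ac)
      qed
      \<comment> \<open>Inserting the Neumann identity into
        \<open>(l + h) y + g z - h Dg(z) W\<close> gives
        \<open>l z + g z + h e - h\<^sup>2 W\<close>: all main terms of first order in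
        \<open>h\<close> cancel.\<close>
      have "(l + h) *\<^sub>R \<psi> z + g (\<psi> z) - (l *\<^sub>R z + g z)
          = ((l + h) *\<^sub>R (\<psi> z - y) + (g (\<psi> z) - g y)) + (h *\<^sub>R e
            + (- ((h * h) *\<^sub>R W) + (g y - g z + h *\<^sub>R fderiv g z W)))"
      proof -
        have e_eq: "e = z - l *\<^sub>R W - fderiv g z W"
          unfolding diff_diff_eq We by simp
        show ?thesis unfolding e_eq y_def by (simp add: algebra_simps)
      qed
      also have "norm \<dots> \<le> (2 * L + 4) * d * h + (h * d + (h * B * h + h * (real CARD('n) * (2 * M * (B / s)\<^sup>2)) * h))"
      proof (intro norm_triangle_mono 1 2)
        have "norm e \<le> d" using e mult_left_mono[OF z, of "c ^ J"] cJ c by (simp add: mult.commute) 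
        then show "norm (h *\<^sub>R e) \<le> h * d" using h by simp
        show "norm (- ((h * h) *\<^sub>R W)) \<le> h * B * h" using h WB by (simp add: mult_left_mono)
      qed
      also have "\<dots> = (2 * L + 5) * d * h + h * K * h" by (simp add: K_def algebra_simps)
      also have "\<dots> \<le> \<delta> / 2 * h + \<delta> / 2 * h"
      proof (intro add_mono mult_right_mono hh)
        have "d \<le> \<delta> / (2 * (2 * L + 5))" by (simp add: d_def)
        then show "(2 * L + 5) * d \<le> \<delta> / 2" using L by (simp add: field_simps)
      qed (use h in auto)
      finally show ?thesis using nr by simp
    qed
    with \<psi>(1) show "\<exists>\<psi>\<in>Aut_space. \<forall>z. norm z \<le> r \<longrightarrow>
        norm (\<psi> z) \<le> r \<and> norm ((l + h) *\<^sub>R \<psi> z + g (\<psi> z) - (l *\<^sub>R z + g z)) \<le> \<delta> * h"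
      by blast
  qed
qed

text \<open>Since \<open>F\<^sub>1 = f\<close> and \<open>F\<^sub>L \<circ> \<Psi> \<approx> f\<close> stays bounded as \<open>L\<close> grows, \<open>\<Psi>\<close> is of size \<open>O(1 / L)\<close>,
  so that \<open>F\<^sub>L \<circ> \<Psi>\<close> differs little from the automorphism \<open>L \<Psi>\<close>.\<close>

lemma automorphism_approximation:
  fixes f :: "'n::finite selfmap"
  assumes n: "CARD('n) \<ge> 2" and f: "holomorphic_map_on f (ball 0 R)" and f0: "f 0 = 0"
    and c: "0 \<le> c" "c < 1" "\<And>z v. z \<in> ball 0 R \<Longrightarrow> norm (fderiv f z v - v) \<le> c * norm v"
    and r: "0 < r" "r < R" and \<delta>: "\<delta> > 0"
  obtains \<Phi> where "\<Phi> \<in> Aut_space" "\<And>z. norm z \<le> r \<Longrightarrow> norm (\<Phi> z - f z) \<le> \<delta>"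
proof -
  define g where "g z = f z - z" for z
  have g: "holomorphic_map_on g (ball 0 R)"
    unfolding g_def[abs_def] by (intro holomorphic_map_diff f holomorphic_map_ident)
  have gc: "norm (fderiv g z v) \<le> c * norm v" if z: "z \<in> ball 0 R" for z v
  proof -
    have "fderiv g z v = fderiv f z v - fderiv (\<lambda>z. z) z v"
      unfolding g_def[abs_def] by (rule fderiv_diff_fun[OF f holomorphic_map_ident z])
    then show ?thesis using c(3)[OF z] fderiv_eqI[OF has_derivative_ident, of z] by simp
  qed
  have g0: "g 0 = 0" by (simp add: g_def f0)
  have gle: "norm (g w) \<le> norm w" if "norm w \<le> r" for w
  proof -
    have "norm (g w - g 0) \<le> c * norm (w - 0)"
      by (rule derivative_bound_imp_lipschitz[OF g gc]) (use that r in auto)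
    also have "\<dots> \<le> 1 * norm w" using c by (intro mult_mono) auto
    finally show ?thesis by (simp add: g0)
  qed
  have rR: "cball 0 r \<subseteq> ball (0 :: complex ^ 'n) R" using r by auto
  obtain M where M: "M \<ge> 0" "\<And>x. norm x \<le> r \<Longrightarrow> norm (f x) \<le> M"
    using holomorphic_map_bounded_cball[OF f rR] by auto
  \<comment> \<open>The chain runs from 1 to \<open>1 + D\<close>. At its end
    \<open>D * norm (\<Psi> z) \<le> M + \<delta>\<close>, which by this choice means
    \<open>norm (\<Psi> z) \<le> \<delta> / 2\<close>. The rate \<open>\<eta>\<close> spreads the
    other \<open>\<delta> / 2\<close> over the length \<open>D\<close>.\<close>
  define D where "D = 2 * (M + \<delta>) / \<delta>"
  have D: "D > 0" using M \<delta> by (simp add: D_def)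
  define \<eta> where "\<eta> = \<delta> / 2 / D"
  have \<eta>: "\<eta> > 0" using D \<delta> by (simp add: \<eta>_def)
  obtain h0 where h0: "h0 > 0"
    "\<And>h l. 0 < h \<Longrightarrow> h < h0 \<Longrightarrow> 1 \<le> l \<Longrightarrow> l \<le> 1 + D \<Longrightarrow> \<exists>\<psi>\<in>Aut_space. \<forall>z. norm z \<le> r \<longrightarrow>
      norm (\<psi> z) \<le> r \<and> norm ((l + h) *\<^sub>R \<psi> z + g (\<psi> z) - (l *\<^sub>R z + g z)) \<le> \<eta> * h"
    by (rule loewner_step[OF n g c(1,2) gc r, of "1 + D" \<eta>]) (use D \<eta> in auto)
  obtain N where N: "D / h0 < real N" using reals_Archimedean2 by blast
  then have N0: "N > 0" using D h0 by (cases N) (auto simp: field_simps)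
  define h where "h = D / real N"
  have h: "h > 0" "h < h0" "real N * h = D" using N N0 D h0 by (auto simp: h_def field_simps)
  \<comment> \<open>Each new map is applied on the outside, to a point that is still in the ball,
    and its error is measured after applying the member of the chain. Hence the errors add without
    amplification by a Lipschitz constant.\<close>
  have "i \<le> N \<Longrightarrow> \<exists>\<Psi>\<in>Aut_space. \<forall>z. norm z \<le> r \<longrightarrow>
      norm (\<Psi> z) \<le> r \<and> norm ((1 + real i * h) *\<^sub>R \<Psi> z + g (\<Psi> z) - f z) \<le> \<eta> * (real i * h)" for i
  proof (induction i)
    case 0
    then show ?case by (intro bexI[OF _ Aut_space_ident]) (simp add: g_def)
  next
    case (Suc i)
    then obtain \<Psi> where \<Psi>: "\<Psi> \<in> Aut_space" "\<And>z. norm z \<le> r \<Longrightarrow> norm (\<Psi> z) \<le> r"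
      "\<And>z. norm z \<le> r \<Longrightarrow> norm ((1 + real i * h) *\<^sub>R \<Psi> z + g (\<Psi> z) - f z) \<le> \<eta> * (real i * h)"
      by auto
    have "real i * h \<le> real N * h" using Suc.prems h by (intro mult_right_mono) auto
    then have "\<exists>\<psi>\<in>Aut_space. \<forall>z. norm z \<le> r \<longrightarrow> norm (\<psi> z) \<le> r \<and>
        norm (((1 + real i * h) + h) *\<^sub>R \<psi> z + g (\<psi> z) - ((1 + real i * h) *\<^sub>R z + g z)) \<le> \<eta> * h"
      using h by (intro h0(2)) auto
    then obtain \<psi> where \<psi>: "\<psi> \<in> Aut_space" "\<And>z. norm z \<le> r \<Longrightarrow> norm (\<psi> z) \<le> r"
      "\<And>z. norm z \<le> r \<Longrightarrow>
        norm (((1 + real i * h) + h) *\<^sub>R \<psi> z + g (\<psi> z) - ((1 + real i * h) *\<^sub>R z + g z)) \<le> \<eta> * h"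
      by auto
    have "norm (\<psi> (\<Psi> z)) \<le> r \<and>
        norm ((1 + real (Suc i) * h) *\<^sub>R \<psi> (\<Psi> z) + g (\<psi> (\<Psi> z)) - f z) \<le> \<eta> * (real (Suc i) * h)"
      if z: "norm z \<le> r" for z
    proof
      note r1 = \<Psi>(2)[OF z]
      show "norm (\<psi> (\<Psi> z)) \<le> r" by (rule \<psi>(2)[OF r1])
      have "(1 + real (Suc i) * h) *\<^sub>R \<psi> (\<Psi> z) + g (\<psi> (\<Psi> z)) - f z
          = (((1 + real i * h) + h) *\<^sub>R \<psi> (\<Psi> z) + g (\<psi> (\<Psi> z)) - ((1 + real i * h) *\<^sub>R \<Psi> z + g (\<Psi> z)))
            + ((1 + real i * h) *\<^sub>R \<Psi> z + g (\<Psi> z) - f z)"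
        by (simp add: algebra_simps)
      also have "norm \<dots> \<le> \<eta> * h + \<eta> * (real i * h)"
        by (intro norm_triangle_mono \<psi>(3)[OF r1] \<Psi>(3)[OF z])
      finally show "norm ((1 + real (Suc i) * h) *\<^sub>R \<psi> (\<Psi> z) + g (\<psi> (\<Psi> z)) - f z) \<le> \<eta> * (real (Suc i) * h)"
        by (simp add: algebra_simps)
    qed
    then show ?case
      by (intro bexI[OF _ Aut_space_compose[OF \<psi>(1) \<Psi>(1)]] allI impI)
  qed
  from this[of N] obtain \<Psi> where \<Psi>: "\<Psi> \<in> Aut_space" "\<And>z. norm z \<le> r \<Longrightarrow> norm (\<Psi> z) \<le> r"
    "\<And>z. norm z \<le> r \<Longrightarrow> norm ((1 + D) *\<^sub>R \<Psi> z + g (\<Psi> z) - f z) \<le> \<eta> * D"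
    unfolding h(3) by auto
  have \<eta>D: "\<eta> * D = \<delta> / 2" using D by (simp add: \<eta>_def)
  have "of_real (1 + D) \<noteq> (0 :: complex)" using D by (simp only: of_real_eq_0_iff)
  from Aut_space_compose[OF Aut_space_cmult[OF this] \<Psi>(1)]
  have "(\<lambda>z. of_real (1 + D) *s \<Psi> z) \<in> Aut_space" .
  then have "(\<lambda>z. (1 + D) *\<^sub>R \<Psi> z) \<in> Aut_space" by (simp only: scaleR_eq_vector_scalar_mult)
  moreover have "norm ((1 + D) *\<^sub>R \<Psi> z - f z) \<le> \<delta>" if z: "norm z \<le> r" for z
  proof -
    let ?E = "(1 + D) *\<^sub>R \<Psi> z + g (\<Psi> z) - f z"
    have E: "norm ?E \<le> \<delta> / 2" using \<Psi>(3)[OF z] by (simp only: \<eta>D)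
    have gz: "norm (g (\<Psi> z)) \<le> norm (\<Psi> z)" by (rule gle[OF \<Psi>(2)[OF z]])
    have "norm (?E + f z - g (\<Psi> z)) \<le> norm ?E + norm (f z) + norm (g (\<Psi> z))"
      by (rule order_trans[OF norm_triangle_ineq4 add_right_mono[OF norm_triangle_ineq]])
    also have "?E + f z - g (\<Psi> z) = (1 + D) *\<^sub>R \<Psi> z" by simp
    finally have "(1 + D) * norm (\<Psi> z) \<le> \<delta> / 2 + M + norm (\<Psi> z)"
      using E M(2)[OF z] gz D by simp
    then have "D * norm (\<Psi> z) \<le> M + \<delta>" using \<delta> by (simp add: algebra_simps)
    moreover have "D * (\<delta> / 2) = M + \<delta>" using \<delta> by (simp add: D_def)
    ultimately have "norm (\<Psi> z) \<le> \<delta> / 2" using mult_le_cancel_left_pos[OF D] by metis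
    moreover have "norm ((1 + D) *\<^sub>R \<Psi> z - f z) \<le> norm ?E + norm (g (\<Psi> z))"
    proof -
      have "norm (?E - g (\<Psi> z)) \<le> norm ?E + norm (g (\<Psi> z))"
        by (rule norm_triangle_ineq4)
      also have "?E - g (\<Psi> z) = (1 + D) *\<^sub>R \<Psi> z - f z" by simp
      finally show ?thesis .
    qed
    ultimately show ?thesis using E gz by linarith
  qed
  ultimately show ?thesis by (rule that)
qed

section \<open>The two classes of maps\<close>

lemma openin_uniform_ball:
  fixes f :: "'n::finite selfmap"
  assumes f: "f \<in> hol_maps" and K: "compact K" "K \<subseteq> unit_ball"
  shows "openin hol_topology {g \<in> hol_maps. \<forall>z\<in>K. dist (g z) (f z) < e}"
  unfolding openin_hol_topology
proof (intro conjI ballI)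
  fix g assume g: "g \<in> {g \<in> hol_maps. \<forall>z\<in>K. dist (g z) (f z) < e}"
  \<comment> \<open>On a nonempty compact set the distance attains its maximum, so the strict
    inequality leaves uniform room.\<close>
  have "\<exists>d>0. \<forall>z\<in>K. dist (g z) (f z) + d \<le> e"
  proof (cases "K = {}")
    case False
    have "continuous_on K (\<lambda>z. dist (g z) (f z))"
      using hol_maps_continuous_on f g K by (auto intro!: continuous_intros intro: continuous_on_subset)
    then obtain w where "w \<in> K" "\<forall>z\<in>K. dist (g z) (f z) \<le> dist (g w) (f w)"
      using continuous_attains_sup[of K] K False by blast
    then show ?thesis
      using g by (intro exI[of _ "e - dist (g w) (f w)"]) auto
  qed (auto intro: exI[of _ "1::real"])
  then obtain d where d: "d > 0" "\<forall>z\<in>K. dist (g z) (f z) + d \<le> e" by blast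
  have "dist (h z) (f z) < e" if "\<forall>z\<in>K. dist (h z) (g z) < d" "z \<in> K" for h z
    using that d dist_triangle[of "h z" "f z" "g z"] by fastforce
  with K d(1) show "\<exists>K' d. compact K' \<and> K' \<subseteq> unit_ball \<and> d > 0 \<and>
      (\<forall>h\<in>hol_maps. (\<forall>z\<in>K'. dist (h z) (g z) < d) \<longrightarrow> h \<in> {g \<in> hol_maps. \<forall>z\<in>K. dist (g z) (f z) < e})"
    by (intro exI[of _ K] exI[of _ d]) simp
qed auto

lemma closure_of_hol_topology_iff:
  fixes f :: "'n::finite selfmap"
  shows "f \<in> hol_topology closure_of S \<longleftrightarrow> f \<in> hol_maps \<and>
    (\<forall>K e. compact K \<and> K \<subseteq> unit_ball \<and> e > 0 \<longrightarrow> (\<exists>g\<in>S \<inter> hol_maps. \<forall>z\<in>K. dist (g z) (f z) < e))"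
  unfolding in_closure_of topspace_hol_topology
proof (intro iffI conjI allI impI; (elim conjE)?)
  fix K :: "(complex ^ 'n) set" and e :: real assume f: "f \<in> hol_maps" "\<forall>T. f \<in> T \<and> openin hol_topology T \<longrightarrow> (\<exists>y. y \<in> S \<and> y \<in> T)"
    and K: "compact K" "K \<subseteq> unit_ball" "0 < e"
  define U where "U = {g \<in> hol_maps. \<forall>z\<in>K. dist (g z) (f z) < e}"
  have "openin hol_topology U"
    unfolding U_def by (rule openin_uniform_ball[OF f(1) K(1,2)])
  moreover have "f \<in> U" using f(1) K by (simp add: U_def)
  ultimately have "\<exists>y. y \<in> S \<and> y \<in> U" using f(2)[THEN spec, of U] by simp
  then show "\<exists>g\<in>S \<inter> hol_maps. \<forall>z\<in>K. dist (g z) (f z) < e"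
    unfolding U_def by auto
next
  fix T assume f: "\<forall>K e. compact K \<and> K \<subseteq> unit_ball \<and> e > 0 \<longrightarrow>
      (\<exists>g\<in>S \<inter> hol_maps. \<forall>z\<in>K. dist (g z) (f z) < e)" and T: "f \<in> T" "openin hol_topology T"
  from T obtain K and e :: real where K: "compact K" "K \<subseteq> unit_ball" "e > 0"
    "\<forall>g\<in>hol_maps. (\<forall>z\<in>K. dist (g z) (f z) < e) \<longrightarrow> g \<in> T"
    unfolding openin_hol_topology by blast
  obtain g where "g \<in> S \<inter> hol_maps" "\<forall>z\<in>K. dist (g z) (f z) < e"
    using f[THEN spec[of _ K], THEN spec[of _ e]] K by auto
  then show "\<exists>y. y \<in> S \<and> y \<in> T" using K(4) by auto
qed

lemma closure_of_hol_topologyD: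
  fixes f :: "'n::finite selfmap"
  assumes "f \<in> hol_topology closure_of S" "compact K" "K \<subseteq> unit_ball" "e > 0"
  shows "\<exists>g\<in>S \<inter> hol_maps. \<forall>z\<in>K. dist (g z) (f z) < e"
  using conjunct2[OF assms(1)[unfolded closure_of_hol_topology_iff], THEN spec[of _ K], THEN spec[of _ e]]
    assms(2-4) by simp

text \<open>\<open>Schwarz_Lemma\<close> wants a strict bound 1, while \<open>B\<close> is a weak
  bound and may be 0; so divide by \<open>B + e\<close> and let \<open>e\<close> tend to 0.\<close>

lemma Schwarz_lemma_bounded:
  assumes "\<phi> holomorphic_on ball 0 1" "\<phi> 0 = 0" "\<And>\<zeta>. norm \<zeta> < 1 \<Longrightarrow> norm (\<phi> \<zeta>) \<le> B" "norm \<zeta> < 1"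
  shows "norm (\<phi> \<zeta>) \<le> B * norm \<zeta>"
proof -
  have B: "0 \<le> B" using assms(3)[of 0] by (simp add: assms(2))
  have "norm (\<phi> \<zeta>) \<le> B * norm \<zeta> + e" if e: "e > 0" for e
  proof -
    define C where "C = B + e"
    have C: "C > 0" using B e by (simp add: C_def)
    have "norm (\<phi> \<zeta> / of_real C) \<le> norm \<zeta>"
    proof (rule Schwarz_Lemma(1)[of "\<lambda>\<zeta>. \<phi> \<zeta> / of_real C"])
      show "(\<lambda>\<zeta>. \<phi> \<zeta> / of_real C) holomorphic_on ball 0 1"
        using C by (intro holomorphic_intros assms) simp
      show "norm (\<phi> z / of_real C) < 1" if "norm z < 1" for z
      proof -
        have "norm (\<phi> z) < C" using assms(3)[OF that] e by (simp add: C_def)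
        then show ?thesis using C by (simp add: norm_divide)
      qed
    qed (use assms in auto)
    then have "norm (\<phi> \<zeta>) \<le> C * norm \<zeta>" using C by (simp add: norm_divide field_simps)
    also have "\<dots> = B * norm \<zeta> + e * norm \<zeta>" by (simp add: C_def algebra_simps)
    also have "e * norm \<zeta> \<le> e" using e assms(4) by simp
    finally show ?thesis by simp
  qed
  then show ?thesis by (rule field_le_epsilon)
qed

text \<open>To stay scalar without losing a dimensional factor, the slice of \<open>Df v - v\<close>
  is paired with its own value \<open>w\<close> at \<open>z\<close>. At \<open>z\<close> the pairing
  equals \<open>(norm w)\<^sup>2\<close>, and one factor \<open>norm w\<close> cancels.\<close>

lemma fderiv_Schwarz:
  fixes f :: "'n::finite selfmap"
  assumes f: "holomorphic_map_on f unit_ball" and f0: "fderiv f 0 = id"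
    and le: "\<And>z v. z \<in> unit_ball \<Longrightarrow> norm (fderiv f z v - v) \<le> norm v" and z: "z \<in> unit_ball"
  shows "norm (fderiv f z v - v) \<le> norm z * norm v"
proof (cases "z = 0 \<or> fderiv f z v = v")
  case True
  then show ?thesis using f0 by auto
next
  case False
  define w where "w = fderiv f z v - v"
  define e where "e = inverse (of_real (norm z)) *s z"
  have z0: "norm z > 0" and w0: "norm w > 0" using False by (auto simp: w_def)
  have e: "norm e = 1" using z0 by (simp add: e_def norm_inverse)
  have ze: "of_real (norm z) *s e = z" using z0 by (simp add: e_def)
  define \<phi> where "\<phi> \<zeta> = hermitian (fderiv f (\<zeta> *s e) v - v) w" for \<zeta>
  have mem: "\<zeta> *s e \<in> unit_ball" if "norm \<zeta> < 1" for \<zeta> using that e by simp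
  have "norm (\<phi> (of_real (norm z))) \<le> norm v * norm w * norm (of_real (norm z) :: complex)"
  proof (rule Schwarz_lemma_bounded)
    have "(\<lambda>\<zeta>. fderiv f (0 + \<zeta> *s e) v $ i) holomorphic_on ball 0 1" for i
      by (rule slice_holomorphic_on[OF holomorphic_map_fderiv[OF open_ball f]]) (use mem in auto)
    then show "\<phi> holomorphic_on ball 0 1"
      unfolding \<phi>_def[abs_def] hermitian_def by (auto intro!: holomorphic_intros)
    show "\<phi> 0 = 0" by (simp add: \<phi>_def f0 hermitian_def)
    show "norm (\<phi> \<zeta>) \<le> norm v * norm w" if "norm \<zeta> < 1" for \<zeta>
      unfolding \<phi>_def by (rule order_trans[OF norm_hermitian_le mult_right_mono[OF le[OF mem[OF that]]]]) simp
  qed (use z in simp)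
  also have "\<phi> (of_real (norm z)) = of_real ((norm w)\<^sup>2)"
    by (simp only: \<phi>_def ze w_def[symmetric] hermitian_self)
  finally have "norm w * norm w \<le> (norm z * norm v) * norm w"
    by (simp add: power2_eq_square norm_mult mult_ac)
  then have "norm w \<le> norm z * norm v" using w0 by (simp only: mult_le_cancel_right_pos)
  then show ?thesis by (simp only: w_def)
qed

text \<open>The bound may vary with the point: closedness supplies \<open>norm z\<close>, density a
  constant.\<close>

lemma Q_ballI:
  assumes "f \<in> hol_maps" "f 0 = 0" "fderiv f 0 = id" "\<And>z. z \<in> unit_ball \<Longrightarrow> c z < 1"
    and "\<And>z v. z \<in> unit_ball \<Longrightarrow> norm (fderiv f z v - v) \<le> c z * norm v"
  shows "f \<in> Q_ball"
proof -
  have "onorm (\<lambda>v. fderiv f z v - v) < 1" if "z \<in> unit_ball" for z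
    using onorm_le[of "\<lambda>v. fderiv f z v - v" "c z"] assms(4,5)[OF that] by (auto intro: le_less_trans)
  then show ?thesis using assms by (simp add: Q_ball_def)
qed

context
  fixes f :: "'n::finite selfmap"
  assumes f: "f \<in> Q_ball"
begin

lemma Q_ball_hol: "f \<in> hol_maps" "holomorphic_map_on f unit_ball"
  and Q_ball_zero: "f 0 = 0" "fderiv f 0 = id"
  using f by (auto simp: Q_ball_def hol_maps_def)

lemma Q_ball_fderiv_le_one:
  assumes z: "z \<in> unit_ball"
  shows "norm (fderiv f z v - v) \<le> norm v"
proof -
  have "bounded_linear (\<lambda>v. fderiv f z v - v)"
    using holomorphic_map_has_derivative[OF Q_ball_hol(2) z]
    by (intro bounded_linear_sub bounded_linear_ident has_derivative_bounded_linear)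
  from onorm[OF this, of v]
  have "norm (fderiv f z v - v) \<le> onorm (\<lambda>v. fderiv f z v - v) * norm v" .
  also have "\<dots> \<le> 1 * norm v"
    using f z by (intro mult_right_mono) (auto simp: Q_ball_def less_imp_le)
  finally show ?thesis by simp
qed

lemma Q_ball_fderiv_bound: "z \<in> unit_ball \<Longrightarrow> norm (fderiv f z v - v) \<le> norm z * norm v"
  using fderiv_Schwarz[OF Q_ball_hol(2) Q_ball_zero(2) Q_ball_fderiv_le_one] by blast

lemma Q_ball_taylor_sums:
  assumes z: "z \<in> unit_ball"
  shows "(\<lambda>k. hpart f (k + 2) z) sums (f z - z)"
proof -
  define r where "r = (1 + norm z) / 2"
  have r: "r > 0" "norm z < r" "r < 1" using z by (auto simp: r_def add_pos_nonneg)
  then have sub: "cball 0 r \<subseteq> unit_ball" by auto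
  obtain M where M: "\<And>x. norm x \<le> r \<Longrightarrow> norm (f x) \<le> M"
    using holomorphic_map_bounded_cball[OF Q_ball_hol(2) sub] by auto
  have "(\<lambda>k. hpart f k z) sums f z"
    by (rule homogeneous_expansion_sums[OF open_ball Q_ball_hol(2) r(1) sub M r(2)])
  from sums_split_initial_segment[OF this, of 2]
  have "(\<lambda>k. hpart f (k + 2) z) sums
      (f z - (\<Sum>j<2. hpart f j z))" .
  \<comment> \<open>The two split-off terms are \<open>f 0 = 0\<close> and
    \<open>Df(0) z = z\<close>.\<close>
  moreover have "higher_deriv f [] = f" by (simp add: fun_eq_iff)
  then have "taylor_coeff f [z] = z" by (simp add: taylor_coeff_def Q_ball_zero)
  then have "(\<Sum>j<2. hpart f j z) = z"
    by (simp add: numeral_2_eq_2 Q_ball_zero)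
  ultimately show ?thesis by simp
qed

end

section \<open>Norms of Taylor coefficients under perturbation\<close>

abbreviation taylor_norm :: "'n::finite selfmap \<Rightarrow> nat \<Rightarrow> real"
  where "taylor_norm f k \<equiv> multilinear_norm k (taylor_coeff f)"

lemma multilinear_norm_le:
  assumes "\<And>vs. length vs = k \<Longrightarrow> \<forall>v\<in>set vs. norm v \<le> 1 \<Longrightarrow> norm (A vs) \<le> B"
  shows "multilinear_norm k A \<le> B"
  unfolding multilinear_norm_def
proof (rule cSUP_least)
  have "replicate k 0 \<in> {vs :: (complex ^ 'a) list. length vs = k \<and> (\<forall>v\<in>set vs. norm v \<le> 1)}" by simp
  then show "{vs :: (complex ^ 'a) list. length vs = k \<and> (\<forall>v\<in>set vs. norm v \<le> 1)} \<noteq> {}" by blast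
qed (use assms in auto)

text \<open>A real supremum is an upper bound only for a bounded set; boundedness comes from
  \<open>taylor_coeff_bound\<close>.\<close>

lemma norm_le_multilinear_norm:
  fixes f :: "'a::finite selfmap"
  assumes "open S" "holomorphic_map_on f S" "0 \<in> S" "\<forall>v\<in>set vs. norm v \<le> 1"
  shows "norm (taylor_coeff f vs) \<le> taylor_norm f (length vs)"
proof -
  obtain r where r: "r > 0" "cball 0 r \<subseteq> S" using cball_subset_open assms by blast
  obtain M where M: "\<And>x. norm x \<le> r \<Longrightarrow> norm (f x) \<le> M"
    using holomorphic_map_bounded_cball[OF assms(2) r(2)] by auto
  show ?thesis
    unfolding multilinear_norm_def
  proof (rule cSUP_upper)
    show "bdd_above ((\<lambda>vs. norm (taylor_coeff f vs)) ` {us. length us = length vs \<and> (\<forall>v\<in>set us. norm v \<le> 1)})"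
    proof (rule bdd_aboveI2)
      fix us :: "(complex ^ 'a) list"
      assume "us \<in> {us. length us = length vs \<and> (\<forall>v\<in>set us. norm v \<le> 1)}"
      then show "norm (taylor_coeff f us)
          \<le> real CARD('a) * M * deriv_loss CARD('a) (length vs) / r ^ length vs"
        using taylor_coeff_bound[OF assms(1,2) r M, of us] by simp
    qed
  qed (use assms in simp)
qed

lemma multilinear_norm_nonneg:
  assumes "open S" "holomorphic_map_on f S" "0 \<in> S"
  shows "0 \<le> taylor_norm f k"
  using norm_le_multilinear_norm[OF assms, of "replicate k 0"] order_trans[OF norm_ge_zero] by auto

text \<open>Used with \<open>r = 1 / 2\<close> for closedness, where finitely many degrees matter at
  a time, and with \<open>r > 1\<close> for density, where the error has to be summed over all
  degrees.\<close>

lemma multilinear_norm_perturbation: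
  fixes f g :: "'n::finite selfmap"
  assumes S: "open S" and f: "holomorphic_map_on f S" and g: "holomorphic_map_on g S"
    and r: "r > 0" "cball 0 r \<subseteq> S" and \<epsilon>: "\<And>z. norm z \<le> r \<Longrightarrow> norm (f z - g z) \<le> \<epsilon>"
  shows "taylor_norm f k
    \<le> taylor_norm g k + real CARD('n) * \<epsilon> * deriv_loss CARD('n) k / r ^ k"
proof (rule multilinear_norm_le)
  fix vs :: "(complex ^ 'n) list" assume vs: "length vs = k" "\<forall>v\<in>set vs. norm v \<le> 1"
  have S0: "0 \<in> S" using r by auto
  have d: "holomorphic_map_on (\<lambda>z. f z - g z) S" by (intro holomorphic_map_diff f g)
  have "f = (\<lambda>z. g z + (f z - g z))" by simp
  then have "higher_deriv f vs 0 = higher_deriv (\<lambda>z. g z + (f z - g z)) vs 0" by simp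
  also have "\<dots> = higher_deriv g vs 0 + higher_deriv (\<lambda>z. f z - g z) vs 0"
    by (rule higher_deriv_add[OF S g d S0])
  finally have "taylor_coeff f vs = taylor_coeff g vs + taylor_coeff (\<lambda>z. f z - g z) vs"
    by (simp add: taylor_coeff_def scaleR_add_right)
  then show "norm (taylor_coeff f vs)
      \<le> taylor_norm g k + real CARD('n) * \<epsilon> * deriv_loss CARD('n) k / r ^ k"
    using norm_triangle_mono[OF norm_le_multilinear_norm[OF S g S0 vs(2)] taylor_coeff_bound[OF S d r \<epsilon> vs(2)]]
    by (simp add: vs)
qed

lemma closure_fderiv:
  fixes f :: "'n::finite selfmap"
  assumes f: "f \<in> hol_topology closure_of S" and z: "z \<in> unit_ball" and \<eta>: "\<eta> > 0"
  obtains g where "g \<in> S" "g \<in> hol_maps" "\<And>v. norm (fderiv g z v - fderiv f z v) \<le> \<eta> * norm v"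
    "norm (g z - f z) \<le> \<eta>"
proof -
  obtain r where r: "r > 0" "cball z r \<subseteq> unit_ball" using cball_subset_open z open_ball by blast
  define e where "e = min \<eta> (\<eta> * r / real CARD('n))"
  have e: "e > 0" using \<eta> r by (simp add: e_def)
  obtain g where g: "g \<in> S" "g \<in> hol_maps" "\<And>x. x \<in> cball z r \<Longrightarrow> dist (g x) (f x) < e"
    using closure_of_hol_topologyD[OF f compact_cball r(2) e] by auto
  have hf: "holomorphic_map_on f unit_ball"
    using f by (simp add: closure_of_hol_topology_iff hol_maps_def)
  have hg: "holomorphic_map_on g unit_ball" using g by (simp add: hol_maps_def)
  have "norm (fderiv (\<lambda>z. g z - f z) z v) \<le> real CARD('n) * e / r * norm v" for v
    by (rule holomorphic_map_fderiv_bound[OF holomorphic_map_diff[OF hg hf] r(2,1)])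
      (use g(3) in \<open>auto simp: dist_norm less_imp_le\<close>)
  then have "norm (fderiv g z v - fderiv f z v) \<le> real CARD('n) * e / r * norm v" for v
    by (simp add: fderiv_diff_fun[OF hg hf z])
  moreover have "real CARD('n) * e / r \<le> \<eta>"
  proof -
    have "e \<le> \<eta> * r / real CARD('n)" by (simp add: e_def)
    then show ?thesis using r by (simp add: field_simps)
  qed
  ultimately have "norm (fderiv g z v - fderiv f z v) \<le> \<eta> * norm v" for v
    by (meson mult_right_mono norm_ge_zero order_trans)
  moreover have "norm (g z - f z) \<le> \<eta>"
    using g(3)[of z] r by (simp add: dist_norm e_def)
  ultimately show ?thesis using that g by blast
qed

section \<open>Both classes are closed\<close>

lemma Q_ball_closed:
  fixes f :: "'n::finite selfmap"
  assumes "f \<in> hol_topology closure_of S" "S \<subseteq> Q_ball"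
  shows "f \<in> Q_ball"
proof -
  have fh: "f \<in> hol_maps" "holomorphic_map_on f unit_ball"
    using assms(1) by (simp_all add: closure_of_hol_topology_iff hol_maps_def)
  have approx: "\<exists>g\<in>S. norm (fderiv g z v - fderiv f z v) \<le> \<eta> \<and> norm (g z - f z) \<le> \<eta>"
    if "z \<in> unit_ball" "\<eta> > 0" for z v and \<eta> :: real
  proof -
    define \<theta> where "\<theta> = \<eta> / (norm v + 1)"
    have \<theta>: "\<theta> > 0" "\<theta> * norm v \<le> \<eta>" "\<theta> \<le> \<eta>"
      using that by (simp_all add: \<theta>_def divide_simps add_nonneg_pos)
    show ?thesis
      by (rule closure_fderiv[OF assms(1) that(1) \<theta>(1)]) (use \<theta> in \<open>blast intro: order_trans\<close>)
  qed
  have "norm (f 0) \<le> 0"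
  proof (rule field_le_epsilon)
    fix \<eta> :: real assume "\<eta> > 0"
    then obtain g where "g \<in> S" "norm (g 0 - f 0) \<le> \<eta>" using approx[of 0 \<eta>] by auto
    then show "norm (f 0) \<le> 0 + \<eta>" using assms(2) Q_ball_zero(1)[of g] by auto
  qed
  then have f0: "f 0 = 0" by simp
  have "norm (fderiv f 0 v - v) \<le> 0" for v
  proof (rule field_le_epsilon)
    fix \<eta> :: real assume "\<eta> > 0"
    then obtain g where "g \<in> S" "norm (fderiv g 0 v - fderiv f 0 v) \<le> \<eta>"
      using approx[of 0 \<eta> v] by auto
    then show "norm (fderiv f 0 v - v) \<le> 0 + \<eta>"
      using assms(2) Q_ball_zero(2)[of g] by (auto simp: norm_minus_commute)
  qed
  then have D0: "fderiv f 0 = id" by (simp add: fun_eq_iff)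
  have "norm (fderiv f z v - v) \<le> norm v" if z: "z \<in> unit_ball" for z v
  proof (rule field_le_epsilon)
    fix \<eta> :: real assume "\<eta> > 0"
    then obtain g where g: "g \<in> S" "norm (fderiv g z v - fderiv f z v) \<le> \<eta>"
      using approx[OF z, of \<eta> v] by auto
    have "norm (fderiv g z v - v) \<le> norm v"
      using Q_ball_fderiv_le_one[of g z v] g assms(2) z by auto
    then show "norm (fderiv f z v - v) \<le> norm v + \<eta>"
      using g(2) norm_triangle_ineq[of "fderiv f z v - fderiv g z v" "fderiv g z v - v"]
      by (simp add: norm_minus_commute)
  qed
  from fderiv_Schwarz[OF fh(2) D0 this] show ?thesis
    by (intro Q_ballI[OF fh(1) f0 D0, of norm]) auto
qed

lemma Q_tilde_ballI:
  fixes f :: "'n::finite selfmap"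
  assumes f: "f \<in> Q_ball"
    and le: "\<And>N. (\<Sum>k<N. real (k + 2) * taylor_norm f (k + 2)) \<le> 1"
  shows "f \<in> Q_tilde_ball"
proof -
  have nn: "0 \<le> real (k + 2) * taylor_norm f (k + 2)" for k
    using multilinear_norm_nonneg[OF open_ball Q_ball_hol(2)[OF f]] by simp
  have "summable (\<lambda>k. real (k + 2) * taylor_norm f (k + 2))"
    by (rule summableI_nonneg_bounded[OF nn le])
  moreover from this have "(\<Sum>k. real (k + 2) * taylor_norm f (k + 2)) \<le> 1"
    by (rule suminf_le_const) (rule le)
  ultimately show ?thesis
    using f Q_ball_taylor_sums[OF f] by (simp add: Q_tilde_ball_def)
qed

lemma Q_tilde_ball_partial_sum:
  fixes f :: "'n::finite selfmap"
  assumes "f \<in> Q_tilde_ball"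
  shows "(\<Sum>k<N. real (k + 2) * taylor_norm f (k + 2)) \<le> 1"
proof -
  have f: "f \<in> Q_ball" using assms by (simp add: Q_tilde_ball_def)
  have nn: "0 \<le> real (k + 2) * taylor_norm f (k + 2)" for k
    using multilinear_norm_nonneg[OF open_ball Q_ball_hol(2)[OF f]] by simp
  have "(\<Sum>k<N. real (k + 2) * taylor_norm f (k + 2))
      \<le> (\<Sum>k. real (k + 2) * taylor_norm f (k + 2))"
    by (rule sum_le_suminf) (use assms nn in \<open>auto simp: Q_tilde_ball_def\<close>)
  then show ?thesis using assms unfolding Q_tilde_ball_def by simp
qed

text \<open>For fixed \<open>N\<close> only finitely many coefficients occur, and they depend
  continuously on the map. Bounding every partial sum by 1 yields summability and the bound on the
  series at once.\<close>

lemma Q_tilde_ball_closed: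
  fixes f :: "'n::finite selfmap"
  assumes cl: "f \<in> hol_topology closure_of S" and S: "S \<subseteq> Q_tilde_ball"
  shows "f \<in> Q_tilde_ball"
proof (rule Q_tilde_ballI)
  have "S \<subseteq> Q_ball" using S by (auto simp: Q_tilde_ball_def)
  then show f: "f \<in> Q_ball" by (rule Q_ball_closed[OF cl])
  fix N
  define C where "C = (\<Sum>k<N. real (k + 2) * (real CARD('n) * deriv_loss CARD('n) (k + 2) / (1 / 2) ^ (k + 2)))"
  have "C \<ge> 0"
    unfolding C_def using deriv_loss_pos[of "CARD('n)"] by (intro sum_nonneg) (simp add: less_imp_le)
  show "(\<Sum>k<N. real (k + 2) * taylor_norm f (k + 2)) \<le> 1"
  proof (rule field_le_epsilon)
    fix e :: real assume e: "e > 0"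
    define \<epsilon> where "\<epsilon> = e / (C + 1)"
    have \<epsilon>: "\<epsilon> > 0" using e \<open>C \<ge> 0\<close> by (simp add: \<epsilon>_def)
    have sub: "cball 0 (1 / 2) \<subseteq> (unit_ball :: (complex ^ 'n) set)" by auto
    obtain g where g: "g \<in> S" "\<And>z. z \<in> cball 0 (1 / 2) \<Longrightarrow> dist (g z) (f z) < \<epsilon>"
      using closure_of_hol_topologyD[OF cl compact_cball sub \<epsilon>] by auto
    have gQ: "g \<in> Q_tilde_ball" "g \<in> Q_ball" using g S by (auto simp: Q_tilde_ball_def)
    have pert: "taylor_norm f k \<le> taylor_norm g k
        + real CARD('n) * \<epsilon> * deriv_loss CARD('n) k / (1 / 2) ^ k" for k
      by (rule multilinear_norm_perturbation[OF open_ball Q_ball_hol(2)[OF f] Q_ball_hol(2)[OF gQ(2)]])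
        (use g(2) in \<open>auto simp: dist_norm norm_minus_commute less_imp_le\<close>)
    have "(\<Sum>k<N. real (k + 2) * taylor_norm f (k + 2))
        \<le> (\<Sum>k<N. real (k + 2) * (taylor_norm g (k + 2)
          + real CARD('n) * \<epsilon> * deriv_loss CARD('n) (k + 2) / (1 / 2) ^ (k + 2)))"
      by (intro sum_mono mult_left_mono pert) simp
    also have "\<dots> = (\<Sum>k<N. real (k + 2) * taylor_norm g (k + 2)) + \<epsilon> * C"
      unfolding C_def sum_distrib_left sum.distrib[symmetric] by (intro sum.cong refl) (simp add: distrib_left)
    also have "\<dots> \<le> 1 + \<epsilon> * C" using Q_tilde_ball_partial_sum[OF gQ(1)] by simp
    also have "\<epsilon> * C \<le> e" using e \<open>C \<ge> 0\<close> by (simp add: \<epsilon>_def field_simps)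
    finally show "(\<Sum>k<N. real (k + 2) * taylor_norm f (k + 2)) \<le> 1 + e" by simp
  qed
qed

section \<open>Density: normalization at the origin, dilation and choice of the approximant\<close>

lemma normalized_automorphism_approximation:
  fixes F :: "'n::finite selfmap"
  assumes F: "holomorphic_map_on F S" and S: "cball 0 r \<subseteq> S" and r: "r > 0"
    and F0: "F 0 = 0" "fderiv F 0 = id"
    and approx: "\<And>\<delta>. \<delta> > 0 \<Longrightarrow> \<exists>\<Phi>\<in>Aut_space. \<forall>z. norm z \<le> r \<longrightarrow> norm (\<Phi> z - F z) \<le> \<delta>"
    and \<eta>: "\<eta> > 0"
  obtains \<Phi> where "\<Phi> \<in> Aut_space" "\<Phi> 0 = 0" "fderiv \<Phi> 0 = id" "\<And>z. norm z \<le> r \<Longrightarrow> norm (\<Phi> z - F z) \<le> \<eta>"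
proof -
  let ?n = "real CARD('n)"
  obtain M where M: "M \<ge> 0" "\<And>x. norm x \<le> r \<Longrightarrow> norm (F x) \<le> M"
    using holomorphic_map_bounded_cball[OF F S] by auto
  define K where "K = 4 + 2 * ?n * M / r"
  have K: "K > 0" using M r by (simp add: K_def add_pos_nonneg)
  \<comment> \<open>The first entry puts \<open>D\<Psi>(0)\<close> within 1/2 of the identity, so
    that it is invertible with inverse of norm at most 2; the second makes the total error
    \<open>K * \<delta>\<close> at most \<open>\<eta>\<close>.\<close>
  define \<delta> where "\<delta> = min (r / (2 * ?n)) (\<eta> / K)"
  have \<delta>: "\<delta> > 0" using r \<eta> K by (simp add: \<delta>_def)
  obtain \<Psi> where \<Psi>: "\<Psi> \<in> Aut_space" "\<And>z. norm z \<le> r \<Longrightarrow> norm (\<Psi> z - F z) \<le> \<delta>"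
    using approx[OF \<delta>] by blast
  have \<Psi>h: "holomorphic_map_on \<Psi> UNIV" using \<Psi> by (simp add: Aut_space_def)
  define L where "L = fderiv \<Psi> 0"
  define \<theta> where "\<theta> = ?n * \<delta> / r"
  have "\<delta> \<le> r / (2 * ?n)" by (simp add: \<delta>_def)
  then have \<theta>: "\<theta> \<le> 1 / 2" "0 \<le> \<theta>" using r \<delta> by (simp_all add: \<theta>_def field_simps)
  have L: "norm (L v - v) \<le> \<theta> * norm v" for v
  proof -
    have \<Psi>S: "holomorphic_map_on \<Psi> S" using \<Psi>h by (rule holomorphic_map_subset) simp
    have "0 \<in> S" using S r by auto
    moreover have "norm (fderiv (\<lambda>z. \<Psi> z - F z) 0 v) \<le> ?n * \<delta> / r * norm v"
      by (rule holomorphic_map_fderiv_bound[OF holomorphic_map_diff[OF \<Psi>S F] S r]) (use \<Psi> in auto)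
    ultimately show ?thesis
      by (simp add: fderiv_diff_fun[OF \<Psi>S F] L_def \<theta>_def F0)
  qed
  have Llin: "Vector_Spaces.linear (*s) (*s) L"
    unfolding L_def by (rule fderiv_linear[OF \<Psi>h UNIV_I])
  have Lge: "norm v \<le> 2 * norm (L v)" for v
  proof -
    have "\<theta> * norm v \<le> 1 / 2 * norm v" using \<theta> by (intro mult_right_mono) auto
    then show ?thesis
      using L[of v] norm_triangle_ineq2[of v "L v"] by (simp add: norm_minus_commute)
  qed
  have inj: "inj L"
    unfolding vec.linear_inj_iff_eq_0[OF Llin] using Lge by (metis norm_eq_zero norm_le_zero_iff mult_zero_right)
  have surj: "surj L" by (rule vec.linear_inj_imp_surj[OF Llin inj])
  have Ilin: "Vector_Spaces.linear (*s) (*s) (inv L)"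
    by (rule vec.inj_linear_imp_inv_linear[OF Llin inj])
  have Ile: "norm (inv L w) \<le> 2 * norm w" for w
    using Lge[of "inv L w"] by (simp add: surj_f_inv_f[OF surj])
  have IA: "inv L \<in> Aut_space"
    by (rule Aut_spaceI[OF holomorphic_map_linear(2)[OF Ilin] holomorphic_map_linear(2)[OF Llin]])
      (simp_all add: surj_f_inv_f[OF surj] inv_f_f[OF inj])
  \<comment> \<open>An affine automorphism corrects value and derivative at 0. It is close to the
    identity, since by Cauchy's estimate the 1-jet of \<open>\<Psi>\<close> at 0 is close to that of
    \<open>F\<close>.\<close>
  define \<Phi> where "\<Phi> z = inv L (\<Psi> z + - \<Psi> 0)" for z
  have "\<Phi> \<in> Aut_space"
    unfolding \<Phi>_def[abs_def] by (rule Aut_space_compose[OF IA Aut_space_compose[OF Aut_space_translation \<Psi>(1)]])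
  moreover have "\<Phi> 0 = 0" using vec.linear_0[OF Ilin] by (simp add: \<Phi>_def)
  moreover have "fderiv \<Phi> 0 = id"
  proof -
    have "((\<lambda>z. \<Psi> z + - \<Psi> 0) has_derivative (\<lambda>v. L v + 0)) (at 0)"
      unfolding L_def by (intro has_derivative_add has_derivative_const holomorphic_map_has_derivative[OF \<Psi>h]) simp
    from has_derivative_compose[OF this holomorphic_map_linear(1)[OF Ilin]]
    have "(\<Phi> has_derivative (\<lambda>v. inv L (L v + 0))) (at 0)" by (simp add: \<Phi>_def[abs_def])
    from fderiv_eqI[OF this] show ?thesis by (simp add: fun_eq_iff inv_f_f[OF inj])
  qed
  moreover have "norm (\<Phi> z - F z) \<le> \<eta>" if z: "norm z \<le> r" for z
  proof -
    have "\<Phi> z - F z = inv L ((\<Psi> z + - \<Psi> 0) - L (F z))"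
      by (simp only: \<Phi>_def vec.linear_diff[OF Ilin] inv_f_f[OF inj])
    then have "norm (\<Phi> z - F z) \<le> 2 * norm ((\<Psi> z + - \<Psi> 0) - L (F z))" using Ile by simp
    also have "(\<Psi> z + - \<Psi> 0) - L (F z) = (\<Psi> z - F z) + (- (\<Psi> 0 - F 0) + - (L (F z) - F z))"
      by (simp add: F0)
    also have "norm \<dots> \<le> \<delta> + (\<delta> + \<theta> * M)"
    proof (intro norm_triangle_mono)
      show "norm (\<Psi> z - F z) \<le> \<delta>" by (rule \<Psi>(2)[OF z])
      show "norm (- (\<Psi> 0 - F 0)) \<le> \<delta>" using \<Psi>(2)[of 0] r by (simp only: norm_minus_cancel) simp
      have "norm (L (F z) - F z) \<le> \<theta> * norm (F z)" by (rule L)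
      also have "\<dots> \<le> \<theta> * M" using \<theta> by (intro mult_left_mono M(2)[OF z])
      finally show "norm (- (L (F z) - F z)) \<le> \<theta> * M" by (simp only: norm_minus_cancel)
    qed
    also have "2 * (\<delta> + (\<delta> + \<theta> * M)) = K * \<delta>" by (simp add: K_def \<theta>_def algebra_simps)
    also have "\<dots> \<le> K * (\<eta> / K)" using K by (intro mult_left_mono) (auto simp: \<delta>_def)
    also have "\<dots> = \<eta>" using K by simp
    finally show ?thesis by simp
  qed
  ultimately show ?thesis by (rule that)
qed

text \<open>The estimate holds up to the boundary because \<open>f\<close> is 2-Lipschitz on the
  ball. Shifting the argument costs \<open>2 * (1 - \<rho>)\<close>, and so does the outer factor,
  as \<open>norm (f z) \<le> 2\<close>.\<close>

lemma Q_ball_dilation_estimate: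
  fixes f :: "'n::finite selfmap"
  assumes f: "f \<in> Q_ball" and \<rho>: "0 < \<rho>" "\<rho> < 1" and z: "z \<in> unit_ball"
  shows "norm (inverse (of_real \<rho>) *s f (of_real \<rho> *s z) - f z) \<le> 4 * (1 - \<rho>) / \<rho>"
proof -
  have D: "norm (fderiv f w v) \<le> 2 * norm v" if "w \<in> unit_ball" for w v
    using Q_ball_fderiv_le_one[OF f that, of v] norm_triangle_ineq2[of "fderiv f w v" v] by linarith
  have lip: "norm (f x - f y) \<le> 2 * norm (x - y)" if "x \<in> unit_ball" "y \<in> unit_ball" for x y
    by (rule derivative_bound_imp_lipschitz[OF Q_ball_hol(2)[OF f] D]) (use that in auto)
  have \<rho>z: "of_real \<rho> *s z \<in> unit_ball"
    using z \<rho> mult_less_le_imp_less[of \<rho> 1 "norm z" 1] by (cases "z = 0") (auto simp: mult_less_cancel_right_disj less_imp_le)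
  have "norm (f z - f 0) \<le> 2 * norm (z - 0)" by (rule lip[OF z]) simp
  then have fz: "norm (f z) \<le> 2" using z by (simp add: Q_ball_zero[OF f])
  have "of_real \<rho> *s z - z = of_real (\<rho> - 1) *s z" by (simp add: vec_eq_iff algebra_simps)
  then have "norm (of_real \<rho> *s z - z) = (1 - \<rho>) * norm z" using \<rho> by (simp del: of_real_diff)
  also have "\<dots> \<le> (1 - \<rho>) * 1" using z \<rho> by (intro mult_left_mono) auto
  finally have 1: "norm (f (of_real \<rho> *s z) - f z) \<le> 2 * (1 - \<rho>)"
    using lip[OF \<rho>z z] by simp
  have "inverse (of_real \<rho>) *s f (of_real \<rho> *s z) - f z
      = of_real (inverse \<rho>) *s ((f (of_real \<rho> *s z) - f z) + of_real (1 - \<rho>) *s f z)"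
    using \<rho> by (simp add: vec_eq_iff field_simps)
  then have "norm (inverse (of_real \<rho>) *s f (of_real \<rho> *s z) - f z)
      = inverse \<rho> * norm ((f (of_real \<rho> *s z) - f z) + of_real (1 - \<rho>) *s f z)"
    using \<rho> by (simp only: norm_vector_scalar_mult norm_of_real) simp
  also have "\<dots> \<le> inverse \<rho> * (2 * (1 - \<rho>) + (1 - \<rho>) * 2)"
  proof (intro mult_left_mono norm_triangle_mono 1)
    show "norm (of_real (1 - \<rho>) *s f z) \<le> (1 - \<rho>) * 2"
      unfolding norm_vector_scalar_mult norm_of_real using \<rho> fz by (intro mult_mono) auto
  qed (use \<rho> in auto)
  finally show ?thesis by (simp add: divide_inverse mult_ac)
qed

lemma Q_ball_automorphism_dense:
  fixes f :: "'n::finite selfmap"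
  assumes n: "CARD('n) \<ge> 2" and f: "f \<in> Q_ball" and e: "e > 0"
  shows "\<exists>g\<in>Q_ball \<inter> A_ball. (f \<in> Q_tilde_ball \<longrightarrow> g \<in> Q_tilde_ball) \<and>
    (\<forall>z\<in>unit_ball. dist (g z) (f z) < e)"
proof -
  let ?n = "real CARD('n)"
  note hf = Q_ball_hol(2)[OF f]
  \<comment> \<open>With \<open>\<rho> \<ge> 1 / 2\<close> and
    \<open>1 - \<rho> \<le> e / 32\<close>, the dilation error is at most
    \<open>e / 4\<close>.\<close>
  define \<rho> where "\<rho> = 1 - min (1 / 2) (e / 32)"
  have \<rho>: "0 < \<rho>" "\<rho> < 1" "1 / 2 \<le> \<rho>" "1 - \<rho> \<le> e / 32" using e by (auto simp: \<rho>_def)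
  \<comment> \<open>The midpoint between 1 and \<open>1 / \<rho>\<close>: the dilated map still
    lives on this ball, and the margin \<open>r - 1\<close> serves both Cauchy's estimate and the
    decay of coefficients.\<close>
  define r where "r = (1 + 1 / \<rho>) / 2"
  have r: "1 < r" "\<rho> * r < 1" using \<rho> by (auto simp: r_def field_simps)
  define c where "c = complex_of_real \<rho>"
  have c: "c \<noteq> 0" "norm c = \<rho>" using \<rho> by (auto simp: c_def)
  define F where "F z = inverse c *s f (c *s z)" for z
  define S where "S = {z :: complex ^ 'n. c *s z \<in> unit_ball}"
  have "open ((\<lambda>z. c *s z) -` unit_ball :: (complex ^ 'n) set)"
    by (intro open_vimage open_ball continuous_intros)
  then have S: "open S" by (simp add: S_def vimage_def)
  have rS: "cball 0 r \<subseteq> S"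
  proof
    fix z :: "complex ^ 'n" assume "z \<in> cball 0 r"
    then have "\<rho> * norm z \<le> \<rho> * r" using \<rho> by (intro mult_left_mono) auto
    then show "z \<in> S" using r by (simp add: S_def c)
  qed
  have "0 \<in> S" by (simp add: S_def)
  have F: "holomorphic_map_on F S"
    unfolding F_def[abs_def] S_def by (rule fderiv_cmult_scale(1)[OF open_ball hf, of c 0]) simp
  have dF: "fderiv F z v = fderiv f (c *s z) v" if "z \<in> S" for z v
    using fderiv_cmult_scale(2)[OF open_ball hf, of c z "inverse c" v] that c
    by (simp add: F_def[abs_def] S_def)
  have F0: "F 0 = 0" "fderiv F 0 = id"
    using dF[OF \<open>0 \<in> S\<close>] by (auto simp: F_def Q_ball_zero[OF f] fun_eq_iff)
  define T where "T = (\<Sum>k. real (k + 2) * (deriv_loss CARD('n) (k + 2) / r ^ (k + 2)))"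
  note T_summable = summable_deriv_loss[OF r(1), of "CARD('n)"]
  have T0: "0 \<le> T"
    unfolding T_def using r deriv_loss_pos[of "CARD('n)"]
    by (intro suminf_nonneg T_summable) (auto intro!: mult_nonneg_nonneg divide_nonneg_nonneg simp: less_imp_le)
  \<comment> \<open>One entry for each demand on the approximant: closeness to \<open>f\<close>,
    half of the slack \<open>1 - \<rho>\<close> for the derivative, and all of it for the weighted
    coefficient sum. So a single map serves both classes.\<close>
  define \<eta> where "\<eta> = min (e / 2) (min ((1 - \<rho>) * (r - 1) / (2 * ?n)) ((1 - \<rho>) / (?n * (T + 1))))"
  have \<eta>: "\<eta> > 0" using e \<rho> r T0 by (simp add: \<eta>_def)
  have approx: "\<exists>\<Phi>\<in>Aut_space. \<forall>z. norm z \<le> r \<longrightarrow> norm (\<Phi> z - F z) \<le> \<delta>" if \<delta>: "\<delta> > 0" for \<delta>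
  proof -
    \<comment> \<open>On the ball of radius \<open>R < 1\<close> the Schwarz bound yields the
      uniform contraction constant \<open>c = R\<close>, and \<open>\<rho> * r < R\<close> leaves
      room for approximating on the image of the ball of radius \<open>r\<close>.\<close>
    define R where "R = (1 + \<rho> * r) / 2"
    have R: "\<rho> * r < R" "R < 1" "0 \<le> R" using r \<rho> by (auto simp: R_def)
    have sub: "ball 0 R \<subseteq> (unit_ball :: (complex ^ 'n) set)" using R by auto
    obtain \<Psi> where \<Psi>: "\<Psi> \<in> Aut_space" "\<And>z. norm z \<le> \<rho> * r \<Longrightarrow> norm (\<Psi> z - f z) \<le> \<rho> * \<delta>"
    proof (rule automorphism_approximation[OF n holomorphic_map_subset[OF hf sub] Q_ball_zero(1)[OF f] R(3,2)])
      show "norm (fderiv f z v - v) \<le> R * norm v" if "z \<in> ball 0 R" for z v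
      proof -
        have "norm (fderiv f z v - v) \<le> norm z * norm v"
          using Q_ball_fderiv_bound[OF f] that sub by blast
        also have "\<dots> \<le> R * norm v" using that by (intro mult_right_mono) auto
        finally show ?thesis .
      qed
      show "0 < \<rho> * r" "\<rho> * r < R" "0 < \<rho> * \<delta>" using \<rho> r R \<delta> by auto
    qed blast
    have "(\<lambda>z. inverse c *s \<Psi> (c *s z)) \<in> Aut_space"
      using c by (intro Aut_space_compose[OF Aut_space_cmult] Aut_space_compose[OF \<Psi>(1)] Aut_space_cmult) auto
    moreover have "norm (inverse c *s \<Psi> (c *s z) - F z) \<le> \<delta>" if "norm z \<le> r" for z
    proof -
      have "norm (c *s z) \<le> \<rho> * r" using that \<rho> by (simp add: c mult_left_mono)
      then have "norm (\<Psi> (c *s z) - f (c *s z)) \<le> \<rho> * \<delta>" by (rule \<Psi>(2))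
      then have "norm (inverse c *s (\<Psi> (c *s z) - f (c *s z))) \<le> inverse \<rho> * (\<rho> * \<delta>)"
        unfolding norm_vector_scalar_mult norm_inverse c using \<rho> by (intro mult_left_mono) auto
      moreover have "inverse \<rho> * (\<rho> * \<delta>) = \<delta>" using \<rho>(1) by simp
      ultimately show ?thesis by (simp add: F_def vec.scale_right_diff_distrib)
    qed
    ultimately show ?thesis by (intro bexI[of _ "\<lambda>z. inverse c *s \<Psi> (c *s z)"] allI impI)
  qed
  obtain \<Phi> where \<Phi>: "\<Phi> \<in> Aut_space" "\<Phi> 0 = 0" "fderiv \<Phi> 0 = id"
    "\<And>z. norm z \<le> r \<Longrightarrow> norm (\<Phi> z - F z) \<le> \<eta>"
    using normalized_automorphism_approximation[OF F rS _ F0 approx \<eta>] r by auto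
  have \<Phi>U: "holomorphic_map_on \<Phi> UNIV" using \<Phi> by (simp add: Aut_space_def)
  have \<Phi>S: "holomorphic_map_on \<Phi> S" using \<Phi>U by (rule holomorphic_map_subset) simp
  define g where "g = restrict \<Phi> unit_ball"
  have gA: "g \<in> A_ball" using \<Phi> by (simp add: A_ball_def g_def)
  have gd: "fderiv g z = fderiv \<Phi> z" if "z \<in> unit_ball" for z
    by (rule fderiv_cong_open[OF open_ball that]) (simp add: g_def)
  have "holomorphic_map_on \<Phi> unit_ball" using \<Phi>U by (rule holomorphic_map_subset) simp
  then have "holomorphic_map_on g unit_ball"
    using holomorphic_map_cong_open[OF open_ball, of 0 1 g \<Phi>] by (simp add: g_def)
  then have gh: "g \<in> hol_maps" by (simp add: hol_maps_def g_def)
  have gQ: "g \<in> Q_ball"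
  proof (rule Q_ballI[OF gh])
    show "g 0 = 0" "fderiv g 0 = id" using \<Phi> gd[of 0] by (simp_all add: g_def)
    show "\<rho> + (1 - \<rho>) / 2 < 1" using \<rho>(2) by argo
    fix z v assume z: "z \<in> (unit_ball :: (complex ^ 'n) set)"
    have zr: "cball z (r - 1) \<subseteq> cball 0 r"
    proof
      fix x assume "x \<in> cball z (r - 1)"
      then show "x \<in> cball 0 r" using z dist_triangle[of 0 x z] by simp
    qed
    have "z \<in> cball 0 r" using z r by simp
    with rS have zS: "z \<in> S" by (rule subsetD)
    have "norm (fderiv (\<lambda>z. \<Phi> z - F z) z v) \<le> ?n * \<eta> / (r - 1) * norm v"
      by (rule holomorphic_map_fderiv_bound[OF holomorphic_map_diff[OF \<Phi>S F] subset_trans[OF zr rS]])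
        (use zr \<Phi> r in auto)
    also have "\<dots> \<le> (1 - \<rho>) / 2 * norm v"
    proof (intro mult_right_mono)
      have "\<eta> \<le> (1 - \<rho>) * (r - 1) / (2 * ?n)" by (simp add: \<eta>_def)
      then show "?n * \<eta> / (r - 1) \<le> (1 - \<rho>) / 2" using r by (simp add: field_simps)
    qed simp
    also have "fderiv (\<lambda>z. \<Phi> z - F z) z v = fderiv g z v - fderiv f (c *s z) v"
      by (simp add: fderiv_diff_fun[OF \<Phi>S F zS] gd[OF z] dF[OF zS])
    finally have 1: "norm (fderiv g z v - fderiv f (c *s z) v) \<le> (1 - \<rho>) / 2 * norm v" .
    have "norm (fderiv f (c *s z) v - v) \<le> norm (c *s z) * norm v"
      by (rule Q_ball_fderiv_bound[OF f]) (use zS in \<open>simp add: S_def\<close>)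
    also have "\<dots> \<le> \<rho> * norm v"
      using z \<rho> by (intro mult_right_mono) (auto simp: c mult_left_le)
    finally have 2: "norm (fderiv f (c *s z) v - v) \<le> \<rho> * norm v" .
    from norm_triangle_mono[OF 1 2] show "norm (fderiv g z v - v) \<le> (\<rho> + (1 - \<rho>) / 2) * norm v"
      by (simp add: distrib_right add.commute)
  qed
  have close: "dist (g z) (f z) < e" if z: "z \<in> unit_ball" for z
  proof -
    have "norm (F z - f z) \<le> 4 * (1 - \<rho>) / \<rho>"
      unfolding F_def c_def by (rule Q_ball_dilation_estimate[OF f \<rho>(1,2) z])
    also have "\<dots> \<le> 4 * (e / 32) / (1 / 2)" using \<rho> e by (intro frac_le mult_left_mono) auto
    also have "\<dots> < e / 2" using e by simp
    finally have "norm (F z - f z) < e / 2" .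
    moreover have "norm (\<Phi> z - F z) \<le> e / 2"
      using \<Phi>(4)[of z] z r by (simp add: \<eta>_def)
    ultimately show ?thesis
      using norm_triangle_ineq[of "\<Phi> z - F z" "F z - f z"] z by (simp add: g_def dist_norm)
  qed
  have tilde: "g \<in> Q_tilde_ball" if ft: "f \<in> Q_tilde_ball"
  proof (rule Q_tilde_ballI[OF gQ])
    fix N
    \<comment> \<open>Derivatives at 0 see only values in the ball, so restricting
      \<open>\<Phi>\<close> does not change the coefficients.\<close>
    have tc: "taylor_coeff g = taylor_coeff \<Phi>"
      unfolding taylor_coeff_def[abs_def]
      by (intro ext arg_cong[of _ _ "\<lambda>x. x /\<^sub>R _"] higher_deriv_cong_open[OF open_ball, of 0 0 1]) (simp_all add: g_def)
    have mF: "taylor_norm F (Suc k) \<le> \<rho> ^ k * taylor_norm f (Suc k)" for k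
    proof (rule multilinear_norm_le)
      fix vs :: "(complex ^ 'n) list" assume vs: "length vs = Suc k" "\<forall>v\<in>set vs. norm v \<le> 1"
      have "higher_deriv F vs 0 = (inverse c * c ^ length vs) *s higher_deriv f vs (c *s 0)"
        unfolding F_def[abs_def] by (rule higher_deriv_cmult_scale[OF open_ball hf]) simp
      also have "inverse c * c ^ length vs = c ^ k" using c by (simp add: vs)
      finally have "taylor_coeff F vs = c ^ k *s taylor_coeff f vs"
        by (simp add: taylor_coeff_def vec_eq_iff)
      then have "norm (taylor_coeff F vs) = \<rho> ^ k * norm (taylor_coeff f vs)"
        by (simp only: norm_vector_scalar_mult norm_power c)
      also have "\<dots> \<le> \<rho> ^ k * taylor_norm f (Suc k)"
        using norm_le_multilinear_norm[OF open_ball hf _ vs(2)] \<rho> by (intro mult_left_mono) (auto simp: vs)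
      finally show "norm (taylor_coeff F vs) \<le> \<rho> ^ k * taylor_norm f (Suc k)" .
    qed
    have bound: "taylor_norm g (k + 2)
        \<le> \<rho> * taylor_norm f (k + 2) + ?n * \<eta> * (deriv_loss CARD('n) (k + 2) / r ^ (k + 2))" for k
    proof -
      have "taylor_norm g (k + 2)
          \<le> taylor_norm F (k + 2) + ?n * \<eta> * deriv_loss CARD('n) (k + 2) / r ^ (k + 2)"
        unfolding tc by (rule multilinear_norm_perturbation[OF S \<Phi>S F _ rS \<Phi>(4)]) (use r in auto)
      moreover have "taylor_norm F (k + 2) \<le> \<rho> ^ Suc k * taylor_norm f (k + 2)"
        using mF[of "Suc k"] by simp
      moreover have "\<rho> ^ Suc k * taylor_norm f (k + 2) \<le> \<rho> * taylor_norm f (k + 2)"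
        using \<rho> multilinear_norm_nonneg[OF open_ball hf]
        by (intro mult_right_mono) (auto intro!: mult_left_le power_le_one)
      ultimately show ?thesis by simp
    qed
    have "(\<Sum>k<N. real (k + 2) * taylor_norm g (k + 2))
        \<le> (\<Sum>k<N. real (k + 2) * (\<rho> * taylor_norm f (k + 2)
          + ?n * \<eta> * (deriv_loss CARD('n) (k + 2) / r ^ (k + 2))))"
      by (intro sum_mono mult_left_mono bound) simp
    also have "\<dots> = \<rho> * (\<Sum>k<N. real (k + 2) * taylor_norm f (k + 2))
        + ?n * \<eta> * (\<Sum>k<N. real (k + 2) * (deriv_loss CARD('n) (k + 2) / r ^ (k + 2)))"
      unfolding sum_distrib_left sum.distrib[symmetric] by (intro sum.cong refl) (simp only: distrib_left mult_ac)
    \<comment> \<open>The dilated map takes at most \<open>\<rho>\<close> of the admissible sum 1,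
      and the error fits into the rest.\<close>
    also have "\<dots> \<le> \<rho> * 1 + ?n * \<eta> * T"
    proof (intro add_mono mult_left_mono Q_tilde_ball_partial_sum[OF ft])
      show "(\<Sum>k<N. real (k + 2) * (deriv_loss CARD('n) (k + 2) / r ^ (k + 2))) \<le> T"
        unfolding T_def using r deriv_loss_pos[of "CARD('n)"]
        by (intro sum_le_suminf T_summable) (auto intro!: mult_nonneg_nonneg divide_nonneg_nonneg simp: less_imp_le)
    qed (use \<rho> \<eta> in auto)
    also have "?n * \<eta> * T \<le> 1 - \<rho>"
    proof -
      have "\<eta> \<le> (1 - \<rho>) / (?n * (T + 1))" by (simp add: \<eta>_def)
      moreover have "?n * (T + 1) > 0" using T0 by simp
      ultimately have "\<eta> * (?n * (T + 1)) \<le> 1 - \<rho>" by (simp only: pos_le_divide_eq)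
      then have "?n * \<eta> * (T + 1) \<le> 1 - \<rho>" by (simp only: mult_ac)
      moreover have "?n * \<eta> * T \<le> ?n * \<eta> * (T + 1)" using \<eta> by (intro mult_left_mono) auto
      ultimately show ?thesis by linarith
    qed
    finally show "(\<Sum>k<N. real (k + 2) * taylor_norm g (k + 2)) \<le> 1" by simp
  qed
  show ?thesis by (intro bexI[of _ g] conjI ballI impI IntI gQ gA tilde close)
qed

theorem theorem1p4:
  assumes "CARD('n::finite) \<ge> 2"
  shows "(Q_ball :: 'n selfmap set) = hol_topology closure_of (Q_ball \<inter> A_ball) \<and>
    (Q_tilde_ball :: 'n selfmap set) = hol_topology closure_of (Q_tilde_ball \<inter> A_ball)"
proof (intro conjI equalityI subsetI)
  fix f :: "'n selfmap"
  show "f \<in> hol_topology closure_of (Q_ball \<inter> A_ball)" if f: "f \<in> Q_ball"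
    unfolding closure_of_hol_topology_iff
  proof (intro conjI allI impI Q_ball_hol(1)[OF f])
    fix K :: "(complex ^ 'n) set" and e :: real
    assume K: "compact K \<and> K \<subseteq> unit_ball \<and> e > 0"
    then obtain g where g: "g \<in> Q_ball \<inter> A_ball" "\<forall>z\<in>unit_ball. dist (g z) (f z) < e"
      using Q_ball_automorphism_dense[OF assms f, of e] by auto
    then show "\<exists>g\<in>Q_ball \<inter> A_ball \<inter> hol_maps. \<forall>z\<in>K. dist (g z) (f z) < e"
      using K Q_ball_hol(1)[of g] by (intro bexI[of _ g]) auto
  qed
  show "f \<in> hol_topology closure_of (Q_tilde_ball \<inter> A_ball)" if ft: "f \<in> Q_tilde_ball"
    unfolding closure_of_hol_topology_iff
  proof (intro conjI allI impI)
    have f: "f \<in> Q_ball" using ft by (simp add: Q_tilde_ball_def)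
    then show "f \<in> hol_maps" by (rule Q_ball_hol(1))
    fix K :: "(complex ^ 'n) set" and e :: real
    assume K: "compact K \<and> K \<subseteq> unit_ball \<and> e > 0"
    then obtain g where g: "g \<in> Q_ball \<inter> A_ball" "g \<in> Q_tilde_ball" "\<forall>z\<in>unit_ball. dist (g z) (f z) < e"
      using Q_ball_automorphism_dense[OF assms f, of e] ft by auto
    then show "\<exists>g\<in>Q_tilde_ball \<inter> A_ball \<inter> hol_maps. \<forall>z\<in>K. dist (g z) (f z) < e"
      using K Q_ball_hol(1)[of g] by (intro bexI[of _ g]) auto
  qed
qed (auto elim: Q_ball_closed Q_tilde_ball_closed)

end
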